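(* Let $\Omega$ be a bounded Lipschitz domain in $\mathbb{R}^d$, $d\ge2$. Let $T$ be a bounded linear operator from $L^2_\sigma(\Omega)$ to $L^2(\Omega;\mathbb{C}^d)$. Suppose that $$\|Tu\|_{L^2(\Omega)}\le M_2\|u\|_{L^2(\Omega)}\ \text{ for } u\in L^2_\sigma(\Omega),\qquad \|Tu\|_{L^\infty(\Omega)}\le M_\infty\|u\|_{L^\infty(\Omega)}\ \text{ for } u\in C^\infty_{0,\sigma}(\Omega).$$ Then $T$ is bounded from $L^p_\sigma(\Omega)$ to $L^p(\Omega;\mathbb{C}^d)$ for any $2<p\le\infty$, and $$\|Tu\|_{L^p(\Omega)}\le C_p\,M_2^{\theta}M_\infty^{1-\theta}\|u\|_{L^p(\Omega)}\quad\text{for any }u\in L^p_\sigma(\Omega),$$ where $\theta=\frac2p$ (so $\theta=0$ if $p=\infty$) and $C_p$ depends only on $p$ and $\Omega$.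
   Context: For $1\le p\le\infty$, $L^p_\sigma(\Omega)=\{u\in L^p(\Omega;\mathbb{C}^d): \int_\Omega u\cdot\nabla\varphi=0\text{ for all }\varphi\in C_0^\infty(\mathbb{R}^d;\mathbb{C})\}$. $C^\infty_{0,\sigma}(\Omega)$ is the space of $u\in C_0^\infty(\Omega;\mathbb{C}^d)$ with $\operatorname{div}u=0$ in $\Omega$. Since $\Omega$ is bounded, $L^p_\sigma(\Omega)\subset L^2_\sigma(\Omega)$ for $p\ge2$. *)

theory Defs
  imports "HOL-Analysis.Analysis" "HOL-Probability.Essential_Supremum"
begin

section \<open>Lipschitz domains\<close>

text \<open>
  A domain is a nonempty connected open set. Near each boundary point the set is the part above
  a Lipschitz graph in a rotated coordinate system. The rotation enters only through its vertical
  direction, the unit vector \<open>e\<close>: a point \<open>y\<close> has height \<open>y \<bullet> e\<close> and horizontal part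
  \<open>y - (y \<bullet> e) *\<^sub>R e\<close>, and the graph function \<open>\<psi>\<close> matters only on the hyperplane orthogonal
  to \<open>e\<close>, which plays the role of the (d-1)-dimensional coordinate space.
\<close>

definition lipschitz_domain :: "(real^'n) set \<Rightarrow> bool" where
  "lipschitz_domain \<Omega> \<longleftrightarrow>
     open \<Omega> \<and> connected \<Omega> \<and> \<Omega> \<noteq> {} \<and>
     (\<forall>x\<^sub>0 \<in> frontier \<Omega>. \<exists>r>0. \<exists>e \<psi> L.
        norm e = 1 \<and> L-lipschitz_on {z. z \<bullet> e = 0} (\<psi> :: real^'n \<Rightarrow> real) \<and>
        (\<forall>y \<in> ball x\<^sub>0 r. y \<in> \<Omega> \<longleftrightarrow> \<psi> (y - (y \<bullet> e) *\<^sub>R e) < y \<bullet> e))"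


section \<open>Smooth functions and test functions\<close>

definition partial :: "'n \<Rightarrow> (real^'n \<Rightarrow> 'b::real_normed_vector) \<Rightarrow> real^'n \<Rightarrow> 'b" where
  "partial i f x = frechet_derivative f (at x) (axis i 1)"

primrec C_k :: "nat \<Rightarrow> (real^'n \<Rightarrow> 'b::real_normed_vector) \<Rightarrow> bool" where
  "C_k 0 f \<longleftrightarrow> continuous_on UNIV f"
| "C_k (Suc k) f \<longleftrightarrow> f differentiable_on UNIV \<and> (\<forall>i. C_k k (partial i f))"

text \<open>Elements of \<open>C\<^sub>0\<^sup>\<infinity>(\<Omega>)\<close> are represented by their extension by zero to the whole space.\<close>

definition test_functions :: "(real^'n) set \<Rightarrow> (real^'n \<Rightarrow> 'b::real_normed_vector) set" where
  "test_functions \<Omega> =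
     {f. (\<forall>k. C_k k f) \<and> compact (closure {x. f x \<noteq> 0}) \<and> closure {x. f x \<noteq> 0} \<subseteq> \<Omega>}"

definition divergence :: "(real^'n \<Rightarrow> complex^'n) \<Rightarrow> real^'n \<Rightarrow> complex" where
  "divergence u x = (\<Sum>i\<in>UNIV. partial i (\<lambda>y. u y $ i) x)"

definition sol_test_functions :: "(real^'n) set \<Rightarrow> (real^'n \<Rightarrow> complex^'n) set" where
  "sol_test_functions \<Omega> = {u \<in> test_functions \<Omega>. \<forall>x\<in>\<Omega>. divergence u x = 0}"


section \<open>Lebesgue spaces\<close>

text \<open>
  Elements of \<open>L\<^sup>p(\<Omega>)\<close>, for \<open>1 \<le> p \<le> \<infinity>\<close>, are represented by functions on the whole space of
  which only the values on \<open>\<Omega>\<close>, up to null sets, matter. The exponent is an extended nonnegative real.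
  The number \<open>Lp_norm p \<Omega> u\<close> is meaningful only for \<open>u \<in> Lp p \<Omega>\<close>.
\<close>

definition Lp :: "ennreal \<Rightarrow> (real^'n) set \<Rightarrow> (real^'n \<Rightarrow> 'b::euclidean_space) set" where
  "Lp p \<Omega> = {u \<in> borel_measurable (lebesgue_on \<Omega>).
     if p = \<infinity> then esssup (lebesgue_on \<Omega>) (\<lambda>x. ennreal (norm (u x))) < \<infinity>
     else integrable (lebesgue_on \<Omega>) (\<lambda>x. norm (u x) powr enn2real p)}"

definition Lp_norm :: "ennreal \<Rightarrow> (real^'n) set \<Rightarrow> (real^'n \<Rightarrow> 'b::euclidean_space) \<Rightarrow> real" where
  "Lp_norm p \<Omega> u =
     (if p = \<infinity> then enn2real (esssup (lebesgue_on \<Omega>) (\<lambda>x. ennreal (norm (u x))))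
      else (LINT x|lebesgue_on \<Omega>. norm (u x) powr enn2real p) powr (1 / enn2real p))"

text \<open>
  The product of \<open>u\<close> with the gradient of \<open>\<phi>\<close> is bilinear, without conjugation. Its integral
  exists because the gradient is bounded with compact support.
\<close>

definition Lp_sol :: "ennreal \<Rightarrow> (real^'n) set \<Rightarrow> (real^'n \<Rightarrow> complex^'n) set" where
  "Lp_sol p \<Omega> = {u \<in> Lp p \<Omega>. \<forall>\<phi> \<in> test_functions UNIV.
     (LINT x|lebesgue_on \<Omega>. (\<Sum>i\<in>UNIV. u x $ i * partial i \<phi> x)) = 0}"

text \<open>
  Bounded complex-linear operators from \<open>Lp_sol p \<Omega>\<close> to \<open>Lp p \<Omega>\<close>, given by their action on
  representatives: equality is equality almost everywhere in \<open>\<Omega>\<close>. The operation \<open>*s\<close> is scalar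
  multiplication by a complex number.
\<close>

definition bounded_operator ::
  "ennreal \<Rightarrow> (real^'n) set \<Rightarrow> ((real^'n \<Rightarrow> complex^'n) \<Rightarrow> real^'n \<Rightarrow> complex^'n) \<Rightarrow> bool" where
  "bounded_operator p \<Omega> T \<longleftrightarrow>
     (\<forall>u \<in> Lp_sol p \<Omega>. T u \<in> Lp p \<Omega>) \<and>
     (\<forall>u \<in> Lp_sol p \<Omega>. \<forall>v \<in> Lp_sol p \<Omega>.
        (AE x in lebesgue_on \<Omega>. u x = v x) \<longrightarrow> (AE x in lebesgue_on \<Omega>. T u x = T v x)) \<and>
     (\<forall>u \<in> Lp_sol p \<Omega>. \<forall>v \<in> Lp_sol p \<Omega>.
        AE x in lebesgue_on \<Omega>. T (\<lambda>y. u y + v y) x = T u x + T v x) \<and>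
     (\<forall>c. \<forall>u \<in> Lp_sol p \<Omega>. AE x in lebesgue_on \<Omega>. T (\<lambda>y. c *s u y) x = c *s T u x) \<and>
     (\<exists>K. \<forall>u \<in> Lp_sol p \<Omega>. Lp_norm p \<Omega> (T u) \<le> K * Lp_norm p \<Omega> u)"

end

theory Submission
  imports Defs
begin

text \<open>
  Extended by zero, a field in \<open>L\<^sup>p\<^sub>\<sigma>(\<Omega>)\<close> is divergence free on the whole space, and pushing a divergence-free
  field forward under a smooth map keeps it divergence free. Let \<open>V\<close> be a smooth field pointing into \<open>\<Omega>\<close>
  along the boundary. Averaging the push-forwards of \<open>u\<close> under \<open>x \<mapsto> x + \<delta>(x)(V(x) + z)\<close> over small \<open>z\<close>
  preserves weak divergence freeness and the support in \<open>\<Omega>\<close>, and where \<open>\<delta>(y) > 0\<close> the value at \<open>y\<close> is at most a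
  multiple of the mean of \<open>|u|\<close> over a ball of radius comparable to \<open>\<delta>(y)\<close>.

  For constant \<open>\<delta>\<close> tending to 0 this approximates \<open>u\<close> by solenoidal test functions with controlled norms,
  which settles \<open>p = \<infinity>\<close>. For \<open>u\<close> a solenoidal test function and \<open>\<delta>\<close> a mollified small multiple of the distance to
  the complement of \<open>F = {Mu > s}\<close>, with \<open>M\<close> the maximal operator, it yields a field \<open>g\<close> in \<open>L\<^sup>\<infinity>\<^sub>\<sigma>(\<Omega>)\<close> with
  \<open>|g| \<le> C s\<close>, \<open>g = u\<close> off \<open>F\<close>, and \<open>\<parallel>u - g\<parallel>\<^sup>2\<close> in \<open>L\<^sup>2\<close> bounded by the integral of \<open>C |u|\<^sup>2\<close> over
  \<open>{|u| > s / 2}\<close>. As \<open>Tg\<close> is bounded by the case \<open>p = \<infinity>\<close>, Chebyshev's inequality for \<open>T(u - g)\<close> controls the level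
  sets of \<open>Tu\<close>, and integrating over \<open>s\<close> as in Marcinkiewicz' theorem gives \<open>2 < p < \<infinity>\<close>; the general \<open>u\<close> follows by
  approximation and Fatou's lemma.
\<close>


section \<open>Smooth functions\<close>

text \<open>Cutting \<open>u\<close> off at height \<open>s\<close>, as interpolation usually does,
  destroys divergence freeness, and \<open>T\<close> acts on solenoidal fields only. So mass is
  moved instead of cut. A single push-forward would merely carry the large values of
  \<open>u\<close> elsewhere; averaging over \<open>z\<close> replaces them by a volume mean, and a
  mean over a ball comparable to the distance from the complement of \<open>F\<close> is at most a
  multiple of \<open>s\<close>, because an enlarged ball reaches a point where
  \<open>Mu \<le> s\<close>. The same displacement must respect \<Omega>, which is why
  \<open>V\<close> enters. Where \<delta> vanishes nothing moves; since \<delta> is nonnegative its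
  gradient vanishes there too, so the moved and the unmoved part fit together without a boundary
  term. The chain rule wants \<delta> smooth, but mollification ruins its comparability with the
  distance in a thin layer inside \<open>F\<close>. There the Lipschitz bound of the test function
  \<open>u\<close> takes over; the thickness of the layer depends on \<open>u\<close>, the constants
  do not.\<close>

lemma partial_eq: "(f has_derivative D) (at x) \<Longrightarrow> partial i f x = D (axis i 1)"
  unfolding partial_def by (metis frechet_derivative_at)

lemma C_k_Suc_D: "C_k (Suc k) f \<Longrightarrow> C_k k f"
proof (induction k arbitrary: f)
  case 0
  then show ?case by (auto intro: differentiable_imp_continuous_on)
next
  case (Suc k)
  then show ?case by auto
qed

lemma C_k_differentiable: "C_k (Suc k) f \<Longrightarrow> f differentiable (at x)"
  by (simp add: differentiable_on_def)

lemma C_k_has_derivative: "C_k (Suc k) f \<Longrightarrow> (f has_derivative frechet_derivative f (at x)) (at x)"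
  using C_k_differentiable frechet_derivative_works by blast

lemma vec_eq_sum_axis: "(h::real^'n) = (\<Sum>j\<in>UNIV. (h $ j) *\<^sub>R axis j 1)"
  by (simp add: vec_eq_iff axis_def if_distrib if_distribR sum.delta' cong: if_cong)

lemma C_k_has_derivative_partial:
  assumes "C_k (Suc k) f"
  shows "(f has_derivative (\<lambda>h. \<Sum>j\<in>UNIV. (h $ j) *\<^sub>R partial j f x)) (at x)"
proof -
  let ?D = "frechet_derivative f (at x)"
  have d: "(f has_derivative ?D) (at x)" using C_k_has_derivative[OF assms] .
  then interpret bounded_linear ?D by (rule has_derivative_bounded_linear)
  have "?D h = (\<Sum>j\<in>UNIV. (h $ j) *\<^sub>R partial j f x)" for h
    by (subst vec_eq_sum_axis) (simp add: sum scaleR partial_def)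
  then have "?D = (\<lambda>h. \<Sum>j\<in>UNIV. (h $ j) *\<^sub>R partial j f x)" by blast
  then show ?thesis using d by simp
qed

text \<open>Reads the partial derivatives off a given derivative as its values at the unit vectors.
  The closure properties below are inductions on \<open>k\<close> with this rule, the partials being
  again of the form that the induction hypothesis covers.\<close>

lemma C_k_I:
  assumes "\<And>x. (f has_derivative D x) (at x)" "\<And>i. C_k k (\<lambda>x. D x (axis i 1))"
  shows "C_k (Suc k) f"
proof -
  have "partial i f = (\<lambda>x. D x (axis i 1))" for i using partial_eq[OF assms(1)] by blast
  then show ?thesis using assms by (auto simp: differentiable_on_def differentiable_def intro: has_derivative_at_withinI)
qed

lemma C_k_continuous: "C_k k f \<Longrightarrow> continuous_on S f"
proof (induction k)
  case 0
  then show ?case using continuous_on_subset by auto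
next
  case (Suc k)
  then show ?case using C_k_Suc_D by blast
qed

lemma C_k_const: "C_k k (\<lambda>x. c)"
proof (induction k arbitrary: c)
  case (Suc k)
  show ?case by (rule C_k_I[where D="\<lambda>_ _. 0"]) (auto intro!: derivative_eq_intros Suc)
qed simp

lemma C_k_bounded_linear:
  assumes L: "bounded_linear L" shows "C_k k f \<Longrightarrow> C_k k (\<lambda>x. L (f x))"
proof (induction k arbitrary: f)
  case 0
  then show ?case using bounded_linear.continuous_on[OF L] by simp
next
  case (Suc k)
  show ?case
    by (rule C_k_I[where D="\<lambda>x h. L (frechet_derivative f (at x) h)"])
      (use Suc in \<open>auto intro!: bounded_linear.has_derivative[OF L] C_k_has_derivative simp: partial_def[symmetric]\<close>)
qed

lemma C_k_id: "C_k k (\<lambda>x. x)"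
proof (induction k)
  case (Suc k)
  show ?case by (rule C_k_I[where D="\<lambda>_ h. h"]) (auto intro!: derivative_eq_intros C_k_const)
qed simp

lemma C_k_add: "C_k k f \<Longrightarrow> C_k k g \<Longrightarrow> C_k k (\<lambda>x. f x + g x)"
proof (induction k arbitrary: f g)
  case 0
  then show ?case by (auto intro: continuous_intros)
next
  case (Suc k)
  show ?case
    by (rule C_k_I[where D="\<lambda>x h. frechet_derivative f (at x) h + frechet_derivative g (at x) h"])
      (use Suc in \<open>auto intro!: has_derivative_add C_k_has_derivative simp: partial_def[symmetric]\<close>)
qed

lemma C_k_sum: "(\<And>i. i \<in> A \<Longrightarrow> C_k k (f i)) \<Longrightarrow> C_k k (\<lambda>x. \<Sum>i\<in>A. f i x)"
  by (induction A rule: infinite_finite_induct) (auto intro: C_k_const C_k_add)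

lemma (in bounded_bilinear) C_k_bilinear:
  "C_k k f \<Longrightarrow> C_k k g \<Longrightarrow> C_k k (\<lambda>x. prod (f x) (g x))"
proof (induction k arbitrary: f g)
  case 0
  then show ?case by (auto intro: continuous_on)
next
  case (Suc k)
  have fg: "C_k k f" "C_k k g" using Suc.prems C_k_Suc_D by blast+
  show ?case
    by (rule C_k_I[where D="\<lambda>x h. prod (f x) (frechet_derivative g (at x) h) + prod (frechet_derivative f (at x) h) (g x)"])
      (use Suc fg in \<open>auto intro!: FDERIV C_k_has_derivative C_k_add simp: partial_def[symmetric]\<close>)
qed

lemmas C_k_scaleR = bounded_bilinear.C_k_bilinear[OF bounded_bilinear_scaleR]
lemmas C_k_mult = bounded_bilinear.C_k_bilinear[OF bounded_bilinear_mult]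
lemmas C_k_inner = bounded_bilinear.C_k_bilinear[OF bounded_bilinear_inner]
lemmas C_k_nth = C_k_bounded_linear[OF bounded_linear_vec_nth]
lemmas C_k_of_real = C_k_bounded_linear[OF bounded_linear_of_real]

lemma C_k_minus: "C_k k f \<Longrightarrow> C_k k (\<lambda>x. - f x)"
  by (rule C_k_bounded_linear) (rule bounded_linear_minus[OF bounded_linear_ident])

lemma C_k_diff: "C_k k f \<Longrightarrow> C_k k g \<Longrightarrow> C_k k (\<lambda>x. f x - g x)"
  using C_k_add[of k f "\<lambda>x. - g x"] C_k_minus[of k g] by simp

lemma partial_compose:
  assumes "C_k (Suc k) f" "C_k (Suc l) G"
  shows "partial i (\<lambda>x. f (G x)) x = (\<Sum>j\<in>UNIV. (partial i G x $ j) *\<^sub>R partial j f (G x))"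
    and "((\<lambda>x. f (G x)) has_derivative
       (\<lambda>h. \<Sum>j\<in>UNIV. (frechet_derivative G (at x) h $ j) *\<^sub>R partial j f (G x))) (at x)"
proof -
  show *: "((\<lambda>x. f (G x)) has_derivative
       (\<lambda>h. \<Sum>j\<in>UNIV. (frechet_derivative G (at x) h $ j) *\<^sub>R partial j f (G x))) (at x)"
    using has_derivative_compose[OF C_k_has_derivative[OF assms(2)] C_k_has_derivative_partial[OF assms(1)]]
    by simp
  show "partial i (\<lambda>x. f (G x)) x = (\<Sum>j\<in>UNIV. (partial i G x $ j) *\<^sub>R partial j f (G x))"
    using partial_eq[OF *] by (simp add: partial_def)
qed

lemma C_k_compose:
  "C_k k f \<Longrightarrow> C_k k G \<Longrightarrow> C_k k (\<lambda>x. f (G x))"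
proof (induction k arbitrary: f)
  case 0
  then show ?case by (auto intro: continuous_on_compose2)
next
  case (Suc k)
  have G: "C_k k G" using Suc.prems C_k_Suc_D by blast
  show ?case
    by (rule C_k_I[OF partial_compose(2)[OF Suc.prems]])
      (use Suc G in \<open>auto intro!: C_k_sum C_k_scaleR C_k_nth simp: partial_def[symmetric]\<close>)
qed

text \<open>The outer function lives on \<open>real\<close>, outside the scope of
  \<open>C_k\<close>, so its iterated derivatives are supplied as a sequence. The index
  \<open>m\<close> is generalised in the induction because each differentiation shifts it by
  one.\<close>

lemma C_k_chain_real:
  fixes D :: "nat \<Rightarrow> real \<Rightarrow> real"
  assumes D: "\<And>m s. (D m has_real_derivative D (Suc m) s) (at s)"
  shows "C_k k q \<Longrightarrow> C_k k (\<lambda>x. D m (q x))"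
proof (induction k arbitrary: m)
  case 0
  have "continuous_on UNIV (D m)" using D DERIV_continuous_on by blast
  then show ?case using 0 by (auto intro: continuous_on_compose2)
next
  case (Suc k)
  have q: "C_k k q" using Suc.prems C_k_Suc_D by blast
  have "((\<lambda>x. D m (q x)) has_derivative (\<lambda>h. D (Suc m) (q x) * frechet_derivative q (at x) h)) (at x)" for x
    using has_derivative_compose[OF C_k_has_derivative[OF Suc.prems] D[of m, unfolded has_field_derivative_def]] .
  then show ?case
    by (rule C_k_I) (use Suc q in \<open>auto intro!: C_k_mult simp: partial_def[symmetric]\<close>)
qed

lemma partial_bounded_linear:
  assumes "bounded_linear L" "C_k (Suc k) f"
  shows "partial i (\<lambda>x. L (f x)) x = L (partial i f x)"
  using partial_eq[OF bounded_linear.has_derivative[OF assms(1) C_k_has_derivative[OF assms(2)]]]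
  by (simp add: partial_def)

lemma partial_add:
  assumes "C_k (Suc k) f" "C_k (Suc l) g"
  shows "partial i (\<lambda>x. f x + g x) x = partial i f x + partial i g x"
  using partial_eq[OF has_derivative_add[OF C_k_has_derivative[OF assms(1)] C_k_has_derivative[OF assms(2)]]]
  by (simp add: partial_def)

lemma partial_scaleR:
  assumes "C_k (Suc k) f" "C_k (Suc l) g"
  shows "partial i (\<lambda>x. f x *\<^sub>R g x) x = f x *\<^sub>R partial i g x + partial i f x *\<^sub>R g x"
  using partial_eq[OF has_derivative_scaleR[OF C_k_has_derivative[OF assms(1)] C_k_has_derivative[OF assms(2)]]]
  by (simp add: partial_def)

lemma partial_mult:
  fixes f g :: "real^'n \<Rightarrow> 'b::real_normed_algebra"
  assumes "C_k (Suc k) f" "C_k (Suc l) g"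
  shows "partial i (\<lambda>x. f x * g x) x = f x * partial i g x + partial i f x * g x"
  using partial_eq[OF has_derivative_mult[OF C_k_has_derivative[OF assms(1)] C_k_has_derivative[OF assms(2)]]]
  by (simp add: partial_def)

lemma partial_const [simp]: "partial i (\<lambda>x. c) x = 0"
  by (rule partial_eq[where D="\<lambda>_. 0"]) simp

lemma partial_id: "partial i (\<lambda>x. x) x = axis i 1"
  by (rule partial_eq[where D="\<lambda>h. h"]) simp

lemma partial_cong_open:
  assumes "open S" "x \<in> S" "\<And>y. y \<in> S \<Longrightarrow> f y = g y" "C_k (Suc k) f"
  shows "partial i g x = partial i f x"
  using has_derivative_transform_within_open[OF C_k_has_derivative[OF assms(4)] assms(1,2) assms(3)]
  by (auto simp: partial_def dest!: frechet_derivative_at)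

section \<open>Smooth functions of bounded support\<close>

definition smooth :: "(real^'n \<Rightarrow> 'b::real_normed_vector) \<Rightarrow> bool" where
  "smooth f \<longleftrightarrow> (\<forall>k. C_k k f)"

text \<open>For a continuous function this is compact support. Vanishing outside a ball about the
  origin passes to sums and partial derivatives without any handling of closures;
  \<open>smooth\<close> together with \<open>bdd_supp\<close> is membership in the test functions of
  the whole space.\<close>

definition bdd_supp :: "('a::real_normed_vector \<Rightarrow> 'b::zero) \<Rightarrow> bool" where
  "bdd_supp f \<longleftrightarrow> (\<exists>r>0. \<forall>z. r < norm z \<longrightarrow> f z = 0)"

lemma smoothD: "smooth f \<Longrightarrow> C_k k f" by (simp add: smooth_def)

lemma smooth_partial: "smooth f \<Longrightarrow> smooth (partial i f)"
  unfolding smooth_def by (metis C_k.simps(2))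

lemma bdd_supp_partial:
  fixes f :: "real^'n \<Rightarrow> 'b::real_normed_vector"
  assumes "bdd_supp f" shows "bdd_supp (partial i f)"
proof -
  obtain r where r: "r > 0" "\<And>z. r < norm z \<Longrightarrow> f z = 0" using assms by (auto simp: bdd_supp_def)
  have "partial i f z = 0" if "r < norm z" for z
    using partial_cong_open[of "- cball 0 r" z "\<lambda>_. 0" f 0 i] that r by (auto intro: C_k_const)
  then show ?thesis using r(1) by (auto simp: bdd_supp_def)
qed

lemma smooth_continuous: "smooth f \<Longrightarrow> continuous_on S f"
  using smoothD C_k_continuous by blast

lemma smooth_borel: "smooth f \<Longrightarrow> f \<in> borel_measurable borel"
  using smooth_continuous borel_measurable_continuous_onI by blast

lemma bounded_if_bdd_supp:
  fixes f :: "real^'n \<Rightarrow> 'b::real_normed_vector"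
  assumes "continuous_on UNIV f" "bdd_supp f"
  obtains B where "B > 0" "\<And>x. norm (f x) \<le> B"
proof -
  obtain r where r: "r > 0" "\<And>z. r < norm z \<Longrightarrow> f z = 0" using assms by (auto simp: bdd_supp_def)
  have "compact (f ` cball 0 r)" by (rule compact_continuous_image) (use assms continuous_on_subset in auto)
  then obtain B where B: "B > 0" "\<And>x. x \<in> cball 0 r \<Longrightarrow> norm (f x) \<le> B"
    using compact_imp_bounded bounded_pos[of "f ` cball 0 r"] by (metis image_eqI)
  have "norm (f x) \<le> B" for x using B r(2)[of x] by (cases "r < norm x") auto
  then show ?thesis using that B(1) by blast
qed

lemma bdd_supp_integrable:
  fixes f :: "real^'n \<Rightarrow> 'b::euclidean_space"
  assumes f: "continuous_on UNIV f" "bdd_supp f"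
  shows "integrable lborel f"
proof -
  obtain r where r: "r > 0" "\<And>z. r < norm z \<Longrightarrow> f z = 0" using f by (auto simp: bdd_supp_def)
  have "integrable lborel (\<lambda>x. indicator (cball 0 r) x *\<^sub>R f x)"
    by (rule borel_integrable_compact) (use f continuous_on_subset in auto)
  also have "(\<lambda>x. indicator (cball 0 r) x *\<^sub>R f x) = f" using r by (auto simp: indicator_def fun_eq_iff)
  finally show ?thesis .
qed

lemma norm_frechet_partial_le:
  assumes "C_k (Suc k) f" "\<And>j. norm (partial j f x) \<le> B"
  shows "norm (frechet_derivative f (at x) h) \<le> (real CARD('n) * B) * norm (h::real^'n)"
proof -
  have "frechet_derivative f (at x) = (\<lambda>h. \<Sum>j\<in>UNIV. (h $ j) *\<^sub>R partial j f x)"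
    by (rule frechet_derivative_at[OF C_k_has_derivative_partial[OF assms(1), of x], symmetric])
  then have "frechet_derivative f (at x) h = (\<Sum>j\<in>UNIV. (h $ j) *\<^sub>R partial j f x)" by (rule fun_cong)
  then have "norm (frechet_derivative f (at x) h) \<le> (\<Sum>j\<in>UNIV. norm ((h $ j) *\<^sub>R partial j f x))"
    using norm_sum by metis
  also have "\<dots> \<le> (\<Sum>j\<in>(UNIV::'n set). norm h * B)"
    by (intro sum_mono) (use assms(2) in \<open>simp add: mult_mono component_le_norm_cart\<close>)
  finally show ?thesis by (simp add: ac_simps)
qed

lemma lipschitz_if_partial_bounded:
  fixes f :: "real^'n \<Rightarrow> 'b::real_normed_vector"
  assumes "C_k (Suc k) f" "\<And>j x. norm (partial j f x) \<le> B"
  shows "norm (f x - f y) \<le> (real CARD('n) * B) * norm (x - y)"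
proof (rule differentiable_bound[of UNIV])
  show "(f has_derivative frechet_derivative f (at x)) (at x within UNIV)" for x
    using C_k_has_derivative[OF assms(1)] by simp
  show "onorm (frechet_derivative f (at x)) \<le> real CARD('n) * B" for x
    by (rule onorm_le) (rule norm_frechet_partial_le[OF assms])
qed auto

lemma finite_uniform_bound:
  assumes "\<And>j::'n::finite. \<exists>B. \<forall>x. (g j x :: real) \<le> B"
  shows "\<exists>B>0. \<forall>j x. g j x \<le> B"
proof -
  obtain b where b: "\<And>j x. g j x \<le> b j" using assms by metis
  have "g j x \<le> (\<Sum>j\<in>UNIV. \<bar>b j\<bar>) + 1" for j x
    using b[of j x] member_le_sum[of j UNIV "\<lambda>j. \<bar>b j\<bar>"] by auto
  moreover have "(\<Sum>j\<in>UNIV. \<bar>b j\<bar>) + 1 > 0" by (simp add: add_nonneg_pos sum_nonneg)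
  ultimately show ?thesis by blast
qed

lemma smooth_partial_bounded:
  fixes f :: "real^'n \<Rightarrow> 'b::real_normed_vector"
  assumes "smooth f" "bdd_supp f"
  obtains B where "B > 0" "\<And>j x. norm (partial j f x) \<le> B"
proof -
  have "\<exists>B. \<forall>x. norm (partial j f x) \<le> B" for j
    using bounded_if_bdd_supp[OF smooth_continuous[OF smooth_partial[OF assms(1), of j]] bdd_supp_partial[OF assms(2), of j]]
    by blast
  then have "\<exists>B>0. \<forall>j x. norm (partial j f x) \<le> B" by (rule finite_uniform_bound)
  then show ?thesis using that by blast
qed

lemma smooth_lipschitz:
  fixes f :: "real^'n \<Rightarrow> 'b::real_normed_vector"
  assumes "smooth f" "bdd_supp f"
  obtains B where "B > 0" "\<And>x y. norm (f x - f y) \<le> B * norm (x - y)"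
proof -
  obtain B where B: "B > 0" "\<And>j x. norm (partial j f x) \<le> B" using smooth_partial_bounded[OF assms] by metis
  show ?thesis
    by (rule that[of "real CARD('n) * B"])
      (use B lipschitz_if_partial_bounded[OF smoothD[OF assms(1)] B(2)] in auto)
qed

text \<open>Subtract from \<open>f\<close> its linearisation at \<open>z\<close>: the partials being
  Lipschitz, the rest has derivative at most a multiple of \<open>norm h\<close> on
  \<open>cball z (norm h)\<close>. The bound is uniform in \<open>z\<close>, so it can be integrated
  against any integrable weight; this yields differentiation under the integral sign and the
  vanishing of integrals of derivatives.\<close>

lemma smooth_taylor:
  fixes f :: "real^'n \<Rightarrow> 'b::real_normed_vector"
  assumes "smooth f" "bdd_supp f"
  obtains B where "B > 0"
    "\<And>z h. norm (f (z + h) - f z - (\<Sum>j\<in>UNIV. (h $ j) *\<^sub>R partial j f z)) \<le> B * norm h ^ 2"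
proof -
  \<comment> \<open>The Lipschitz constant is encoded as a bound on difference quotients indexed by
    pairs, so that \<open>finite_uniform_bound\<close> yields one constant for all \<open>j\<close>.
    For coinciding points the quotient is 0 by division by zero.\<close>
  have ex: "\<exists>B. \<forall>p. norm (partial j f (fst p) - partial j f (snd p)) / norm (fst p - snd p) \<le> B" for j
  proof -
    obtain B where "B > 0" "\<And>x y. norm (partial j f x - partial j f y) \<le> B * norm (x - y)"
      using smooth_lipschitz[OF smooth_partial[OF assms(1), of j] bdd_supp_partial[OF assms(2), of j]] by blast
    then show ?thesis by (intro exI[of _ B] allI) (auto simp: divide_simps)
  qed
  obtain B where B0: "B > 0" "\<And>j p. norm (partial j f (fst p) - partial j f (snd p)) / norm (fst p - snd p) \<le> B"
  proof -
    have "\<exists>B>0. \<forall>j p. norm (partial j f (fst p) - partial j f (snd p)) / norm (fst p - snd p) \<le> B"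
      by (rule finite_uniform_bound[OF ex])
    then show ?thesis using that by blast
  qed
  have B: "norm (partial j f x - partial j f y) \<le> B * norm (x - y)" for j x y
    using B0(2)[of j "(x,y)"] by (cases "x = y") (auto simp: divide_simps)
  show ?thesis
  proof (rule that[of "real CARD('n) * B"])
    show "real CARD('n) * B > 0" using B0 by simp
    fix z h :: "real^'n"
    define g where "g y = f y - (\<Sum>j\<in>UNIV. ((y - z) $ j) *\<^sub>R partial j f z)" for y
    have g': "(g has_derivative (\<lambda>k. \<Sum>j\<in>UNIV. (k $ j) *\<^sub>R (partial j f y - partial j f z))) (at y)" for y
      unfolding g_def
      by (rule derivative_eq_intros bounded_linear.has_derivative[OF bounded_linear_vec_nth]
        C_k_has_derivative_partial[OF smoothD[OF assms(1)]] refl)+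
       (auto simp: scaleR_diff_right sum_subtractf)
    have "norm (g (z + h) - g z) \<le> (real CARD('n) * (B * norm h)) * norm ((z + h) - z)"
    proof (rule differentiable_bound[of "cball z (norm h)"])
      show "(g has_derivative (\<lambda>k. \<Sum>j\<in>UNIV. (k $ j) *\<^sub>R (partial j f y - partial j f z))) (at y within cball z (norm h))" for y
        using g' has_derivative_at_withinI by blast
      show "z \<in> cball z (norm h)" "z + h \<in> cball z (norm h)" by (auto simp: dist_norm)
      fix y assume y: "y \<in> cball z (norm h)"
      show "onorm (\<lambda>k. \<Sum>j\<in>UNIV. (k $ j) *\<^sub>R (partial j f y - partial j f z)) \<le> real CARD('n) * (B * norm h)"
      proof (rule onorm_le)
        fix k :: "real^'n"
        have "norm (\<Sum>j\<in>UNIV. (k $ j) *\<^sub>R (partial j f y - partial j f z)) \<le> (\<Sum>j\<in>(UNIV::'n set). norm k * (B * norm h))"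
        proof (rule sum_norm_le)
          fix j
          have "norm (partial j f y - partial j f z) \<le> B * norm h"
            using B[of j y z] y B0(1) by (smt (verit) dist_norm mem_cball mult_left_mono norm_minus_commute)
          then show "norm ((k $ j) *\<^sub>R (partial j f y - partial j f z)) \<le> norm k * (B * norm h)"
            using component_le_norm_cart[of k j] by (auto intro!: mult_mono)
        qed
        then show "norm (\<Sum>j\<in>UNIV. (k $ j) *\<^sub>R (partial j f y - partial j f z)) \<le> real CARD('n) * (B * norm h) * norm k"
          by (simp add: ac_simps)
      qed
    qed auto
    then show "norm (f (z + h) - f z - (\<Sum>j\<in>UNIV. (h $ j) *\<^sub>R partial j f z)) \<le> real CARD('n) * B * norm h ^ 2"
      by (simp add: g_def power2_eq_square algebra_simps)
  qed
qed

section \<open>Bump functions and mollifiers\<close>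

text \<open>The classical flat functions at 0. The family is closed under differentiation,
  \<open>p\<close> turning into \<open>X^2 (p - p')\<close>, so every derivative of the case
  \<open>p = 1\<close> is explicit.\<close>

definition exp_flat :: "real poly \<Rightarrow> real \<Rightarrow> real" where
  "exp_flat p s = (if s > 0 then poly p (1 / s) * exp (- (1 / s)) else 0)"

lemma poly_exp_tendsto_0: "((\<lambda>x::real. x ^ k * poly p x / exp x) \<longlongrightarrow> 0) at_top"
proof (induction p arbitrary: k)
  case (pCons a p)
  have "((\<lambda>x::real. a * (x ^ k / exp x) + x ^ Suc k * poly p x / exp x) \<longlongrightarrow> a * 0 + 0) at_top"
    by (intro tendsto_intros tendsto_power_div_exp_0 pCons)
  then show ?case by (simp add: algebra_simps add_divide_distrib)
qed simp

lemma exp_flat_deriv: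
  "(exp_flat p has_real_derivative exp_flat ([:0, 0, 1:] * (p - pderiv p)) s) (at s)"
proof (cases s "0::real" rule: linorder_cases)
  case less
  have "((\<lambda>_. 0) has_real_derivative 0) (at s)" by simp
  then have "(exp_flat p has_real_derivative 0) (at s)"
    by (rule has_field_derivative_transform_within_open[of _ _ _ "{..<0}"]) (use less in \<open>auto simp: exp_flat_def\<close>)
  then show ?thesis using less by (simp add: exp_flat_def)
next
  case greater
  have *: "((\<lambda>s. poly p (1 / s) * exp (- (1 / s))) has_real_derivative
      poly ([:0, 0, 1:] * (p - pderiv p)) (1 / s) * exp (- (1 / s))) (at s)"
    by (rule derivative_eq_intros DERIV_chain2[OF poly_DERIV] refl | use greater in force)+
       (use greater in \<open>simp add: field_simps\<close>)
  have "(exp_flat p has_real_derivative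
      poly ([:0, 0, 1:] * (p - pderiv p)) (1 / s) * exp (- (1 / s))) (at s)"
    by (rule has_field_derivative_transform_within_open[OF *, of "{0<..}"]) (use greater in \<open>auto simp: exp_flat_def\<close>)
  then show ?thesis using greater by (simp add: exp_flat_def)
next
  case equal
  have "((\<lambda>h. exp_flat p h / h) \<longlongrightarrow> 0) (at_right 0)"
  proof -
    \<comment> \<open>With \<open>x = 1 / h\<close> the quotient \<open>exp_flat p h / h\<close> is
      \<open>x * poly p x / exp x\<close>; the factor \<open>x ^ 1\<close> is the division by
      \<open>h\<close>.\<close>
    have "((\<lambda>x::real. x ^ 1 * poly p x / exp x) \<longlongrightarrow> 0) at_top" by (rule poly_exp_tendsto_0)
    then have "((\<lambda>h::real. inverse h ^ 1 * poly p (inverse h) / exp (inverse h)) \<longlongrightarrow> 0) (at_right 0)"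
      using filterlim_compose filterlim_inverse_at_top_right by blast
    then show ?thesis
      by (rule Lim_transform_eventually)
        (auto simp: eventually_at_right_field exp_flat_def exp_minus field_simps intro!: exI[of _ 1])
  qed
  moreover have "((\<lambda>h. exp_flat p h / h) \<longlongrightarrow> 0) (at_left 0)"
    by (rule Lim_transform_eventually[of "\<lambda>_. 0"])
      (auto simp: eventually_at_left_field exp_flat_def intro!: exI[of _ "-1"])
  ultimately have "((\<lambda>h. exp_flat p h / h) \<longlongrightarrow> 0) (at 0)"
    by (simp add: filterlim_at_split)
  then show ?thesis using equal by (simp add: DERIV_def exp_flat_def)
qed

lemma smooth_exp_flat:
  assumes "smooth q" shows "smooth (\<lambda>x. exp_flat 1 (q x))"
proof -
  define D where "D m = exp_flat (((\<lambda>p. [:0, 0, 1:] * (p - pderiv p)) ^^ m) 1)" for m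
  have "(D m has_real_derivative D (Suc m) s) (at s)" for m s
    unfolding D_def using exp_flat_deriv by simp
  then have "C_k k (\<lambda>x. D 0 (q x))" for k using C_k_chain_real smoothD[OF assms] by blast
  then show ?thesis by (simp add: D_def smooth_def)
qed

definition bump :: "real^'n \<Rightarrow> real \<Rightarrow> real^'n \<Rightarrow> real" where
  "bump a r x = exp_flat 1 (r\<^sup>2 - (x - a) \<bullet> (x - a))"

lemma smooth_bump: "smooth (bump a r)"
  unfolding bump_def by (rule smooth_exp_flat)
    (auto simp: smooth_def intro!: C_k_diff C_k_const C_k_inner C_k_id)

lemma bump_nonneg: "bump a r x \<ge> 0" by (simp add: bump_def exp_flat_def)

lemma bump_pos_iff:
  assumes "r > 0" shows "bump a r x > 0 \<longleftrightarrow> x \<in> ball a r"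
proof -
  have "bump a r x > 0 \<longleftrightarrow> norm (x - a) ^ 2 < r ^ 2"
    by (simp add: bump_def exp_flat_def power2_norm_eq_inner)
  also have "\<dots> \<longleftrightarrow> norm (x - a) < r" using assms power_less_imp_less_base[of "norm (x - a)" 2 r] power_strict_mono[of "norm (x - a)" r 2] by auto
  finally show ?thesis by (simp add: dist_norm norm_minus_commute)
qed

lemma bump_eq_0: "r > 0 \<Longrightarrow> x \<notin> ball a r \<Longrightarrow> bump a r x = 0"
  using bump_pos_iff bump_nonneg by (metis order_le_less)

lemma bump_bdd_supp: "r > 0 \<Longrightarrow> bdd_supp (bump (a::real^'n) r)"
  unfolding bdd_supp_def
proof (intro exI[of _ "norm a + r"] conjI allI impI)
  fix z :: "real^'n" assume "r > 0" "norm a + r < norm z"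
  then have "z \<notin> ball a r" using norm_triangle_ineq2[of z a] by (auto simp: dist_norm norm_minus_commute)
  then show "bump a r z = 0" using \<open>r > 0\<close> bump_eq_0 by blast
qed (simp add: add_nonneg_pos)

definition mollifier :: "real \<Rightarrow> (real^'n \<Rightarrow> real) \<Rightarrow> bool" where
  "mollifier r \<rho> \<longleftrightarrow> smooth \<rho> \<and> bdd_supp \<rho> \<and> (\<forall>z. \<rho> z \<ge> 0) \<and> (\<forall>z. norm z \<ge> r \<longrightarrow> \<rho> z = 0) \<and>
     integrable lborel \<rho> \<and> (LINT z|lborel. \<rho> z) = 1"

lemma mollifier_exists:
  assumes "r > 0" shows "\<exists>\<rho> :: real^'n \<Rightarrow> real. mollifier r \<rho>"
proof -
  let ?b = "bump (0::real^'n) r"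
  define c where "c = (LINT z|lborel. ?b z)"
  have i: "integrable lborel ?b"
    using bdd_supp_integrable smooth_continuous smooth_bump bump_bdd_supp assms by blast
  have "c > 0"
  proof -
    have "c \<noteq> 0"
    proof
      assume "c = 0"
      then have "AE z in lborel. ?b z = 0"
        using integral_nonneg_eq_0_iff_AE[OF i] bump_nonneg by (auto simp: c_def)
      then have "AE z in lborel. z \<notin> ball (0::real^'n) r"
        by eventually_elim (use bump_pos_iff[OF assms, of 0] in force)
      then have "ball (0::real^'n) r \<in> null_sets lborel"
        by (subst AE_iff_null_sets) auto
      then have "measure lborel (ball (0::real^'n) r) = 0" by (rule measure_eq_0_null_sets)
      then show False using content_ball_pos[OF assms, of "0::real^'n"] by simp
    qed
    moreover have "c \<ge> 0" unfolding c_def by (rule integral_nonneg_AE) (simp add: bump_nonneg)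
    ultimately show ?thesis by simp
  qed
  have "mollifier r (\<lambda>z. ?b z / c)"
    unfolding mollifier_def
  proof (intro conjI allI impI)
    show "smooth (\<lambda>z. ?b z / c)" unfolding smooth_def
      by (intro allI C_k_bounded_linear[OF bounded_linear_divide] smoothD smooth_bump)
    show "bdd_supp (\<lambda>z. ?b z / c)" using bump_bdd_supp[OF assms, of 0] by (auto simp: bdd_supp_def)
    show "?b z / c \<ge> 0" for z using bump_nonneg[of 0 r z] \<open>c > 0\<close> by simp
    show "?b z / c = 0" if "norm z \<ge> r" for z using bump_eq_0[OF assms, of z 0] that by simp
    show "integrable lborel (\<lambda>z. ?b z / c)" using i by simp
    show "(LINT z|lborel. ?b z / c) = 1" using \<open>c > 0\<close> by (simp add: c_def)
  qed
  then show ?thesis by blast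
qed

section \<open>Smoothing operators and integration by parts\<close>

lemma integrable_kernel:
  fixes \<kappa> :: "real^'n \<Rightarrow> real" and w :: "real^'n \<Rightarrow> 'b::euclidean_space"
  assumes \<kappa>: "smooth \<kappa>" "bdd_supp \<kappa>" and a: "a \<in> borel_measurable borel" and w: "integrable lborel w"
  shows "integrable lborel (\<lambda>x. \<kappa> (y - a x) *\<^sub>R w x)"
proof -
  obtain B where B: "B > 0" "\<And>x. norm (\<kappa> x) \<le> B"
    using bounded_if_bdd_supp[OF smooth_continuous[OF \<kappa>(1)] \<kappa>(2)] by metis
  have [measurable]: "\<kappa> \<in> borel_measurable borel" "a \<in> borel_measurable borel" "w \<in> borel_measurable borel"
    using smooth_borel[OF \<kappa>(1)] a w by auto
  show ?thesis
    by (rule Bochner_Integration.integrable_bound[of _ "\<lambda>x. B *\<^sub>R w x"])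
      (use w B in \<open>auto intro!: mult_right_mono simp: abs_of_pos\<close>)
qed

text \<open>All differentiation falls on \<kappa>, so the centres \<open>a x\<close> are merely
  measurable and the weight merely integrable. With \<open>a x = x\<close> this is mollification;
  with \<open>a\<close> a displacement it is the averaged push-forward for constant \<delta>. The
  uniform Taylor remainder is integrated against \<open>norm (w x)\<close>.\<close>

lemma smoothing_has_derivative:
  fixes \<kappa> :: "real^'n \<Rightarrow> real" and w :: "real^'n \<Rightarrow> 'b::euclidean_space"
  assumes \<kappa>: "smooth \<kappa>" "bdd_supp \<kappa>" and a: "a \<in> borel_measurable borel" and w: "integrable lborel w"
  shows "((\<lambda>y. LINT x|lborel. \<kappa> (y - a x) *\<^sub>R w x) has_derivative
     (\<lambda>h. \<Sum>j\<in>UNIV. (h $ j) *\<^sub>R (LINT x|lborel. partial j \<kappa> (y - a x) *\<^sub>R w x))) (at y)"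
    (is "(?F has_derivative ?D) _")
proof -
  obtain B where B: "B > 0"
    "\<And>z h. norm (\<kappa> (z + h) - \<kappa> z - (\<Sum>j\<in>UNIV. (h $ j) *\<^sub>R partial j \<kappa> z)) \<le> B * norm h ^ 2"
    using smooth_taylor[OF \<kappa>] by blast
  note i = integrable_kernel[OF _ _ a w]
  note i0 = i[OF \<kappa>] and i1 = i[OF smooth_partial[OF \<kappa>(1)] bdd_supp_partial[OF \<kappa>(2)]]
  define W where "W = (LINT x|lborel. norm (w x))"
  have W: "W \<ge> 0" by (simp add: W_def)
  have rem: "norm (?F (y + h) - ?F y - ?D h) \<le> B * W * norm h ^ 2" for h
  proof -
    let ?r = "\<lambda>x. (\<kappa> (y + h - a x) - \<kappa> (y - a x) - (\<Sum>j\<in>UNIV. (h $ j) *\<^sub>R partial j \<kappa> (y - a x))) *\<^sub>R w x"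
    have eq: "?r x = \<kappa> (y + h - a x) *\<^sub>R w x - \<kappa> (y - a x) *\<^sub>R w x
        - (\<Sum>j\<in>UNIV. (h $ j) *\<^sub>R (partial j \<kappa> (y - a x) *\<^sub>R w x))" for x
      by (simp add: scaleR_diff_left scaleR_left.sum)
    have "?F (y + h) - ?F y - ?D h = (LINT x|lborel. ?r x)"
      unfolding eq using i0 i1 by (simp del: scaleR_scaleR)
    also have "norm \<dots> \<le> (LINT x|lborel. (B * norm h ^ 2) * norm (w x))"
    proof (rule Bochner_Integration.integral_norm_bound_integral)
      show "integrable lborel ?r" unfolding eq using i0 i1 by (simp del: scaleR_scaleR)
      show "integrable lborel (\<lambda>x. B * (norm h)\<^sup>2 * norm (w x))" using w by simp
      fix x
      have e: "y + h - a x = y - a x + h" by simp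
      show "norm (?r x) \<le> B * norm h ^ 2 * norm (w x)"
        unfolding norm_scaleR e real_norm_def[symmetric] by (rule mult_right_mono[OF B(2) norm_ge_zero])
    qed
    finally show ?thesis by (simp add: W_def algebra_simps)
  qed
  show ?thesis
    unfolding has_derivative_at_alt
  proof (intro conjI allI impI)
    show "bounded_linear ?D"
      by (intro bounded_linear_sum bounded_linear_scaleR_left[THEN bounded_linear_compose] bounded_linear_vec_nth)
    fix e :: real assume e: "e > 0"
    show "\<exists>d>0. \<forall>z. norm (z - y) < d \<longrightarrow> norm (?F z - ?F y - ?D (z - y)) \<le> e * norm (z - y)"
    proof (intro exI[of _ "e / (B * W + 1)"] conjI allI impI)
      have BW: "B * W + 1 > 0" using B(1) W by (simp add: add_nonneg_pos)
      show "e / (B * W + 1) > 0" using e BW by simp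
      fix z assume z: "norm (z - y) < e / (B * W + 1)"
      have "norm (?F z - ?F y - ?D (z - y)) \<le> B * W * norm (z - y) ^ 2" using rem[of "z - y"] by simp
      also have "\<dots> \<le> (B * W + 1) * norm (z - y) * norm (z - y)"
        unfolding power2_eq_square by (simp add: algebra_simps)
      also have "\<dots> \<le> e * norm (z - y)"
        using z BW by (intro mult_right_mono) (auto simp: field_simps)
      finally show "norm (?F z - ?F y - ?D (z - y)) \<le> e * norm (z - y)" .
    qed
  qed
qed

lemma sum_axis_scaleR: "(\<Sum>j\<in>UNIV. (axis i t $ j) *\<^sub>R g j) = t *\<^sub>R (g (i::'n::finite) :: 'b::real_vector)"
proof -
  have "(\<Sum>j\<in>UNIV. (axis i t $ j) *\<^sub>R g j) = (\<Sum>j\<in>UNIV. if j = i then t *\<^sub>R g i else 0)"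
    by (rule sum.cong) (auto simp: axis_def)
  then show ?thesis by simp
qed

lemma partial_smoothing:
  fixes \<kappa> :: "real^'n \<Rightarrow> real" and w :: "real^'n \<Rightarrow> 'b::euclidean_space"
  assumes "smooth \<kappa>" "bdd_supp \<kappa>" "a \<in> borel_measurable borel" "integrable lborel w"
  shows "partial i (\<lambda>y. LINT x|lborel. \<kappa> (y - a x) *\<^sub>R w x) y = (LINT x|lborel. partial i \<kappa> (y - a x) *\<^sub>R w x)"
proof -
  have "partial i (\<lambda>y. LINT x|lborel. \<kappa> (y - a x) *\<^sub>R w x) y
      = (\<Sum>j\<in>UNIV. (axis i 1 $ j) *\<^sub>R (LINT x|lborel. partial j \<kappa> (y - a x) *\<^sub>R w x))"
    by (rule partial_eq) (rule smoothing_has_derivative[OF assms])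
  also have "\<dots> = 1 *\<^sub>R (LINT x|lborel. partial i \<kappa> (y - a x) *\<^sub>R w x)"
    by (rule sum_axis_scaleR)
  finally show ?thesis by simp
qed

lemma smooth_smoothing:
  fixes \<kappa> :: "real^'n \<Rightarrow> real" and w :: "real^'n \<Rightarrow> 'b::euclidean_space"
  assumes "smooth \<kappa>" "bdd_supp \<kappa>" and a: "a \<in> borel_measurable borel" "integrable lborel w"
  shows "smooth (\<lambda>y. LINT x|lborel. \<kappa> (y - a x) *\<^sub>R w x)"
proof -
  have "C_k k (\<lambda>y. LINT x|lborel. \<kappa> (y - a x) *\<^sub>R w x)" for k
    using assms(1,2)
  proof (induction k arbitrary: \<kappa>)
    case 0
    then have "isCont (\<lambda>y. LINT x|lborel. \<kappa> (y - a x) *\<^sub>R w x) y" for y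
      by (rule has_derivative_continuous[OF smoothing_has_derivative[OF _ _ a]])
    then show ?case by (simp add: continuous_at_imp_continuous_on)
  next
    case (Suc k)
    have "partial i (\<lambda>y. LINT x|lborel. \<kappa> (y - a x) *\<^sub>R w x) = (\<lambda>y. LINT x|lborel. partial i \<kappa> (y - a x) *\<^sub>R w x)" for i
      using partial_smoothing[OF Suc.prems a] by blast
    moreover have "(\<lambda>y. LINT x|lborel. \<kappa> (y - a x) *\<^sub>R w x) differentiable_on UNIV"
      unfolding differentiable_on_def differentiable_def
      by (intro ballI exI) (rule has_derivative_at_withinI[OF smoothing_has_derivative[OF Suc.prems a]])
    ultimately show ?case using Suc.IH[OF smooth_partial[OF Suc.prems(1)] bdd_supp_partial[OF Suc.prems(2)]] by simp
  qed
  then show ?thesis by (simp add: smooth_def)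
qed

lemma lborel_integral_translation:
  fixes f :: "'a::euclidean_space \<Rightarrow> 'b::euclidean_space"
  assumes [measurable]: "f \<in> borel_measurable borel"
  shows "(LINT x|lborel. f (x + c)) = (LINT x|lborel. f x)"
proof -
  have "(LINT x|lborel. f x) = (LINT x|distr lborel borel ((+) c). f x)" by (simp add: lborel_distr_plus)
  also have "\<dots> = (LINT x|lborel. f (x + c))" by (subst integral_distr) (auto simp: add.commute)
  finally show ?thesis by simp
qed

text \<open>By translation invariance \<open>f (x + h) - f x\<close> integrates to 0. For
  \<open>h = axis i t\<close> the integral of \<open>t\<close> times the partial derivative is
  therefore minus that of the Taylor remainder, which is of order \<open>t^2\<close> on the ball of
  radius \<open>r + 1\<close> and vanishes outside it for \<open>t \<le> 1\<close>. Divide by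
  \<open>t\<close> and let it tend to 0.\<close>

lemma integral_partial_eq_0:
  fixes f :: "real^'n \<Rightarrow> 'b::euclidean_space"
  assumes f: "smooth f" "bdd_supp f"
  shows "(LINT x|lborel. partial i f x) = 0"
proof -
  obtain B where B: "B > 0"
    "\<And>z h. norm (f (z + h) - f z - (\<Sum>j\<in>UNIV. (h $ j) *\<^sub>R partial j f z)) \<le> B * norm h ^ 2"
    using smooth_taylor[OF f] by blast
  obtain r where r: "r > 0" "\<And>z. r < norm z \<Longrightarrow> f z = 0" using f(2) by (auto simp: bdd_supp_def)
  let ?I = "LINT x|lborel. partial i f x"
  let ?m = "measure lborel (cball (0::real^'n) (r + 1))"
  have if0: "integrable lborel f" "integrable lborel (partial i f)"
    using bdd_supp_integrable smooth_continuous smooth_partial bdd_supp_partial f by blast+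
  have p0: "partial i f z = 0" if "r < norm z" for z
    using partial_cong_open[of "- cball 0 r" z "\<lambda>_. 0" f 0 i] that r by (auto intro: C_k_const)
  have key: "norm ?I \<le> B * ?m * t" if t: "0 < t" "t \<le> 1" for t
  proof -
    let ?h = "axis i t :: real^'n"
    have nh: "norm ?h = t" using t by (simp add: norm_eq_sqrt_inner inner_axis_axis)
    have "f x = 0" if "r + 1 < norm x" for x using r(2)[of x] that by simp
    have [measurable]: "f \<in> borel_measurable borel" using smooth_borel[OF f(1)] .
    have it: "integrable lborel (\<lambda>x. f (x + ?h))"
    proof (rule bdd_supp_integrable)
      show "continuous_on UNIV (\<lambda>x. f (x + ?h))"
        by (rule continuous_on_compose2[OF smooth_continuous[OF f(1), of UNIV]]) (auto intro!: continuous_intros)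
      have "f (z + ?h) = 0" if "r + 1 < norm z" for z
        using r(2)[of "z + ?h"] that norm_triangle_ineq4[of "z + ?h" ?h] nh t(2) by simp
      then show "bdd_supp (\<lambda>x. f (x + ?h))" unfolding bdd_supp_def using r(1) by (intro exI[of _ "r + 1"]) auto
    qed
    have s: "(\<Sum>j\<in>UNIV. (?h $ j) *\<^sub>R partial j f x) = t *\<^sub>R partial i f x" for x
      by (rule sum_axis_scaleR)
    have "- (t *\<^sub>R ?I) = (LINT x|lborel. f (x + ?h) - f x - t *\<^sub>R partial i f x)"
      using if0 it lborel_integral_translation[of f ?h] by simp
    also have "norm \<dots> \<le> (LINT x::real^'n|lborel. (B * t ^ 2) * indicator (cball 0 (r + 1)) x)"
    proof (rule Bochner_Integration.integral_norm_bound_integral)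
      show "integrable lborel (\<lambda>x. f (x + ?h) - f x - t *\<^sub>R partial i f x)" using if0 it by simp
      show "integrable lborel (\<lambda>x::real^'n. (B * t ^ 2) * indicator (cball 0 (r + 1)) x)"
        by (intro integrable_mult_right integrable_real_indicator emeasure_bounded_finite) auto
      fix x :: "real^'n"
      show "norm (f (x + ?h) - f x - t *\<^sub>R partial i f x) \<le> (B * t ^ 2) * indicator (cball 0 (r + 1)) x"
      proof (cases "norm x \<le> r + 1")
        case True
        then show ?thesis using B(2)[of x ?h] s[of x] nh by simp
      next
        case False
        then have "f x = 0" "partial i f x = 0" "f (x + ?h) = 0"
          using r(2)[of x] p0[of x] r(2)[of "x + ?h"] norm_triangle_ineq4[of "x + ?h" ?h] nh t(2) by auto
        then show ?thesis using False by simp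
      qed
    qed
    finally have "t * norm ?I \<le> B * t ^ 2 * ?m" using t by simp
    then show ?thesis using t by (simp add: power2_eq_square field_simps)
  qed
  have "norm ?I \<le> 0"
  proof (rule field_le_epsilon)
    fix e :: real assume e: "e > 0"
    let ?t = "min 1 (e / (B * ?m + 1))"
    have m: "B * ?m \<ge> 0" using B(1) by simp
    have "norm ?I \<le> B * ?m * ?t" using e m by (intro key) (auto intro!: divide_pos_pos)
    also have "\<dots> \<le> B * ?m * (e / (B * ?m + 1))" using m by (intro mult_left_mono) auto
    also have "\<dots> \<le> e" using m e by (simp add: field_simps)
    finally show "norm ?I \<le> 0 + e" by simp
  qed
  then show ?thesis by simp
qed

section \<open>A smooth field pointing into a Lipschitz domain\<close>

text \<open>The move by \<open>b *\<^sub>R e + z\<close> raises the height by at least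
  \<open>b - norm z\<close>, while the horizontal part moves by at most \<open>2 * norm z\<close>,
  so that the graph rises by at most \<open>2 * L * norm z\<close>. This explains
  \<open>K = 2 * L + 1\<close>. Both ends of the move must stay in the chart ball, but the starting
  point may lie on the boundary.\<close>

lemma lipschitz_chart_push:
  fixes \<Omega> :: "(real^'n) set"
  assumes \<Omega>: "lipschitz_domain \<Omega>" and x0: "x0 \<in> frontier \<Omega>"
  shows "\<exists>r e K. r > 0 \<and> norm e = 1 \<and> K \<ge> 1 \<and>
    (\<forall>y s b z. y \<in> closure \<Omega> \<longrightarrow> y \<in> ball x0 r \<longrightarrow> y + s *\<^sub>R (b *\<^sub>R e + z) \<in> ball x0 r \<longrightarrow> s > 0 \<longrightarrow>
       K * norm z < b \<longrightarrow> y + s *\<^sub>R (b *\<^sub>R e + z) \<in> \<Omega>)"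
proof -
  obtain r e \<psi> L where r: "r > 0" and e: "norm e = 1" and L: "L-lipschitz_on {z. z \<bullet> e = 0} (\<psi> :: real^'n \<Rightarrow> real)"
    and ch: "\<And>y. y \<in> ball x0 r \<Longrightarrow> y \<in> \<Omega> \<longleftrightarrow> \<psi> (y - (y \<bullet> e) *\<^sub>R e) < y \<bullet> e"
    using \<Omega> x0 unfolding lipschitz_domain_def by metis
  have L0: "L \<ge> 0" using L lipschitz_on_nonneg by blast
  define P where "P y = y - (y \<bullet> e) *\<^sub>R e" for y :: "real^'n"
  have ee: "e \<bullet> e = 1" using e by (simp add: norm_eq_1)
  have P0: "P y \<bullet> e = 0" for y by (simp add: P_def inner_diff_left ee)
  define F where "F y = y \<bullet> e - \<psi> (P y)" for y
  have "continuous_on UNIV F" unfolding F_def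
    by (intro continuous_intros continuous_on_compose2[OF lipschitz_on_continuous_on[OF L]])
      (auto simp: P_def inner_diff_left ee intro!: continuous_intros)
  then have opF: "open {y. F y < 0}" by (intro open_Collect_less) auto
  \<comment> \<open>\<open>{y. F y < 0}\<close> is open and misses \<Omega> inside the chart ball,
    hence misses the closure there: boundary points satisfy the graph inequality in its non-strict
    form, and the push makes it strict.\<close>
  have cl: "F y \<ge> 0" if "y \<in> closure \<Omega>" "y \<in> ball x0 r" for y
  proof (rule ccontr)
    assume "\<not> F y \<ge> 0"
    then have "y \<in> {y. F y < 0} \<inter> ball x0 r" using that by auto
    then have "({y. F y < 0} \<inter> ball x0 r) \<inter> closure \<Omega> \<noteq> {}" using that(1) by blast
    then have "({y. F y < 0} \<inter> ball x0 r) \<inter> \<Omega> \<noteq> {}"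
      unfolding open_Int_closure_eq_empty[OF open_Int[OF opF open_ball]] .
    then obtain y2 where y2: "y2 \<in> \<Omega>" "F y2 < 0" "y2 \<in> ball x0 r" by blast
    then show False using ch[OF y2(3)] by (simp add: F_def P_def)
  qed
  have "y + s *\<^sub>R (b *\<^sub>R e + z) \<in> \<Omega>" if y: "y \<in> closure \<Omega>" "y \<in> ball x0 r"
    and w: "y + s *\<^sub>R (b *\<^sub>R e + z) \<in> ball x0 r" and s: "s > 0" and b: "(2 * L + 1) * norm z < b" for y s b z
  proof -
    let ?w = "y + s *\<^sub>R (b *\<^sub>R e + z)"
    have ze: "\<bar>z \<bullet> e\<bar> \<le> norm z" using Cauchy_Schwarz_ineq2[of z e] e by simp
    have "P ?w - P y = s *\<^sub>R P z" by (simp add: P_def inner_add_left ee algebra_simps)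
    moreover have "norm (P z) \<le> 2 * norm z"
      unfolding P_def using norm_triangle_ineq4[of z "(z \<bullet> e) *\<^sub>R e"] ze e by simp
    ultimately have "norm (P ?w - P y) \<le> s * (2 * norm z)" using s by simp
    moreover have "\<bar>\<psi> (P ?w) - \<psi> (P y)\<bar> \<le> L * norm (P ?w - P y)"
      using lipschitz_onD[OF L, of "P ?w" "P y"] P0 by (simp add: dist_norm)
    ultimately have "\<psi> (P ?w) \<le> \<psi> (P y) + L * (s * (2 * norm z))"
      using mult_left_mono[of _ _ L] L0 by fastforce
    moreover have "\<psi> (P y) \<le> y \<bullet> e" using cl[OF y] by (simp add: F_def)
    moreover have "?w \<bullet> e = y \<bullet> e + s * (b + z \<bullet> e)" by (simp add: inner_add_left ee)
    moreover have "s * ((2 * L) * norm z) < s * (b + z \<bullet> e)"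
      using b ze s by (intro mult_strict_left_mono) (auto simp: algebra_simps)
    moreover have "L * (s * (2 * norm z)) = s * ((2 * L) * norm z)" by simp
    ultimately have "\<psi> (P ?w) < ?w \<bullet> e" by linarith
    then show ?thesis using ch[OF w] by (simp add: P_def)
  qed
  then show ?thesis using r e L0 by (intro exI[of _ r] exI[of _ e] exI[of _ "2 * L + 1"]) auto
qed

lemma bdd_supp_add:
  fixes f g :: "'a::real_normed_vector \<Rightarrow> 'b::real_normed_vector"
  assumes "bdd_supp f" "bdd_supp g" shows "bdd_supp (\<lambda>x. f x + g x)"
proof -
  obtain r1 r2 where "r1 > 0" "\<And>z. r1 < norm z \<Longrightarrow> f z = 0" "r2 > 0" "\<And>z. r2 < norm z \<Longrightarrow> g z = 0"
    using assms by (auto simp: bdd_supp_def)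
  then show ?thesis unfolding bdd_supp_def by (intro exI[of _ "max r1 r2"]) auto
qed

lemma bdd_supp_0: "bdd_supp (\<lambda>x. 0)"
  unfolding bdd_supp_def by (intro exI[of _ 1]) auto

lemma bdd_supp_sum:
  fixes f :: "'i \<Rightarrow> 'a::real_normed_vector \<Rightarrow> 'b::real_normed_vector"
  assumes "\<And>i. i \<in> A \<Longrightarrow> bdd_supp (f i)" shows "bdd_supp (\<lambda>x. \<Sum>i\<in>A. f i x)"
  using assms by (induction A rule: infinite_finite_induct) (auto intro: bdd_supp_add bdd_supp_0)

text \<open>\<open>V\<close> is the sum of the chart directions weighted by bumps. Where the total
  weight \<open>N\<close> is small the point is a definite distance inside \<Omega> and every short
  move is harmless; where it is large, a single chart carries a weight that outdoes the perturbation
  \<open>z\<close>.\<close>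

lemma inward_field:
  fixes \<Omega> :: "(real^'n) set"
  assumes b: "bounded \<Omega>" and \<Omega>: "lipschitz_domain \<Omega>"
  shows "\<exists>(V :: real^'n \<Rightarrow> real^'n) \<eta> t0. smooth V \<and> bdd_supp V \<and> \<eta> > 0 \<and> t0 > 0 \<and>
    (\<forall>x s z. x \<in> closure \<Omega> \<longrightarrow> 0 < s \<longrightarrow> s \<le> t0 \<longrightarrow> norm z \<le> \<eta> \<longrightarrow> x + s *\<^sub>R (V x + z) \<in> \<Omega>)"
proof -
  have op: "open \<Omega>" using \<Omega> by (simp add: lipschitz_domain_def)
  obtain r e K where r: "\<And>j. j \<in> frontier \<Omega> \<Longrightarrow> r j > 0" and e: "\<And>j. j \<in> frontier \<Omega> \<Longrightarrow> norm (e j) = 1"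
    and K: "\<And>j. j \<in> frontier \<Omega> \<Longrightarrow> K j \<ge> 1"
    and push: "\<And>j y s b z. j \<in> frontier \<Omega> \<Longrightarrow> y \<in> closure \<Omega> \<Longrightarrow> y \<in> ball j (r j) \<Longrightarrow>
       y + s *\<^sub>R (b *\<^sub>R e j + z) \<in> ball j (r j) \<Longrightarrow> s > 0 \<Longrightarrow> K j * norm z < b \<Longrightarrow> y + s *\<^sub>R (b *\<^sub>R e j + z) \<in> \<Omega>"
    using lipschitz_chart_push[OF \<Omega>] by metis
  have cf: "compact (frontier \<Omega>)" using b compact_frontier_bounded by blast
  \<comment> \<open>Halving the radii leaves room: a point in a halved ball may move by less than
    \<open>rm\<close> and still be in the chart ball.\<close>
  obtain J where J: "J \<subseteq> frontier \<Omega>" "finite J" "frontier \<Omega> \<subseteq> (\<Union>j\<in>J. ball j (r j / 2))"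
  proof (rule compactE_image[OF cf, of "frontier \<Omega>" "\<lambda>j. ball j (r j / 2)"])
    show "frontier \<Omega> \<subseteq> (\<Union>j\<in>frontier \<Omega>. ball j (r j / 2))" using r by fastforce
  qed (use that in auto)
  define \<beta> where "\<beta> j = bump j (r j / 2)" for j
  define N where "N x = (\<Sum>j\<in>J. \<beta> j x)" for x
  define V where "V x = (\<Sum>j\<in>J. \<beta> j x *\<^sub>R e j)" for x
  have r': "r j / 2 > 0" if "j \<in> J" for j using r J that by auto
  have \<beta>0: "\<beta> j x \<ge> 0" for j x by (simp add: \<beta>_def bump_nonneg)
  have \<beta>b: "\<beta> j x > 0 \<longleftrightarrow> x \<in> ball j (r j / 2)" if "j \<in> J" for j x
    using bump_pos_iff[OF r'[OF that]] by (simp add: \<beta>_def)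
  have s\<beta>: "C_k k (\<beta> j)" for k j by (simp add: \<beta>_def smooth_bump smoothD)
  have bs\<beta>: "bdd_supp (\<beta> j)" if "j \<in> J" for j unfolding \<beta>_def by (rule bump_bdd_supp[OF r'[OF that]])
  have sV: "smooth V" unfolding smooth_def V_def by (intro allI C_k_sum C_k_scaleR s\<beta> C_k_const)
  have sN: "smooth N" unfolding smooth_def N_def by (intro allI C_k_sum s\<beta>)
  have bV: "bdd_supp V" unfolding V_def
  proof (rule bdd_supp_sum)
    fix j assume "j \<in> J"
    then show "bdd_supp (\<lambda>x. \<beta> j x *\<^sub>R e j)" using bs\<beta>[of j] by (auto simp: bdd_supp_def)
  qed
  have bN: "bdd_supp N" unfolding N_def by (rule bdd_supp_sum) (rule bs\<beta>)
  obtain BV where BV: "BV > 0" "\<And>x. norm (V x) \<le> BV"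
    using bounded_if_bdd_supp[OF smooth_continuous[OF sV] bV] by blast
  obtain BN where BN: "BN > 0" "\<And>x. norm (N x) \<le> BN"
    using bounded_if_bdd_supp[OF smooth_continuous[OF sN] bN] by blast
  have "\<exists>\<sigma>>0. \<forall>x\<in>frontier \<Omega>. N x \<ge> 2 * \<sigma>"
  proof (cases "frontier \<Omega> = {}")
    case False
    obtain x where x: "x \<in> frontier \<Omega>" "\<And>y. y \<in> frontier \<Omega> \<Longrightarrow> N x \<le> N y"
      using continuous_attains_inf[OF cf False smooth_continuous[OF sN]] by blast
    obtain j where j: "j \<in> J" "x \<in> ball j (r j / 2)" using J x by blast
    have "\<beta> j x \<le> N x" unfolding N_def by (rule member_le_sum) (use j \<beta>0 J in auto)
    then have "N x > 0" using iffD2[OF \<beta>b[OF j(1)] j(2)] by linarith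
    then show ?thesis using x by (intro exI[of _ "N x / 2"]) auto
  qed (auto intro: exI[of _ 1])
  then obtain \<sigma> where \<sigma>: "\<sigma> > 0" "\<And>x. x \<in> frontier \<Omega> \<Longrightarrow> N x \<ge> 2 * \<sigma>" by blast
  \<comment> \<open>On the boundary \<open>N\<close> is at least \<open>2 * \<sigma>\<close>, so the
    points of the closure with weak bumps form a compact subset of \<Omega>, which has a positive
    distance \<open>d0\<close> from the complement.\<close>
  define W where "W = closure \<Omega> \<inter> {x. N x \<le> \<sigma>}"
  have "compact W" unfolding W_def using b
    by (intro compact_Int_closed closed_Collect_le smooth_continuous[OF sN] continuous_intros) auto
  moreover have "W \<subseteq> \<Omega>" using \<sigma> op by (force simp: W_def frontier_def interior_open)
  ultimately obtain d0 where d0: "d0 > 0" "(\<Union>x\<in>W. ball x d0) \<subseteq> \<Omega>"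
    using compact_subset_open_imp_ball_epsilon_subset op by metis
  define rm where "rm = Min (insert 1 ((\<lambda>j. r j / 2) ` J))"
  have rm: "rm > 0" using J(2) r' by (auto simp: rm_def)
  have rm2: "rm \<le> r j / 2" if "j \<in> J" for j unfolding rm_def by (rule Min_le) (use J(2) that in auto)
  define Kx where "Kx = Max (insert 1 (K ` J))"
  have Kx: "Kx \<ge> 1" "\<And>j. j \<in> J \<Longrightarrow> K j \<le> Kx" unfolding Kx_def using J(2) by (auto intro!: Max_ge)
  \<comment> \<open>Were all weights at most \<open>\<sigma> / c\<close>, their sum would not exceed
    \<sigma>. The added 1 keeps \<open>c\<close> positive.\<close>
  define c where "c = real (card J) + 1"
  have c: "c > 0" by (simp add: c_def)
  \<comment> \<open>A perturbation of size \<eta> costs at most \<open>Kx * \<eta>\<close> in any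
    chart; the factor 2 makes this strictly smaller than the guaranteed weight
    \<open>\<sigma> / c\<close>.\<close>
  define \<eta> where "\<eta> = min 1 (\<sigma> / (2 * Kx * c))"
  have \<eta>: "\<eta> > 0" "\<eta> \<le> 1" using \<sigma> Kx c by (auto simp: \<eta>_def)
  have "Kx * \<eta> \<le> Kx * (\<sigma> / (2 * Kx * c))" using Kx by (intro mult_left_mono) (auto simp: \<eta>_def)
  also have "\<dots> < \<sigma> / c" using Kx c \<sigma> by (simp add: field_simps)
  finally have K\<eta>: "Kx * \<eta> < \<sigma> / c" .
  \<comment> \<open>Before scaling by \<open>s\<close>, the full displacement \<open>V x + z\<close>
    is bounded by \<open>BV + 1\<close> and every partial sum of chart moves by
    \<open>BN + 1\<close>. So moves with \<open>s \<le> t0\<close> are shorter than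
    \<open>d0\<close> and than every halved chart radius.\<close>
  define t0 where "t0 = min d0 rm / (BN + BV + 2)"
  have t0: "t0 > 0" using d0 rm BN BV by (auto simp: t0_def)
  have t0b: "t0 * (BN + BV + 2) = min d0 rm" using BN BV by (simp add: t0_def)
  have "x + s *\<^sub>R (V x + z) \<in> \<Omega>" if x: "x \<in> closure \<Omega>" and s: "0 < s" "s \<le> t0" and z: "norm z \<le> \<eta>" for x s z
  proof -
    have sb: "s * q < min d0 rm" if "q < BN + BV + 2" "q \<ge> 0" for q
    proof -
      have "s * q \<le> t0 * q" using that s by (intro mult_right_mono) auto
      also have "\<dots> < t0 * (BN + BV + 2)" using that t0 by simp
      finally show ?thesis using t0b by simp
    qed
    show ?thesis
    proof (cases "N x \<le> \<sigma>")
      case True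
      then have "x \<in> W" using x by (simp add: W_def)
      moreover have "norm (s *\<^sub>R (V x + z)) < d0"
      proof -
        have "norm (V x + z) \<le> BV + 1" using norm_triangle_ineq[of "V x" z] BV(2)[of x] z \<eta> by simp
        then show ?thesis using sb[of "norm (V x + z)"] BN BV s by simp
      qed
      then have "x + s *\<^sub>R (V x + z) \<in> ball x d0" by (simp add: dist_norm)
      ultimately show ?thesis using d0(2) by blast
    next
      case False
      have "\<exists>k\<in>J. \<beta> k x > \<sigma> / c"
      proof (rule ccontr)
        assume "\<not> ?thesis"
        then have "N x \<le> real (card J) * (\<sigma> / c)" unfolding N_def by (intro sum_bounded_above) auto
        also have "\<dots> \<le> \<sigma>" using \<sigma> c by (simp add: c_def field_simps)
        finally show False using False by simp
      qed
      then obtain k where k: "k \<in> J" "\<beta> k x > \<sigma> / c" by blast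
      \<comment> \<open>The point reached after the move in chart \<open>k\<close>, which carries
        the whole perturbation \<open>z\<close>, and the moves in the charts of
        \<open>A\<close>.\<close>
      define Y where "Y A = x + s *\<^sub>R (\<beta> k x *\<^sub>R e k + z) + s *\<^sub>R (\<Sum>j\<in>A. \<beta> j x *\<^sub>R e j)" for A
      have near: "dist x (Y A) < rm" if A: "A \<subseteq> J - {k}" for A
      proof -
        have fA: "finite A" using A J finite_subset by blast
        have "norm (\<Sum>j\<in>A. \<beta> j x *\<^sub>R e j) \<le> (\<Sum>j\<in>A. \<beta> j x)"
        proof (rule sum_norm_le)
          fix j assume "j \<in> A"
          then show "norm (\<beta> j x *\<^sub>R e j) \<le> \<beta> j x" using e[of j] A J \<beta>0 by auto
        qed
        moreover have "norm (\<beta> k x *\<^sub>R e k) = \<beta> k x" using e[of k] k J \<beta>0 by auto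
        moreover have "(\<Sum>j\<in>A. \<beta> j x) + \<beta> k x = (\<Sum>j\<in>insert k A. \<beta> j x)" using A fA by (subst sum.insert) auto
        moreover have "\<dots> \<le> N x" unfolding N_def by (rule sum_mono2) (use A k J \<beta>0 in auto)
        moreover have "N x \<le> BN" using BN(2)[of x] by simp
        ultimately have "norm (\<beta> k x *\<^sub>R e k + z + (\<Sum>j\<in>A. \<beta> j x *\<^sub>R e j)) \<le> BN + 1"
          using norm_triangle_ineq[of "\<beta> k x *\<^sub>R e k + z" "\<Sum>j\<in>A. \<beta> j x *\<^sub>R e j"]
            norm_triangle_ineq[of "\<beta> k x *\<^sub>R e k" z] z \<eta> by linarith
        then have "s * norm (\<beta> k x *\<^sub>R e k + z + (\<Sum>j\<in>A. \<beta> j x *\<^sub>R e j)) < rm"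
          using sb[of "norm (\<beta> k x *\<^sub>R e k + z + (\<Sum>j\<in>A. \<beta> j x *\<^sub>R e j))"] BV by simp
        moreover have "dist x (Y A) = norm (s *\<^sub>R (\<beta> k x *\<^sub>R e k + z + (\<Sum>j\<in>A. \<beta> j x *\<^sub>R e j)))"
          unfolding Y_def dist_norm scaleR_add_right
          by (subst norm_minus_commute) (simp add: algebra_simps)
        ultimately show ?thesis using s by simp
      qed
      have inb: "Y A \<in> ball j (r j)" if "A \<subseteq> J - {k}" "j \<in> J" "\<beta> j x > 0" for A j
      proof -
        have "dist j x < r j / 2" using \<beta>b that by simp
        then show ?thesis using near[OF that(1)] rm2[OF that(2)] dist_triangle[of j "Y A" x] by simp
      qed
      \<comment> \<open>The displacement is split into vertical moves in single charts: the one in chart \<open>k\<close> enters \<open>\<Omega>\<close>,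
        and the others do not leave it.\<close>
      have Yin: "Y A \<in> \<Omega>" if "A \<subseteq> J - {k}" for A
      proof -
        have "finite A" using that J finite_subset by blast
        then show ?thesis using that
        proof (induction A rule: finite_induct)
          case empty
          have bk: "\<beta> k x > 0" using k \<sigma> c by (smt (verit) divide_pos_pos)
          have Yk: "Y {} = x + s *\<^sub>R (\<beta> k x *\<^sub>R e k + z)" by (simp add: Y_def)
          have "K k * norm z \<le> Kx * \<eta>" using Kx k z K[of k] J by (intro mult_mono) auto
          then have "K k * norm z < \<beta> k x" using K\<eta> k by linarith
          then show ?case unfolding Yk
            using push[of k x s "\<beta> k x" z] inb[of "{}" k] x s k J bk \<beta>b[OF k(1), of x] r'[OF k(1)] unfolding Yk by auto
        next
          case (insert j A)
          have j: "j \<in> J" "A \<subseteq> J - {k}" using insert by auto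
          have YA: "Y A \<in> \<Omega>" using insert by auto
          then have YAc: "Y A \<in> closure \<Omega>" using closure_subset by blast
          have Yj: "Y (insert j A) = Y A + s *\<^sub>R (\<beta> j x *\<^sub>R e j + 0)"
            using insert by (simp add: Y_def algebra_simps)
          show ?case
          proof (cases "\<beta> j x > 0")
            case True
            have "Y A + s *\<^sub>R (\<beta> j x *\<^sub>R e j + 0) \<in> \<Omega>"
              by (rule push[of j]) (use j J YAc inb[of A j] inb[of "insert j A" j] insert.prems True s Yj in auto)
            then show ?thesis using Yj by simp
          next
            case False
            then have "\<beta> j x = 0" using \<beta>0[of j x] by simp
            then show ?thesis using Yj YA by simp
          qed
        qed
      qed
      have "V x = \<beta> k x *\<^sub>R e k + (\<Sum>j\<in>J - {k}. \<beta> j x *\<^sub>R e j)"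
        unfolding V_def using k J by (simp add: sum.remove)
      then have "Y (J - {k}) = x + s *\<^sub>R (V x + z)" by (simp add: Y_def algebra_simps)
      then show ?thesis using Yin[of "J - {k}"] by simp
    qed
  qed
  then show ?thesis using sV bV \<eta> t0 by blast
qed

section \<open>Averaged push-forwards\<close>

text \<open>For a field that vanishes outside \<Omega> this is the orthogonality condition of
  \<open>Lp_sol\<close>. Stated on the whole space it makes no reference to the boundary, so test
  functions can be composed freely with displacements.\<close>

definition weakly_div_free :: "(real^'n \<Rightarrow> complex^'n) \<Rightarrow> bool" where
  "weakly_div_free u \<longleftrightarrow> (\<forall>\<phi> :: real^'n \<Rightarrow> complex. smooth \<phi> \<longrightarrow> bdd_supp \<phi> \<longrightarrow>
     (LINT x|lborel. (\<Sum>i\<in>UNIV. u x $ i * partial i \<phi> x)) = 0)"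

definition displace :: "(real^'n \<Rightarrow> real) \<Rightarrow> (real^'n \<Rightarrow> real^'n) \<Rightarrow> real^'n \<Rightarrow> real^'n \<Rightarrow> real^'n" where
  "displace \<delta> V z x = x + \<delta> x *\<^sub>R (V x + z)"

text \<open>The real Jacobian matrix of \<open>G\<close> at \<open>x\<close>, whose columns are the
  partials, acting on a complex vector.\<close>

definition jac :: "(real^'n \<Rightarrow> real^'n) \<Rightarrow> real^'n \<Rightarrow> complex^'n \<Rightarrow> complex^'n" where
  "jac G x w = (\<chi> i. \<Sum>j\<in>UNIV. of_real (partial j G x $ i) * w $ j)"

text \<open>The chain rule in the form that makes push-forwards preserve divergence freeness:
  testing the transported vector against \<open>\<phi>\<close> at \<open>G x\<close> is testing the
  original one against \<open>\<phi>\<close> composed with \<open>G\<close>.\<close>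

lemma jac_chain:
  fixes \<phi> :: "real^'n \<Rightarrow> complex" and G :: "real^'n \<Rightarrow> real^'n"
  assumes "smooth \<phi>" "smooth G"
  shows "(\<Sum>i\<in>UNIV. jac G x w $ i * partial i \<phi> (G x)) = (\<Sum>j\<in>UNIV. w $ j * partial j (\<lambda>x. \<phi> (G x)) x)"
proof -
  have "(\<Sum>i\<in>UNIV. jac G x w $ i * partial i \<phi> (G x))
      = (\<Sum>i\<in>UNIV. \<Sum>j\<in>UNIV. of_real (partial j G x $ i) * w $ j * partial i \<phi> (G x))"
    by (simp add: jac_def sum_distrib_right)
  also have "\<dots> = (\<Sum>j\<in>UNIV. \<Sum>i\<in>UNIV. of_real (partial j G x $ i) * w $ j * partial i \<phi> (G x))"
    by (rule sum.swap)
  also have "\<dots> = (\<Sum>j\<in>UNIV. w $ j * partial j (\<lambda>x. \<phi> (G x)) x)"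
    unfolding partial_compose(1)[OF smoothD[OF assms(1), of "Suc 0"] smoothD[OF assms(2), of "Suc 0"]]
    by (simp add: sum_distrib_left scaleR_conv_of_real ac_simps)
  finally show ?thesis .
qed

lemma jac_id: "(\<And>j. partial j G x = axis j 1) \<Longrightarrow> jac G x w = w"
proof -
  assume "\<And>j. partial j G x = axis j 1"
  moreover have "(\<Sum>j\<in>UNIV. of_real (axis j 1 $ i) * w $ j) = w $ i" for i
  proof -
    have "(\<Sum>j\<in>UNIV. of_real (axis j 1 $ i) * w $ j) = (\<Sum>j\<in>UNIV. if j = i then w $ i else 0)"
      by (rule sum.cong) (auto simp: axis_def)
    then show ?thesis by simp
  qed
  ultimately show ?thesis by (simp add: jac_def vec_eq_iff)
qed

lemma norm_vec_le_sum: "norm (v :: 'a::real_normed_vector^'n) \<le> (\<Sum>i\<in>UNIV. norm (v $ i))"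
  unfolding norm_vec_def by (rule L2_set_le_sum) simp

lemma norm_jac_le:
  assumes "\<And>j. norm (partial j G x) \<le> P"
  shows "norm (jac G x (w :: complex^'n)) \<le> (real CARD('n) ^ 2 * P) * norm w"
proof -
  have "norm (jac G x w $ i) \<le> (\<Sum>j\<in>(UNIV::'n set). P * norm w)" for i
    unfolding jac_def vec_lambda_beta
  proof (rule sum_norm_le)
    fix j
    have "\<bar>partial j G x $ i\<bar> \<le> P" using component_le_norm_cart[of "partial j G x" i] assms[of j] by linarith
    then show "norm (of_real (partial j G x $ i) * w $ j) \<le> P * norm w"
      unfolding norm_mult norm_of_real by (intro mult_mono Finite_Cartesian_Product.norm_nth_le) auto
  qed
  then have "(\<Sum>i\<in>UNIV. norm (jac G x w $ i)) \<le> (\<Sum>i\<in>(UNIV::'n set). real CARD('n) * (P * norm w))"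
    by (intro sum_mono) simp
  then show ?thesis using norm_vec_le_sum[of "jac G x w"] by (simp add: power2_eq_square algebra_simps)
qed

section \<open>Measurability of vector fields and affine substitution\<close>

lemma borel_measurable_nth [measurable (raw)]:
  fixes f :: "'a \<Rightarrow> 'b::euclidean_space^'n"
  assumes "f \<in> borel_measurable M" shows "(\<lambda>x. f x $ i) \<in> borel_measurable M"
  using borel_measurable_continuous_on[OF linear_continuous_on[OF bounded_linear_vec_nth] assms] .

lemma borel_measurable_vecI:
  fixes f :: "'a \<Rightarrow> 'b::euclidean_space^'n"
  assumes "\<And>i. (\<lambda>x. f x $ i) \<in> borel_measurable M" shows "f \<in> borel_measurable M"
proof (rule borel_measurable_euclidean_space[THEN iffD2], rule ballI)
  fix b :: "'b^'n" assume "b \<in> Basis"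
  then obtain i c where "b = axis i c" by (auto simp: Basis_vec_def)
  then have "(\<lambda>x. f x \<bullet> b) = (\<lambda>x. f x $ i \<bullet> c)" by (simp add: inner_axis fun_eq_iff)
  then show "(\<lambda>x. f x \<bullet> b) \<in> borel_measurable M" using assms[of i] by simp
qed

lemma lborel_integral_affine:
  fixes f :: "'a::euclidean_space \<Rightarrow> 'b::euclidean_space"
  assumes [measurable]: "f \<in> borel_measurable borel" and "c > 0"
  shows "(LINT y|lborel. f y) = c ^ DIM('a) *\<^sub>R (LINT z|lborel. f (t + c *\<^sub>R z))"
proof -
  have "(LINT y|lborel. f y) = (LINT y|density (distr lborel borel (\<lambda>x. t + c *\<^sub>R x)) (\<lambda>_. \<bar>c\<bar>^DIM('a)). f y)"
    using lborel_affine[of c t] assms(2) by simp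
  also have "\<dots> = c ^ DIM('a) *\<^sub>R (LINT z|lborel. f (t + c *\<^sub>R z))"
    using assms(2) by (subst integral_density) (auto simp: integral_distr)
  finally show ?thesis .
qed

lemma nn_integral_lborel_affine:
  fixes f :: "'a::euclidean_space \<Rightarrow> ennreal"
  assumes [measurable]: "f \<in> borel_measurable borel" and "c > 0"
  shows "(\<integral>\<^sup>+y. f y \<partial>lborel) = ennreal (c ^ DIM('a)) * (\<integral>\<^sup>+z. f (t + c *\<^sub>R z) \<partial>lborel)"
proof -
  have "(\<integral>\<^sup>+y. f y \<partial>lborel) = (\<integral>\<^sup>+y. f y \<partial>density (distr lborel borel (\<lambda>x. t + c *\<^sub>R x)) (\<lambda>_. \<bar>c\<bar>^DIM('a)))"
    using lborel_affine[of c t] assms(2) by simp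
  also have "\<dots> = ennreal (c ^ DIM('a)) * (\<integral>\<^sup>+z. f (t + c *\<^sub>R z) \<partial>lborel)"
    using assms(2) by (subst nn_integral_density) (auto simp: nn_integral_distr nn_integral_cmult)
  finally show ?thesis .
qed

text \<open>Collects the data chosen from \<Omega> alone. Every constant defined in this context is
  built from them, which is how the final constant comes to depend only on \<Omega> and the
  exponent.\<close>

locale spreading =
  fixes \<Omega> :: "(real^'n) set" and V :: "real^'n \<Rightarrow> real^'n" and \<rho> :: "real^'n \<Rightarrow> real" and \<eta> R A B t0 :: real
  assumes open_\<Omega>: "open \<Omega>" and bounded_\<Omega>: "bounded \<Omega>"
    and V: "smooth V" "bdd_supp V" and \<rho>: "mollifier \<eta> \<rho>" and \<eta>: "\<eta> > 0"
    and R: "\<And>x. norm (V x) + \<eta> \<le> R" and A: "\<And>j x. norm (partial j V x) \<le> A" and B: "\<And>z. \<rho> z \<le> B"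
    and t0: "t0 > 0" "t0 \<le> 1"
    and push: "\<And>x s z. x \<in> closure \<Omega> \<Longrightarrow> 0 < s \<Longrightarrow> s \<le> t0 \<Longrightarrow> norm z \<le> \<eta> \<Longrightarrow> x + s *\<^sub>R (V x + z) \<in> \<Omega>"
begin

lemma R_pos: "R > 0" using R[of 0] \<eta> norm_ge_zero[of "V 0"] by linarith
lemma A_nonneg: "A \<ge> 0" using A[of undefined 0] norm_ge_zero order_trans by blast
lemma \<rho>_nonneg: "\<rho> z \<ge> 0" using \<rho> by (simp add: mollifier_def)
lemma B_nonneg: "B \<ge> 0" using B[of 0] \<rho>_nonneg[of 0] by linarith
lemma \<rho>_0: "norm z \<ge> \<eta> \<Longrightarrow> \<rho> z = 0" using \<rho> by (simp add: mollifier_def)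
lemma \<rho>_smooth: "smooth \<rho>" "bdd_supp \<rho>" using \<rho> by (auto simp: mollifier_def)
lemma \<rho>_int: "integrable lborel \<rho>" "(LINT z|lborel. \<rho> z) = 1" using \<rho> by (auto simp: mollifier_def)

lemma \<rho>_meas [measurable]: "\<rho> \<in> borel_measurable borel" using \<rho>_smooth smooth_borel by blast
lemma V_meas [measurable]: "V \<in> borel_measurable borel" "partial j V \<in> borel_measurable borel"
  using V smooth_borel smooth_partial by blast+

text \<open>The Lipschitz bound makes \<open>\<delta>\<close> comparable at a point and at its displacements.\<close>

definition admissible :: "(real^'n \<Rightarrow> real) \<Rightarrow> bool" where
  "admissible \<delta> \<longleftrightarrow> smooth \<delta> \<and> (\<forall>x. 0 \<le> \<delta> x \<and> \<delta> x \<le> t0) \<and> (\<forall>x y. \<bar>\<delta> x - \<delta> y\<bar> * (2 * R) \<le> norm (x - y)) \<and>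
     (\<forall>j x. \<bar>partial j \<delta> x\<bar> \<le> 1)"

text \<open>The point \<open>x\<close> is displaced to \<open>y\<close> by \<open>displace \<delta> V z\<close> exactly for \<open>z = pos \<delta> y x\<close>. Where \<open>\<delta> x = 0\<close>
  the kernel vanishes because of the division by zero.\<close>

definition pos :: "(real^'n \<Rightarrow> real) \<Rightarrow> real^'n \<Rightarrow> real^'n \<Rightarrow> real^'n" where
  "pos \<delta> y x = (1 / \<delta> x) *\<^sub>R (y - x) - V x"

definition ker :: "(real^'n \<Rightarrow> real) \<Rightarrow> real^'n \<Rightarrow> real^'n \<Rightarrow> real" where
  "ker \<delta> y x = \<rho> (pos \<delta> y x) / \<delta> x ^ CARD('n)"

definition integrand :: "(real^'n \<Rightarrow> real) \<Rightarrow> (real^'n \<Rightarrow> complex^'n) \<Rightarrow> real^'n \<Rightarrow> real^'n \<Rightarrow> complex^'n" where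
  "integrand \<delta> u y x = ker \<delta> y x *\<^sub>R jac (displace \<delta> V (pos \<delta> y x)) x (u x)"

text \<open>\<open>spread \<delta> u\<close> is the \<open>\<rho>\<close>-average over \<open>z\<close> of the push-forwards of \<open>u\<close> under \<open>displace \<delta> V z\<close>, written as
  a kernel by substituting \<open>y\<close> for \<open>z\<close>; points with \<open>\<delta> = 0\<close> do not move.\<close>

definition spread :: "(real^'n \<Rightarrow> real) \<Rightarrow> (real^'n \<Rightarrow> complex^'n) \<Rightarrow> real^'n \<Rightarrow> complex^'n" where
  "spread \<delta> u y = (if \<delta> y = 0 then u y else LINT x|lborel. integrand \<delta> u y x)"

text \<open>\<open>CJ\<close> bounds the Jacobian of every displacement that occurs: the identity
  contributes 1, the derivative of \<open>V\<close> at most \<open>A\<close> and that of \<delta> at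
  most \<open>R\<close>, as \<delta> and its partials do not exceed 1. \<open>CK\<close> adds the
  size of the kernel, the power of 2 coming from
  \<open>\<delta> x \<ge> \<delta> y / 2\<close>.\<close>

definition CJ :: real where "CJ = real CARD('n) ^ 2 * (1 + A + R)"
definition CK :: real where "CK = B * 2 ^ CARD('n) * CJ"

lemma CJ_nonneg: "CJ \<ge> 0" using A_nonneg R_pos by (simp add: CJ_def)
lemma CK_nonneg: "CK \<ge> 0" using CJ_nonneg B_nonneg by (simp add: CK_def)

lemma admissible_const: "0 \<le> t \<Longrightarrow> t \<le> t0 \<Longrightarrow> admissible (\<lambda>_. t)"
  by (simp add: admissible_def smooth_def C_k_const)

context
  fixes \<delta> :: "real^'n \<Rightarrow> real" assumes adm: "admissible \<delta>"
begin

lemma \<delta>_smooth: "smooth \<delta>" and \<delta>_nonneg: "\<delta> x \<ge> 0" and \<delta>_le: "\<delta> x \<le> t0"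
  and \<delta>_lip: "\<bar>\<delta> x - \<delta> y\<bar> * (2 * R) \<le> norm (x - y)" and \<delta>_part: "\<bar>partial j \<delta> x\<bar> \<le> 1"
  using adm by (auto simp: admissible_def)

lemma \<delta>_meas [measurable]: "\<delta> \<in> borel_measurable borel" "partial j \<delta> \<in> borel_measurable borel"
  using \<delta>_smooth smooth_borel smooth_partial by blast+

lemma smooth_displace: "smooth (displace \<delta> V z)"
  unfolding displace_def smooth_def
  by (intro allI C_k_add C_k_id C_k_scaleR C_k_const smoothD \<delta>_smooth V)

lemma partial_displace:
  "partial j (displace \<delta> V z) x = axis j 1 + (\<delta> x *\<^sub>R partial j V x + partial j \<delta> x *\<^sub>R (V x + z))"
proof -
  have s: "C_k (Suc 0) (\<lambda>x. x :: real^'n)" "C_k (Suc 0) \<delta>" "C_k (Suc 0) (\<lambda>x. V x + z)" "C_k (Suc 0) V"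
      "C_k (Suc 0) (\<lambda>x. \<delta> x *\<^sub>R (V x + z))" "C_k (Suc 0) (\<lambda>x :: real^'n. z)"
    by (intro C_k_add C_k_id C_k_scaleR C_k_const smoothD \<delta>_smooth V)+
  show ?thesis
    unfolding displace_def
    by (subst partial_add[OF s(1,5)], subst partial_scaleR[OF s(2,3)], subst partial_add[OF s(4,6)])
      (simp add: partial_id)
qed

lemma displace_jac_le:
  assumes "norm (V x + z) \<le> R" shows "norm (jac (displace \<delta> V z) x w) \<le> CJ * norm w"
  unfolding CJ_def
proof (rule norm_jac_le)
  fix j
  have "norm (\<delta> x *\<^sub>R partial j V x) \<le> A"
    using A[of j x] \<delta>_nonneg[of x] \<delta>_le[of x] t0 mult_mono[of "\<delta> x" 1 "norm (partial j V x)" A] by simp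
  moreover have "norm (partial j \<delta> x *\<^sub>R (V x + z)) \<le> R"
    using \<delta>_part[of j x] assms mult_mono[of "\<bar>partial j \<delta> x\<bar>" 1 "norm (V x + z)" R] by simp
  moreover have "norm (axis j (1::real)) = 1" by simp
  ultimately show "norm (partial j (displace \<delta> V z) x) \<le> 1 + A + R"
    unfolding partial_displace
    using norm_triangle_ineq[of "axis j 1" "\<delta> x *\<^sub>R partial j V x + partial j \<delta> x *\<^sub>R (V x + z)"]
      norm_triangle_ineq[of "\<delta> x *\<^sub>R partial j V x" "partial j \<delta> x *\<^sub>R (V x + z)"] by linarith
qed

lemma ker_nonneg: "ker \<delta> y x \<ge> 0" using \<rho>_nonneg \<delta>_nonneg by (simp add: ker_def)

lemma ker_eq_0: "\<delta> x = 0 \<Longrightarrow> ker \<delta> y x = 0" by (simp add: ker_def zero_power)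

lemma V_plus_le: "norm z \<le> \<eta> \<Longrightarrow> norm (V x + z) \<le> R"
  using norm_triangle_ineq[of "V x" z] R[of x] by linarith

text \<open>Mass from \<open>x\<close> travels at most \<open>R * \<delta> x\<close>. As \<delta>
  has Lipschitz constant \<open>1 / (2 * R)\<close>, it changes by at most
  \<open>\<delta> x / 2\<close> on the way, so its values at both ends are comparable.\<close>

lemma ker_support:
  assumes "ker \<delta> y x \<noteq> 0"
  shows "\<delta> x > 0" "norm (pos \<delta> y x) < \<eta>" "y = displace \<delta> V (pos \<delta> y x) x" "norm (y - x) \<le> R * \<delta> x"
    "\<delta> x \<le> 2 * \<delta> y" "\<delta> y \<le> 2 * \<delta> x" "norm (V x + pos \<delta> y x) \<le> R"
proof -
  have "\<delta> x \<noteq> 0" using assms by (auto simp: ker_def)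
  then show d: "\<delta> x > 0" using \<delta>_nonneg[of x] by simp
  show z: "norm (pos \<delta> y x) < \<eta>" using assms \<rho>_0 by (force simp: ker_def)
  show y: "y = displace \<delta> V (pos \<delta> y x) x" using d by (simp add: displace_def pos_def)
  show Vz: "norm (V x + pos \<delta> y x) \<le> R" using V_plus_le z by simp
  have "y - x = \<delta> x *\<^sub>R (V x + pos \<delta> y x)" using y by (simp add: displace_def algebra_simps)
  then show n: "norm (y - x) \<le> R * \<delta> x" using Vz d by (simp add: mult.commute)
  have "\<bar>\<delta> y - \<delta> x\<bar> * (2 * R) \<le> R * \<delta> x" using \<delta>_lip[of y x] n by linarith
  then have "\<bar>\<delta> y - \<delta> x\<bar> * 2 \<le> \<delta> x" using R_pos by (simp add: algebra_simps)
  then have *: "\<delta> y * 2 - \<delta> x * 2 \<le> \<delta> x" "\<delta> x * 2 - \<delta> y * 2 \<le> \<delta> x"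
    using abs_ge_self[of "\<delta> y - \<delta> x"] abs_ge_minus_self[of "\<delta> y - \<delta> x"] by (simp_all add: algebra_simps)
  show "\<delta> x \<le> 2 * \<delta> y" using * by linarith
  show "\<delta> y \<le> 2 * \<delta> x" using * d by linarith
qed

lemma integrand_bound_ker: "norm (integrand \<delta> u y x) \<le> ker \<delta> y x * (CJ * norm (u x))"
proof (cases "ker \<delta> y x = 0")
  case False
  then show ?thesis unfolding integrand_def norm_scaleR
    using displace_jac_le[OF ker_support(7)[OF False], of "u x"] ker_nonneg[of y x] by (simp add: mult_left_mono)
qed (simp add: integrand_def)

lemma ker_bound:
  assumes "\<delta> y > 0"
  shows "ker \<delta> y x \<le> B * 2 ^ CARD('n) / \<delta> y ^ CARD('n) * indicator (cball y (2 * R * \<delta> y)) x"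
proof (cases "ker \<delta> y x = 0")
  case True
  then show ?thesis using B_nonneg assms by simp
next
  case False
  note s = ker_support[OF False]
  have "norm (y - x) \<le> 2 * R * \<delta> y" using s(4) R_pos mult_left_mono[OF s(5), of R] by linarith
  then have i: "x \<in> cball y (2 * R * \<delta> y)" by (simp add: dist_norm)
  have "(\<delta> y / 2) ^ CARD('n) \<le> \<delta> x ^ CARD('n)" using s(6) assms by (intro power_mono) auto
  then have "\<rho> (pos \<delta> y x) / \<delta> x ^ CARD('n) \<le> B / (\<delta> y / 2) ^ CARD('n)"
    using B[of "pos \<delta> y x"] \<rho>_nonneg[of "pos \<delta> y x"] assms s(1) by (intro frac_le) auto
  then show ?thesis using i by (simp add: ker_def power_divide)
qed

lemma integrand_bound:
  assumes "\<delta> y > 0"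
  shows "norm (integrand \<delta> u y x) \<le> CK / \<delta> y ^ CARD('n) * (indicator (cball y (2 * R * \<delta> y)) x * norm (u x))"
proof -
  have "norm (integrand \<delta> u y x) \<le> ker \<delta> y x * (CJ * norm (u x))" by (rule integrand_bound_ker)
  also have "\<dots> \<le> B * 2 ^ CARD('n) / \<delta> y ^ CARD('n) * indicator (cball y (2 * R * \<delta> y)) x * (CJ * norm (u x))"
    using ker_bound[OF assms] CJ_nonneg by (intro mult_right_mono) auto
  finally show ?thesis by (simp add: CK_def ac_simps)
qed

lemma ker_meas [measurable]: "(\<lambda>(y, x). ker \<delta> y x) \<in> borel_measurable (lborel \<Otimes>\<^sub>M lborel)"
  unfolding ker_def pos_def by measurable

lemma jac_meas:
  assumes [measurable]: "u \<in> borel_measurable borel" "f \<in> borel_measurable M" "g \<in> borel_measurable M"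
  shows "(\<lambda>p. jac (displace \<delta> V (f p)) (g p) (u (g p))) \<in> borel_measurable M"
  by (rule borel_measurable_vecI) (unfold jac_def partial_displace vec_lambda_beta, measurable)

lemma integrand_meas:
  assumes [measurable]: "u \<in> borel_measurable borel"
  shows "(\<lambda>(y, x). integrand \<delta> u y x) \<in> borel_measurable (lborel \<Otimes>\<^sub>M lborel)"
proof -
  have [measurable]: "(\<lambda>p. pos \<delta> (fst p) (snd p)) \<in> borel_measurable (lborel \<Otimes>\<^sub>M lborel)"
    unfolding pos_def by measurable
  have [measurable]: "(\<lambda>p. jac (displace \<delta> V (pos \<delta> (fst p) (snd p))) (snd p) (u (snd p))) \<in> borel_measurable (lborel \<Otimes>\<^sub>M lborel)"
    by (rule jac_meas) measurable
  have [measurable]: "(\<lambda>p. ker \<delta> (fst p) (snd p)) \<in> borel_measurable (lborel \<Otimes>\<^sub>M lborel)"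
    using ker_meas by (simp add: case_prod_unfold)
  show ?thesis unfolding case_prod_unfold integrand_def by measurable
qed

lemma integrand_meas_x:
  assumes "u \<in> borel_measurable borel" shows "integrand \<delta> u y \<in> borel_measurable borel"
  using measurable_Pair2[OF integrand_meas[OF assms], of y] by simp

lemma integrand_integrable:
  assumes u: "integrable lborel u" and "\<delta> y > 0" shows "integrable lborel (integrand \<delta> u y)"
proof (rule Bochner_Integration.integrable_bound)
  have [measurable]: "u \<in> borel_measurable borel" using u by simp
  show "integrable lborel (\<lambda>x. (CK / \<delta> y ^ CARD('n)) *\<^sub>R u x)" using u by simp
  show "integrand \<delta> u y \<in> borel_measurable lborel" using integrand_meas_x by simp
  have "norm (integrand \<delta> u y x) \<le> norm ((CK / \<delta> y ^ CARD('n)) *\<^sub>R u x)" for x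
  proof -
    have "indicator (cball y (2 * R * \<delta> y)) x * norm (u x) \<le> norm (u x)" by (simp add: indicator_def)
    then have "CK / \<delta> y ^ CARD('n) * (indicator (cball y (2 * R * \<delta> y)) x * norm (u x)) \<le> CK / \<delta> y ^ CARD('n) * norm (u x)"
      using CK_nonneg assms(2) by (intro mult_left_mono) auto
    then show ?thesis using integrand_bound[OF assms(2), of u x] CK_nonneg assms(2) by simp
  qed
  then show "AE x in lborel. norm (integrand \<delta> u y x) \<le> norm ((CK / \<delta> y ^ CARD('n)) *\<^sub>R u x)" by simp
qed

lemma spread_bound:
  assumes u: "integrable lborel u" and "\<delta> y > 0"
  shows "norm (spread \<delta> u y) \<le> CK / \<delta> y ^ CARD('n) * (LINT x|lborel. indicator (cball y (2 * R * \<delta> y)) x * norm (u x))"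
proof -
  have "norm (spread \<delta> u y) \<le> (LINT x|lborel. CK / \<delta> y ^ CARD('n) * (indicator (cball y (2 * R * \<delta> y)) x * norm (u x)))"
    unfolding spread_def if_not_P[OF less_imp_neq[OF assms(2), symmetric]]
  proof (rule Bochner_Integration.integral_norm_bound_integral)
    show "integrable lborel (integrand \<delta> u y)" by (rule integrand_integrable[OF assms])
    have "integrable lborel (\<lambda>x. indicator (cball y (2 * R * \<delta> y)) x *\<^sub>R norm (u x))"
      using u by (intro integrable_mult_indicator) auto
    then show "integrable lborel (\<lambda>x. CK / \<delta> y ^ CARD('n) * (indicator (cball y (2 * R * \<delta> y)) x * norm (u x)))"
      by simp
  qed (rule integrand_bound[OF assms(2)])
  then show ?thesis by simp
qed

lemma spread_meas:
  assumes [measurable]: "u \<in> borel_measurable borel" shows "spread \<delta> u \<in> borel_measurable borel"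
proof -
  have "(\<lambda>y. LINT x|lborel. integrand \<delta> u y x) \<in> borel_measurable lborel"
    using lborel.borel_measurable_lebesgue_integral[OF integrand_meas[OF assms]] by simp
  then have [measurable]: "(\<lambda>y. LINT x|lborel. integrand \<delta> u y x) \<in> borel_measurable borel" by simp
  show ?thesis unfolding spread_def by measurable
qed

text \<open>A nonzero contribution at \<open>y\<close> starts from a point of \<Omega> with positive
  \<delta>, and \<open>push\<close> sends it into \<Omega>. Points with vanishing \<delta> keep the
  value of \<open>u\<close>.\<close>

lemma spread_eq_0:
  assumes u: "\<And>x. x \<notin> \<Omega> \<Longrightarrow> u x = 0" and y: "y \<notin> \<Omega>" shows "spread \<delta> u y = 0"
proof -
  have "integrand \<delta> u y x = 0" for x
  proof (rule ccontr)
    assume nz: "integrand \<delta> u y x \<noteq> 0"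
    then have k: "ker \<delta> y x \<noteq> 0" by (auto simp: integrand_def)
    have "u x \<noteq> 0" using integrand_bound_ker[of u y x] nz by auto
    then have "x \<in> closure \<Omega>" using u closure_subset by blast
    then have "displace \<delta> V (pos \<delta> y x) x \<in> \<Omega>"
      unfolding displace_def using ker_support[OF k] \<delta>_le by (intro push) auto
    then show False using y ker_support(3)[OF k] by simp
  qed
  then show ?thesis using u y by (simp add: spread_def)
qed

text \<open>For fixed \<open>x\<close> substitute \<open>y = displace \<delta> V z x\<close>: the
  volume factor \<open>\<delta> x ^ CARD('n)\<close> is cancelled by the denominator of the kernel.
  This matches the kernel form of \<open>spread\<close> with the average over
  \<open>z\<close>.\<close>

lemma integral_ker_y:
  "(LINT y|lborel. ker \<delta> y x *\<^sub>R f (pos \<delta> y x) y)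
     = (if \<delta> x = 0 then 0 else LINT z|lborel. \<rho> z *\<^sub>R f z (displace \<delta> V z x))"
  if [measurable]: "(\<lambda>y. f (pos \<delta> y x) y) \<in> borel_measurable borel" for f :: "real^'n \<Rightarrow> real^'n \<Rightarrow> complex"
proof (cases "\<delta> x = 0")
  case False
  then have d: "\<delta> x > 0" using \<delta>_nonneg[of x] by simp
  have dz: "(x + \<delta> x *\<^sub>R V x) + \<delta> x *\<^sub>R z = displace \<delta> V z x" for z by (simp add: displace_def algebra_simps)
  have p: "pos \<delta> (displace \<delta> V z x) x = z" for z using d by (simp add: displace_def pos_def)
  have k: "ker \<delta> (displace \<delta> V z x) x = \<rho> z / \<delta> x ^ CARD('n)" for z by (simp add: ker_def p)
  have [measurable]: "(\<lambda>y. ker \<delta> y x) \<in> borel_measurable borel" unfolding ker_def pos_def by measurable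
  have "(LINT y|lborel. ker \<delta> y x *\<^sub>R f (pos \<delta> y x) y)
      = \<delta> x ^ CARD('n) *\<^sub>R (LINT z|lborel. (\<rho> z / \<delta> x ^ CARD('n)) *\<^sub>R f z (displace \<delta> V z x))"
    by (subst lborel_integral_affine[OF _ d, of _ "x + \<delta> x *\<^sub>R V x"])
      (simp_all only: dz p k DIM_cart DIM_real, simp_all)
  also have "\<dots> = (LINT z|lborel. \<delta> x ^ CARD('n) *\<^sub>R ((\<rho> z / \<delta> x ^ CARD('n)) *\<^sub>R f z (displace \<delta> V z x)))"
    by (rule integral_scaleR_right[symmetric])
  finally show ?thesis using d by simp
qed (simp add: ker_eq_0)

lemma nn_integral_ker_y: "(\<integral>\<^sup>+y. ennreal (ker \<delta> y x) \<partial>lborel) \<le> 1"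
proof (cases "\<delta> x = 0")
  case False
  then have d: "\<delta> x > 0" using \<delta>_nonneg[of x] by simp
  have dz: "(x + \<delta> x *\<^sub>R V x) + \<delta> x *\<^sub>R z = displace \<delta> V z x" for z by (simp add: displace_def algebra_simps)
  have p: "pos \<delta> (displace \<delta> V z x) x = z" for z using d by (simp add: displace_def pos_def)
  have k: "ker \<delta> (displace \<delta> V z x) x = \<rho> z / \<delta> x ^ CARD('n)" for z by (simp add: ker_def p)
  have [measurable]: "(\<lambda>y. ker \<delta> y x) \<in> borel_measurable borel" unfolding ker_def pos_def by measurable
  have "(\<integral>\<^sup>+y. ennreal (ker \<delta> y x) \<partial>lborel)
      = ennreal (\<delta> x ^ CARD('n)) * (\<integral>\<^sup>+z. ennreal (\<rho> z / \<delta> x ^ CARD('n)) \<partial>lborel)"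
    by (subst nn_integral_lborel_affine[OF _ d, of _ "x + \<delta> x *\<^sub>R V x"])
      (simp_all only: dz k DIM_cart DIM_real, simp_all)
  also have "\<dots> = (\<integral>\<^sup>+z. ennreal (\<rho> z) \<partial>lborel)"
    by (subst nn_integral_cmult[symmetric]) (use d \<rho>_nonneg in \<open>auto simp: ennreal_mult'[symmetric]\<close>)
  also have "\<dots> = 1" using \<rho>_int \<rho>_nonneg by (simp add: nn_integral_eq_integral)
  finally show ?thesis by simp
qed (simp add: ker_eq_0)

end

end

text \<open>Tonelli, integrating first over the variable in which the weight \<open>k\<close> has
  mass at most 1. It justifies both exchanges of integrals below, once with the kernel and once with
  \<rho> as weight.\<close>

lemma integrable_pair_weight:
  fixes g :: "real^'n \<Rightarrow> real^'n \<Rightarrow> 'b::euclidean_space" and u :: "real^'n \<Rightarrow> 'c::euclidean_space"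
  assumes g [measurable]: "(\<lambda>(y, x). g y x) \<in> borel_measurable (lborel \<Otimes>\<^sub>M lborel)"
    and k: "\<And>x. (\<integral>\<^sup>+y. ennreal (k y x) \<partial>lborel) \<le> 1" "\<And>y x. k y x \<ge> 0"
      "\<And>x. (\<lambda>y. k y x) \<in> borel_measurable borel"
    and le: "\<And>y x. norm (g y x) \<le> k y x * (C * norm (u x))" and u: "integrable lborel u" and C: "C \<ge> 0"
  shows "integrable (lborel \<Otimes>\<^sub>M lborel) (\<lambda>(y, x). g y x)"
proof (rule integrableI_bounded[OF g])
  have "(\<integral>\<^sup>+p. ennreal (norm (case p of (y, x) \<Rightarrow> g y x)) \<partial>(lborel \<Otimes>\<^sub>M lborel))
      = (\<integral>\<^sup>+x. \<integral>\<^sup>+y. ennreal (norm (g y x)) \<partial>lborel \<partial>lborel)"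
    by (subst lborel_pair.nn_integral_snd[symmetric]) auto
  also have "\<dots> \<le> (\<integral>\<^sup>+x. ennreal (C * norm (u x)) \<partial>lborel)"
  proof (rule nn_integral_mono)
    fix x
    have "(\<integral>\<^sup>+y. ennreal (norm (g y x)) \<partial>lborel) \<le> (\<integral>\<^sup>+y. ennreal (k y x) * ennreal (C * norm (u x)) \<partial>lborel)"
      by (rule nn_integral_mono) (use le k C in \<open>simp add: ennreal_mult'[symmetric] ennreal_leI\<close>)
    also have "\<dots> = (\<integral>\<^sup>+y. ennreal (k y x) \<partial>lborel) * ennreal (C * norm (u x))"
      by (rule nn_integral_multc) (use k(3)[of x] in measurable)
    also have "\<dots> \<le> 1 * ennreal (C * norm (u x))" by (rule mult_right_mono[OF k(1)]) simp
    finally show "(\<integral>\<^sup>+y. ennreal (norm (g y x)) \<partial>lborel) \<le> ennreal (C * norm (u x))" by simp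
  qed
  also have "\<dots> < \<infinity>"
  proof -
    have i: "integrable lborel (\<lambda>x. C * norm (u x))" using u by simp
    have "(\<integral>\<^sup>+x. ennreal (C * norm (u x)) \<partial>lborel) = ennreal (LINT x|lborel. C * norm (u x))"
      by (rule nn_integral_eq_integral[OF i]) (use C in simp)
    then show ?thesis by simp
  qed
  finally show "(\<integral>\<^sup>+p. ennreal (norm (case p of (y, x) \<Rightarrow> g y x)) \<partial>(lborel \<Otimes>\<^sub>M lborel)) < \<infinity>" .
qed

lemma smooth_compose: "smooth f \<Longrightarrow> smooth G \<Longrightarrow> smooth (\<lambda>x. f (G x))"
  unfolding smooth_def by (rule allI, rule C_k_compose[of _ f G]) auto

lemma bounded_linear_pairing:
  fixes d :: "'n::finite \<Rightarrow> complex"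
  shows "bounded_linear (\<lambda>w :: complex^'n. \<Sum>i\<in>UNIV. w $ i * d i)"
  by (intro bounded_linear_sum bounded_linear_compose[OF bounded_linear_mult_left bounded_linear_vec_nth])

lemma norm_pairing_le:
  fixes w :: "complex^'n"
  assumes "\<And>i. norm (d i) \<le> b" shows "norm (\<Sum>i\<in>UNIV. w $ i * d i) \<le> real CARD('n) * b * norm w"
proof -
  have "norm (\<Sum>i\<in>UNIV. w $ i * d i) \<le> (\<Sum>i\<in>(UNIV::'n set). norm w * b)"
    by (rule sum_norm_le) (use assms in \<open>simp add: norm_mult mult_mono Finite_Cartesian_Product.norm_nth_le\<close>)
  then show ?thesis by (simp add: ac_simps)
qed

section \<open>Averages of divergence-free fields are divergence free\<close>

context spreading
begin

text \<open>Test with \<open>\<phi>\<close>, integrate over \<open>y\<close> first and substitute;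
  after a second exchange, each fixed \<open>z\<close> gives the pairing of \<open>u\<close> with
  the gradient of \<open>\<phi>\<close> composed with a displacement, which vanishes by
  hypothesis.\<close>

lemma spread_weakly_div_free:
  assumes adm: "admissible \<delta>" and u: "integrable lborel u" "weakly_div_free u"
  shows "weakly_div_free (spread \<delta> u)"
  unfolding weakly_div_free_def
proof (intro allI impI)
  fix \<phi> :: "real^'n \<Rightarrow> complex" assume \<phi>: "smooth \<phi>" "bdd_supp \<phi>"
  obtain b where b: "b > 0" "\<And>i x. norm (partial i \<phi> x) \<le> b" using smooth_partial_bounded[OF \<phi>] by blast
  have [measurable]: "partial i \<phi> \<in> borel_measurable borel" for i using smooth_borel[OF smooth_partial[OF \<phi>(1)]] .
  have u_meas [measurable]: "u \<in> borel_measurable borel" using u(1) by simp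
  note [measurable] = \<delta>_meas[OF adm]
  \<comment> \<open>\<open>G\<close> is the density of the moved part in kernel form and
    \<open>Q\<close> the same contribution in terms of \<open>z\<close>; \<open>H\<close> is the
    part that stays in place.\<close>
  define G where "G y x = (\<Sum>i\<in>UNIV. integrand \<delta> u y x $ i * partial i \<phi> y)" for y x
  define Q where "Q z x = (\<Sum>i\<in>UNIV. jac (displace \<delta> V z) x (u x) $ i * partial i \<phi> (displace \<delta> V z x))" for z x
  define H where "H y = (if \<delta> y = 0 then (\<Sum>i\<in>UNIV. u y $ i * partial i \<phi> y) else 0)" for y
  define C where "C = real CARD('n) * b * CJ"
  have C: "C \<ge> 0" using b CJ_nonneg by (simp add: C_def)
  have CG: "real CARD('n) * b * (k * (CJ * s)) = k * (C * s)" for k s by (simp add: C_def ac_simps)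
  have G_int: "integrable (lborel \<Otimes>\<^sub>M lborel) (\<lambda>(y, x). G y x)"
  proof (rule integrable_pair_weight[where k="ker \<delta>", OF _ _ _ _ _ u(1) C])
    have [measurable]: "(\<lambda>p. integrand \<delta> u (fst p) (snd p)) \<in> borel_measurable (lborel \<Otimes>\<^sub>M lborel)"
      using integrand_meas[OF adm u_meas] by (simp add: case_prod_unfold)
    show "(\<lambda>(y, x). G y x) \<in> borel_measurable (lborel \<Otimes>\<^sub>M lborel)"
      unfolding G_def case_prod_unfold by measurable
    show "(\<lambda>y. ker \<delta> y x) \<in> borel_measurable borel" for x unfolding ker_def pos_def by measurable
    show "norm (G y x) \<le> ker \<delta> y x * (C * norm (u x))" for y x
    proof -
      have "norm (G y x) \<le> real CARD('n) * b * norm (integrand \<delta> u y x)"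
        unfolding G_def by (rule norm_pairing_le) (rule b)
      also have "\<dots> \<le> real CARD('n) * b * (ker \<delta> y x * (CJ * norm (u x)))"
        using integrand_bound_ker[OF adm] b by (intro mult_left_mono) auto
      finally show ?thesis by (simp only: CG)
    qed
  qed (use nn_integral_ker_y[OF adm] ker_nonneg[OF adm] in auto)
  have disp_meas [measurable]: "(\<lambda>p. displace \<delta> V (fst p) (snd p)) \<in> borel_measurable (lborel \<Otimes>\<^sub>M lborel)"
    unfolding displace_def by measurable
  have Q_int: "integrable (lborel \<Otimes>\<^sub>M lborel) (\<lambda>(z, x). \<rho> z *\<^sub>R Q z x)"
  proof (rule integrable_pair_weight[where k="\<lambda>z x. \<rho> z", OF _ _ _ _ _ u(1) C])
    have [measurable]: "(\<lambda>p. jac (displace \<delta> V (fst p)) (snd p) (u (snd p))) \<in> borel_measurable (lborel \<Otimes>\<^sub>M lborel)"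
      by (rule jac_meas[OF adm]) measurable
    show "(\<lambda>(z, x). \<rho> z *\<^sub>R Q z x) \<in> borel_measurable (lborel \<Otimes>\<^sub>M lborel)"
      unfolding Q_def case_prod_unfold by measurable
    show "norm (\<rho> z *\<^sub>R Q z x) \<le> \<rho> z * (C * norm (u x))" for z x
    proof (cases "norm z < \<eta>")
      case True
      have "norm (Q z x) \<le> real CARD('n) * b * norm (jac (displace \<delta> V z) x (u x))"
        unfolding Q_def by (rule norm_pairing_le) (rule b)
      also have "\<dots> \<le> real CARD('n) * b * (CJ * norm (u x))"
        using displace_jac_le[OF adm V_plus_le[OF adm]] True b by (intro mult_left_mono) auto
      finally have "\<rho> z * norm (Q z x) \<le> \<rho> z * (real CARD('n) * b * (CJ * norm (u x)))"
        using \<rho>_nonneg[of z] by (rule mult_left_mono)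
      then show ?thesis using \<rho>_nonneg[of z] by (simp add: C_def ac_simps)
    qed (use \<rho>_0[of z] in simp)
    show "(\<integral>\<^sup>+z. ennreal (\<rho> z) \<partial>lborel) \<le> 1" for x :: "real^'n"
      using \<rho>_int \<rho>_nonneg by (simp add: nn_integral_eq_integral)
  qed (use \<rho>_nonneg in auto)
  have H_int: "integrable lborel H"
  proof (rule Bochner_Integration.integrable_bound)
    show "integrable lborel (\<lambda>x. (real CARD('n) * b) *\<^sub>R u x)" using u by simp
    show "H \<in> borel_measurable lborel" unfolding H_def by measurable
    have "norm (H x) \<le> norm ((real CARD('n) * b) *\<^sub>R u x)" for x
      using norm_pairing_le[of "\<lambda>i. partial i \<phi> x" b "u x"] b by (simp add: H_def)
    then show "AE x in lborel. norm (H x) \<le> norm ((real CARD('n) * b) *\<^sub>R u x)" by simp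
  qed
  have 1: "(\<Sum>i\<in>UNIV. spread \<delta> u y $ i * partial i \<phi> y) = (LINT x|lborel. G y x) + H y" for y
  proof (cases "\<delta> y = 0")
    case True
    \<comment> \<open>A nonzero kernel would give
      \<open>0 < \<delta> x \<le> 2 * \<delta> y = 0\<close>. So nothing is moved onto a point where
      \<delta> vanishes, and the two parts do not overlap.\<close>
    have "ker \<delta> y x = 0" for x using ker_support(1,5)[OF adm, of y x] True by fastforce
    then have "G y x = 0" for x by (simp add: G_def integrand_def)
    then show ?thesis using True by (simp add: spread_def H_def)
  next
    case False
    then have "\<delta> y > 0" using \<delta>_nonneg[OF adm, of y] by simp
    then show ?thesis using False
        integral_bounded_linear[OF bounded_linear_pairing[of "\<lambda>i. partial i \<phi> y"] integrand_integrable[OF adm u(1), of y]]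
      by (simp add: spread_def H_def G_def)
  qed
  have 2: "(LINT y|lborel. G y x) + H x = (LINT z|lborel. \<rho> z *\<^sub>R Q z x)" for x
  proof (cases "\<delta> x = 0")
    case True
    have "partial j (displace \<delta> V z) x = axis j 1" for j z
    proof -
      \<comment> \<open>A zero of the nonnegative \<delta> is a minimum. With the gradient gone, the
        Jacobian of every displacement at \<open>x\<close> is the identity, so \<open>Q\<close>
        there is just the unmoved pairing.\<close>
      have "partial j \<delta> x = 0"
      proof -
        have "frechet_derivative \<delta> (at x) = (\<lambda>h. 0)"
          by (rule differential_zero_maxmin[OF UNIV_I open_UNIV C_k_has_derivative[OF smoothD[OF \<delta>_smooth[OF adm]]]])
            (use \<delta>_nonneg[OF adm] True in simp)
        then show ?thesis by (simp add: partial_def)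
      qed
      then show ?thesis using True by (simp add: partial_displace[OF adm])
    qed
    then have "Q z x = (\<Sum>i\<in>UNIV. u x $ i * partial i \<phi> x)" for z
      unfolding Q_def by (subst jac_id) (auto simp: displace_def True)
    then have Q: "Q z x = H x" for z using True by (simp add: H_def)
    have "G y x = 0" for y using True ker_eq_0[OF adm] by (simp add: G_def integrand_def)
    then show ?thesis using \<rho>_int by (simp add: Q)
  next
    case False
    let ?f = "\<lambda>z y. (\<Sum>i\<in>UNIV. jac (displace \<delta> V z) x (u x) $ i * partial i \<phi> y)"
    have m: "(\<lambda>y. ?f (pos \<delta> y x) y) \<in> borel_measurable borel"
    proof -
      have [measurable]: "(\<lambda>y. pos \<delta> y x) \<in> borel_measurable borel" unfolding pos_def by measurable
      have [measurable]: "(\<lambda>y. jac (displace \<delta> V (pos \<delta> y x)) x (u x)) \<in> borel_measurable borel"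
        by (rule jac_meas[OF adm]) measurable
      show ?thesis by measurable
    qed
    have "G y x = ker \<delta> y x *\<^sub>R ?f (pos \<delta> y x) y" for y
      by (simp add: G_def integrand_def scaleR_sum_right)
    then show ?thesis using integral_ker_y[where f="?f" and x=x, OF adm m] False by (simp add: Q_def H_def)
  qed
  \<comment> \<open>Displacements for a fixed \<open>z\<close> are bounded, so \<open>\<phi>\<close>
    composed with one of them is again smooth with bounded support and may be used as a test
    function.\<close>
  have 3: "(LINT x|lborel. Q z x) = 0" for z
  proof -
    have sm: "smooth (\<lambda>x. \<phi> (displace \<delta> V z x))"
      by (rule smooth_compose[OF \<phi>(1) smooth_displace[OF adm]])
    obtain r where r: "r > 0" "\<And>z. r < norm z \<Longrightarrow> \<phi> z = 0" using \<phi>(2) by (auto simp: bdd_supp_def)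
    have "\<phi> (displace \<delta> V z x) = 0" if x: "r + R + norm z < norm x" for x
    proof (rule r(2))
      have "norm (V x + z) \<le> R + norm z" using norm_triangle_ineq[of "V x" z] R[of x] \<eta> by linarith
      then have "norm (\<delta> x *\<^sub>R (V x + z)) \<le> R + norm z"
        using \<delta>_nonneg[OF adm, of x] \<delta>_le[OF adm, of x] t0 mult_mono[of "\<delta> x" 1 "norm (V x + z)" "R + norm z"] by simp
      then show "r < norm (displace \<delta> V z x)"
        using x norm_triangle_ineq2[of x "- (\<delta> x *\<^sub>R (V x + z))"] by (simp add: displace_def)
    qed
    then have bs: "bdd_supp (\<lambda>x. \<phi> (displace \<delta> V z x))"
      unfolding bdd_supp_def using r(1) R_pos by (intro exI[of _ "r + R + norm z"]) (auto intro: add_pos_nonneg)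
    have "Q z x = (\<Sum>j\<in>UNIV. u x $ j * partial j (\<lambda>x. \<phi> (displace \<delta> V z x)) x)" for x
      unfolding Q_def by (rule jac_chain[OF \<phi>(1) smooth_displace[OF adm]])
    then show ?thesis using u(2) sm bs by (simp add: weakly_div_free_def)
  qed
  have i1: "integrable lborel (\<lambda>y. LINT x|lborel. G y x)" using lborel_pair.integrable_fst[OF G_int] by simp
  have i2: "integrable lborel (\<lambda>x. LINT y|lborel. G y x)" using lborel_pair.integrable_snd[OF G_int] by simp
  have "(LINT y|lborel. (\<Sum>i\<in>UNIV. spread \<delta> u y $ i * partial i \<phi> y))
      = (LINT y|lborel. LINT x|lborel. G y x) + (LINT x|lborel. H x)"
    unfolding 1 by (rule Bochner_Integration.integral_add[OF i1 H_int])
  also have "\<dots> = (LINT x|lborel. LINT y|lborel. G y x) + (LINT x|lborel. H x)"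
    using lborel_pair.Fubini_integral[OF G_int] by simp
  also have "\<dots> = (LINT x|lborel. LINT z|lborel. \<rho> z *\<^sub>R Q z x)"
    unfolding 2[symmetric] by (rule Bochner_Integration.integral_add[OF i2 H_int, symmetric])
  also have "\<dots> = (LINT z|lborel. LINT x|lborel. \<rho> z *\<^sub>R Q z x)"
    using lborel_pair.Fubini_integral[OF Q_int] by simp
  also have "\<dots> = 0" by (simp add: 3)
  finally show "(LINT y|lborel. (\<Sum>i\<in>UNIV. spread \<delta> u y $ i * partial i \<phi> y)) = 0" .
qed

section \<open>Constant \<delta>: the average is a solenoidal test function\<close>

context
  fixes t :: real assumes t: "0 < t" "t \<le> t0"
begin

definition scaled_kernel :: "real^'n \<Rightarrow> real" where
  "scaled_kernel w = \<rho> ((1 / t) *\<^sub>R w) / t ^ CARD('n)"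

lemma const_adm: "admissible (\<lambda>_. t)" using t by (simp add: admissible_const)

lemma scaled_kernel: "smooth scaled_kernel" "bdd_supp scaled_kernel"
proof -
  have "C_k k (\<lambda>w. \<rho> ((1 / t) *\<^sub>R w))" for k
    by (rule C_k_compose[of k \<rho> "\<lambda>w. (1 / t) *\<^sub>R w", OF smoothD[OF \<rho>_smooth(1)]
        C_k_bounded_linear[OF bounded_linear_scaleR_right C_k_id]])
  then show "smooth scaled_kernel"
    unfolding scaled_kernel_def[abs_def] smooth_def by (intro allI C_k_bounded_linear[OF bounded_linear_divide])
  have "scaled_kernel w = 0" if "t * \<eta> < norm w" for w
    using \<rho>_0[of "(1 / t) *\<^sub>R w"] that t by (simp add: scaled_kernel_def field_simps)
  then show "bdd_supp scaled_kernel" unfolding bdd_supp_def using t \<eta> by (intro exI[of _ "t * \<eta>"]) auto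
qed

text \<open>For constant \<delta> the Jacobian does not depend on \<open>z\<close>, hence not on
  \<open>y\<close>. All dependence on \<open>y\<close> sits in a smooth kernel centred at the
  displaced point, to which the smoothing lemmas apply.\<close>

lemma integrand_const:
  "integrand (\<lambda>_. t) u y x
   = scaled_kernel (y - displace (\<lambda>_. t) V 0 x) *\<^sub>R jac (displace (\<lambda>_. t) V 0) x (u x)"
proof -
  have "pos (\<lambda>_. t) y x = (1 / t) *\<^sub>R (y - displace (\<lambda>_. t) V 0 x)"
    using t by (simp add: pos_def displace_def algebra_simps)
  moreover have "jac (displace (\<lambda>_. t) V z) x w = jac (displace (\<lambda>_. t) V 0) x w" for z w
    by (simp add: jac_def partial_displace[OF const_adm])
  ultimately show ?thesis by (simp add: integrand_def ker_def scaled_kernel_def)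
qed

lemma spread_const:
  "spread (\<lambda>_. t) u = (\<lambda>y. LINT x|lborel. scaled_kernel (y - displace (\<lambda>_. t) V 0 x) *\<^sub>R
     jac (displace (\<lambda>_. t) V 0) x (u x))"
proof -
  have "integrand (\<lambda>_. t) u y = (\<lambda>x. scaled_kernel (y - displace (\<lambda>_. t) V 0 x) *\<^sub>R
     jac (displace (\<lambda>_. t) V 0) x (u x))" for y by (rule ext) (rule integrand_const)
  then show ?thesis using t by (intro ext) (simp add: spread_def)
qed

text \<open>Smoothness comes from the kernel and compact support from \<open>push\<close>. The
  divergence in \<open>y\<close> equals minus the pairing of \<open>u\<close> with the gradient of
  the kernel composed with the displacement, so weak divergence freeness of \<open>u\<close> makes
  it vanish pointwise.\<close>

lemma spread_const_sol_test_function: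
  assumes u: "integrable lborel u" "weakly_div_free u" "\<And>x. x \<notin> \<Omega> \<Longrightarrow> u x = 0"
  shows "spread (\<lambda>_. t) u \<in> sol_test_functions \<Omega>"
proof -
  let ?a = "displace (\<lambda>_. t) V 0" and ?w = "\<lambda>x. jac (displace (\<lambda>_. t) V 0) x (u x)"
  let ?v = "spread (\<lambda>_. t) u"
  have [measurable]: "u \<in> borel_measurable borel" using u(1) by simp
  have a: "?a \<in> borel_measurable borel" using smooth_borel[OF smooth_displace[OF const_adm]] .
  have w: "integrable lborel ?w"
  proof (rule Bochner_Integration.integrable_bound)
    show "integrable lborel (\<lambda>x. CJ *\<^sub>R u x)" using u by simp
    show "?w \<in> borel_measurable lborel" using jac_meas[OF const_adm, of u "\<lambda>_. 0" lborel "\<lambda>x. x"] by simp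
    have "norm (?w x) \<le> norm (CJ *\<^sub>R u x)" for x
      using displace_jac_le[OF const_adm V_plus_le[OF const_adm], of 0 x "u x"] \<eta> CJ_nonneg by simp
    then show "AE x in lborel. norm (?w x) \<le> norm (CJ *\<^sub>R u x)" by simp
  qed
  have smv: "smooth ?v" unfolding spread_const by (rule smooth_smoothing[OF scaled_kernel a w])
  \<comment> \<open>All places that mass from the closure of \<Omega> can reach. As a continuous
    image of a compact set, contained in \<Omega> by \<open>push\<close>, it confines the support of
    the average.\<close>
  define S where "S = (\<lambda>p. displace (\<lambda>_. t) V (snd p) (fst p)) ` (closure \<Omega> \<times> cball 0 \<eta>)"
  have "compact S" unfolding S_def displace_def
    by (intro compact_continuous_image continuous_intros continuous_on_compose2[OF smooth_continuous[OF V(1), of UNIV]] compact_Times)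
      (use bounded_\<Omega> in \<open>auto simp: compact_closure\<close>)
  have S\<Omega>: "S \<subseteq> \<Omega>" using push t by (auto simp: S_def displace_def)
  have "y \<in> S" if "?v y \<noteq> 0" for y
  proof -
    have "\<exists>x. integrand (\<lambda>_. t) u y x \<noteq> 0"
    proof (rule ccontr)
      assume "\<not> ?thesis"
      then have "integrand (\<lambda>_. t) u y = (\<lambda>x. 0)" by blast
      then show False using that t by (simp add: spread_def)
    qed
    then obtain x where x: "integrand (\<lambda>_. t) u y x \<noteq> 0" by blast
    then have k: "ker (\<lambda>_. t) y x \<noteq> 0" by (auto simp: integrand_def)
    have "u x \<noteq> 0" using integrand_bound_ker[OF const_adm, of u y x] x by auto
    then have "x \<in> closure \<Omega>" using u(3) closure_subset by blast
    then show ?thesis unfolding S_def using ker_support(2,3)[OF const_adm k]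
      by (intro image_eqI[of _ _ "(x, pos (\<lambda>_. t) y x)"]) auto
  qed
  then have sub: "{y. ?v y \<noteq> 0} \<subseteq> S" by blast
  then have "closure {y. ?v y \<noteq> 0} \<subseteq> S" using \<open>compact S\<close> compact_imp_closed by (intro closure_minimal) auto
  then have supp: "compact (closure {y. ?v y \<noteq> 0})" "closure {y. ?v y \<noteq> 0} \<subseteq> \<Omega>"
    using S\<Omega> bounded_subset[OF compact_imp_bounded[OF \<open>compact S\<close>] sub] by (auto simp: compact_closure)
  have "divergence ?v y = 0" for y
  proof -
    \<comment> \<open>For fixed \<open>y\<close> the kernel, seen as a function of its centre,
      serves as the test function; the reflection causes the minus sign in
      \<open>p\<phi>\<close>.\<close>
    let ?\<phi> = "\<lambda>\<zeta>. complex_of_real (scaled_kernel (y - \<zeta>))"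
    have p\<phi>: "partial i ?\<phi> \<zeta> = - of_real (partial i scaled_kernel (y - \<zeta>))" for i \<zeta>
    proof -
      note d = C_k_has_derivative[OF smoothD[OF scaled_kernel(1)], of "y - \<zeta>"]
      have "((\<lambda>\<zeta>. scaled_kernel (y - \<zeta>)) has_derivative
          (\<lambda>h. frechet_derivative scaled_kernel (at (y - \<zeta>)) (- h))) (at \<zeta>)"
        by (rule has_derivative_compose[of "\<lambda>\<zeta>. y - \<zeta>" "\<lambda>h. - h" \<zeta> UNIV scaled_kernel, OF _ d])
          (auto intro!: derivative_eq_intros)
      then have "(?\<phi> has_derivative (\<lambda>h. of_real (frechet_derivative scaled_kernel (at (y - \<zeta>)) (- h)))) (at \<zeta>)"
        by (rule bounded_linear.has_derivative[OF bounded_linear_of_real])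
      then have "partial i ?\<phi> \<zeta> = of_real (frechet_derivative scaled_kernel (at (y - \<zeta>)) (- axis i 1))"
        by (rule partial_eq)
      then show ?thesis
        using linear_neg[OF has_derivative_linear[OF d], of "axis i 1"] by (simp add: partial_def)
    qed
    have "C_k k (\<lambda>\<zeta>. scaled_kernel (y - \<zeta>))" for k
      by (rule C_k_compose[of k scaled_kernel "\<lambda>\<zeta>. y - \<zeta>", OF smoothD[OF scaled_kernel(1)]])
        (intro C_k_diff C_k_const C_k_id)
    then have sm\<phi>: "smooth ?\<phi>" unfolding smooth_def by (intro allI C_k_of_real)
    have sm: "smooth (\<lambda>x. ?\<phi> (?a x))"
      by (rule smooth_compose[OF sm\<phi> smooth_displace[OF const_adm]])
    obtain r where r: "r > 0" "\<And>z. r < norm z \<Longrightarrow> scaled_kernel z = 0" using scaled_kernel(2) by (auto simp: bdd_supp_def)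
    have "?\<phi> (?a x) = 0" if x: "r + R + norm y < norm x" for x
    proof -
      have "norm (t *\<^sub>R V x) \<le> R" using mult_mono[of t 1 "norm (V x)" R] R[of x] \<eta> t t0 by simp
      then have "r < norm (y - ?a x)"
        using x norm_triangle_ineq2[of x "y - t *\<^sub>R V x"] norm_triangle_ineq4[of y "t *\<^sub>R V x"]
          norm_minus_commute[of x "y - t *\<^sub>R V x"]
        by (simp add: displace_def algebra_simps)
      then show ?thesis using r(2) by simp
    qed
    then have bs: "bdd_supp (\<lambda>x. ?\<phi> (?a x))"
      unfolding bdd_supp_def using r(1) R_pos by (intro exI[of _ "r + R + norm y"]) (auto intro: add_pos_nonneg)
    have int: "integrable lborel (\<lambda>x. partial i scaled_kernel (y - ?a x) *\<^sub>R ?w x)" for i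
      by (rule integrable_kernel[OF smooth_partial[OF scaled_kernel(1)] bdd_supp_partial[OF scaled_kernel(2)] a w])
    have "partial i (\<lambda>y. ?v y $ i) y = (LINT x|lborel. partial i scaled_kernel (y - ?a x) *\<^sub>R ?w x $ i)" for i
    proof -
      have "partial i (\<lambda>y. ?v y $ i) y = partial i ?v y $ i"
        by (rule partial_bounded_linear[OF bounded_linear_vec_nth smoothD[OF smv]])
      also have "partial i ?v y = (LINT x|lborel. partial i scaled_kernel (y - ?a x) *\<^sub>R ?w x)"
        unfolding spread_const by (rule partial_smoothing[OF scaled_kernel a w])
      also have "\<dots> $ i = (LINT x|lborel. (partial i scaled_kernel (y - ?a x) *\<^sub>R ?w x) $ i)"
        by (rule integral_bounded_linear[OF bounded_linear_vec_nth int, symmetric])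
      finally show ?thesis by simp
    qed
    then have "divergence ?v y = (\<Sum>i\<in>UNIV. (LINT x|lborel. partial i scaled_kernel (y - ?a x) *\<^sub>R ?w x $ i))"
      by (simp add: divergence_def)
    also have "\<dots> = (LINT x|lborel. (\<Sum>i\<in>UNIV. partial i scaled_kernel (y - ?a x) *\<^sub>R ?w x $ i))"
      using integrable_bounded_linear[OF bounded_linear_vec_nth int] by (intro Bochner_Integration.integral_sum[symmetric]) simp
    also have "\<dots> = (LINT x|lborel. - (\<Sum>j\<in>UNIV. u x $ j * partial j (\<lambda>x. ?\<phi> (?a x)) x))"
      unfolding jac_chain[OF sm\<phi> smooth_displace[OF const_adm], symmetric] p\<phi>
      by (simp add: sum_negf[symmetric] scaleR_conv_of_real mult.commute)
    also have "\<dots> = 0" using u(2) sm bs by (simp add: weakly_div_free_def)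
    finally show ?thesis .
  qed
  then show ?thesis using smv supp by (simp add: sol_test_functions_def test_functions_def smooth_def)
qed

end

end

section \<open>Approximation by solenoidal test functions\<close>

text \<open>A convex power lies above its tangent at \<open>a\<close>. Young's inequality for the
  numbers \<open>a powr q\<close> and \<open>s powr q\<close> with weights
  \<open>(q - 1) / q\<close> and \<open>1 / q\<close> says precisely this.\<close>

lemma powr_tangent:
  fixes q a s :: real
  assumes "q \<ge> 1" "a > 0" "s \<ge> 0"
  shows "a powr q + q * a powr (q - 1) * (s - a) \<le> s powr q"
proof -
  have aq: "a powr (q - 1) * a = a powr q" using assms(2) powr_mult_base[of a "q - 1"] by (simp add: mult.commute)
  show ?thesis
  proof (cases "s = 0")
    case True
    have "(1 - q) * a powr q \<le> 0" using assms by (simp add: mult_le_0_iff)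
    moreover have "q * a powr (q - 1) * (0 - a) = - (q * a powr q)" using aq by (simp add: mult.assoc)
    ultimately show ?thesis using True by (simp only: left_diff_distrib) simp
  next
    case False
    then have s: "s > 0" using assms by simp
    have "(a powr q) powr ((q - 1) / q) * (s powr q) powr (1 / q) \<le> ((q - 1) / q) * a powr q + (1 / q) * s powr q"
      by (rule Youngs_inequality_0) (use assms s in \<open>auto simp: field_simps\<close>)
    then have "a powr (q - 1) * s \<le> ((q - 1) / q) * a powr q + (1 / q) * s powr q"
      using assms s by (simp add: powr_powr)
    then have "q * (a powr (q - 1) * s) \<le> q * (((q - 1) / q) * a powr q + (1 / q) * s powr q)"
      using assms by (intro mult_left_mono) auto
    also have "\<dots> = (q - 1) * a powr q + s powr q" using assms by (simp add: field_simps)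
    finally have "q * (a powr (q - 1) * s) \<le> (q - 1) * a powr q + s powr q" .
    moreover have "q * a powr (q - 1) * (s - a) = q * (a powr (q - 1) * s) - q * a powr q"
      using aq by (simp only: right_diff_distrib mult.assoc)
    ultimately show ?thesis by (simp only: left_diff_distrib)
  qed
qed

text \<open>Jensen's inequality for the mean over \<open>S\<close>, by integrating the tangent
  inequality at that mean. The right-hand side is an \<open>ennreal\<close> integral, so it also
  covers a power that is not integrable.\<close>

lemma power_mean_set:
  fixes f :: "'a \<Rightarrow> real"
  assumes S: "S \<in> sets M" "emeasure M S < \<infinity>" "measure M S > 0" and f: "\<And>x. f x \<ge> 0" "f \<in> borel_measurable M"
    and i: "integrable M (\<lambda>x. indicator S x * f x)" and q: "q \<ge> 1"
  shows "ennreal (((LINT x|M. indicator S x * f x) / measure M S) powr q)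
    \<le> ennreal (1 / measure M S) * (\<integral>\<^sup>+x. ennreal (indicator S x * f x powr q) \<partial>M)"
proof -
  define m where "m = measure M S"
  define a where "a = (LINT x|M. indicator S x * f x) / m"
  have m: "m > 0" using S by (simp add: m_def)
  have "a \<ge> 0" using m f unfolding a_def by (intro divide_nonneg_pos integral_nonneg_AE) auto
  let ?h = "\<lambda>x. indicator S x * f x powr q"
  have hm: "?h \<in> borel_measurable M" using f S by measurable
  have "ennreal (a powr q) \<le> ennreal (1 / m) * (\<integral>\<^sup>+x. ennreal (?h x) \<partial>M)"
  proof (cases "a = 0 \<or> \<not> integrable M ?h")
    case True
    then show ?thesis
    proof
      assume "\<not> integrable M ?h"
      then have "(\<integral>\<^sup>+x. ennreal (?h x) \<partial>M) = \<infinity>"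
        using integrableI_nonneg[OF hm] by (auto simp: less_top[symmetric])
      then show ?thesis using m by (simp add: ennreal_mult_top)
    qed simp
  next
    case False
    then have h: "integrable M ?h" and a: "a > 0" using \<open>a \<ge> 0\<close> by auto
    define c where "c = q * a powr (q - 1)"
    have S1: "integrable M (\<lambda>x. indicator S x :: real)" using S by simp
    have Ia: "(LINT x|M. indicator S x * f x) = m * a" using m by (simp add: a_def)
    have "(LINT x|M. (a powr q - c * a) * indicator S x + c * (indicator S x * f x))
        = (a powr q - c * a) * m + c * (m * a)"
      using S1 i S(1) by (simp add: Ia m_def)
    then have "m * a powr q = (LINT x|M. (a powr q - c * a) * indicator S x + c * (indicator S x * f x))"
      by (simp add: algebra_simps)
    also have "\<dots> \<le> (LINT x|M. ?h x)"
    proof (rule integral_mono)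
      fix x
      show "(a powr q - c * a) * indicator S x + c * (indicator S x * f x) \<le> ?h x"
        using powr_tangent[OF q a f(1)[of x]] by (auto simp: indicator_def c_def algebra_simps)
    qed (use S1 i h in auto)
    finally have "a powr q \<le> 1 / m * (LINT x|M. ?h x)" using m by (simp add: field_simps)
    then have "ennreal (a powr q) \<le> ennreal (1 / m * (LINT x|M. ?h x))" by (rule ennreal_leI)
    also have "\<dots> = ennreal (1 / m) * ennreal (LINT x|M. ?h x)" using m by (intro ennreal_mult') auto
    also have "ennreal (LINT x|M. ?h x) = (\<integral>\<^sup>+x. ennreal (?h x) \<partial>M)"
      by (rule nn_integral_eq_integral[OF h, symmetric]) simp
    finally show ?thesis .
  qed
  then show ?thesis by (simp add: a_def m_def)
qed

lemma measure_cball_scale: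
  "r \<ge> 0 \<Longrightarrow> measure lborel (cball (c :: real^'n) r) = r ^ CARD('n) * measure lborel (ball (0 :: real^'n) 1)"
  using content_ball_conv_unit_ball[of r c] content_cball_conv_ball[of c r] by simp

text \<open>Truncate the values of \<open>u\<close> at \<open>N\<close>, take continuous functions
  converging almost everywhere to the result, force a common integrable bound on them and apply
  dominated convergence.\<close>

lemma bounded_continuous_approx:
  fixes u :: "real^'n \<Rightarrow> 'b::euclidean_space"
  assumes u: "integrable lborel u" "bdd_supp u" and e: "e > 0"
  shows "\<exists>f. continuous_on UNIV f \<and> bdd_supp f \<and> (LINT x|lborel. norm (u x - f x)) < e"
proof -
  have [measurable]: "u \<in> borel_measurable borel" using u by simp
  obtain r where r: "r > 0" "\<And>z. r < norm z \<Longrightarrow> u z = 0" using u(2) by (auto simp: bdd_supp_def)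
  define w where "w N x = (if norm (u x) \<le> real N then u x else 0)" for N x
  have w_meas [measurable]: "w N \<in> borel_measurable borel" for N unfolding w_def by measurable
  have "(\<lambda>N. LINT x|lborel. norm (u x - w N x)) \<longlonglongrightarrow> (LINT x::real^'n|lborel. norm (0::'b))"
  proof (rule integral_dominated_convergence[where w="\<lambda>x. norm (u x)"])
    have "(\<lambda>N. norm (u x - w N x)) \<longlonglongrightarrow> norm (0::'b)" for x
    proof (rule tendsto_eventually)
      obtain N0 :: nat where "norm (u x) \<le> real N0" using real_arch_simple by blast
      then show "\<forall>\<^sub>F N in sequentially. norm (u x - w N x) = norm (0::'b)"
        by (intro eventually_sequentiallyI[of N0]) (auto simp: w_def)
    qed
    then show "AE x in lborel. (\<lambda>N. norm (u x - w N x)) \<longlonglongrightarrow> norm (0::'b)" by simp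
  qed (use u in \<open>auto simp: w_def\<close>)
  then have "\<forall>\<^sub>F N in sequentially. (LINT x|lborel. norm (u x - w N x)) < e / 2"
    using e by (intro order_tendstoD(2)) auto
  then have "\<forall>\<^sub>F N in sequentially. (LINT x|lborel. norm (u x - w N x)) < e / 2 \<and> N \<ge> 1"
    using eventually_ge_at_top[of 1] by (rule eventually_conj)
  then obtain N where N: "(LINT x|lborel. norm (u x - w N x)) < e / 2" "N \<ge> 1"
    using eventually_happens'[OF sequentially_bot] by blast
  have "w N \<in> borel_measurable lebesgue" by (intro measurable_completion) simp
  then have "w N measurable_on UNIV" by (rule lebesgue_measurable_imp_measurable_on) simp
  then obtain Z g where Z: "negligible Z" and g: "\<And>n. continuous_on UNIV (g n)"
    "\<And>x. x \<notin> Z \<Longrightarrow> (\<lambda>n. g n x) \<longlonglongrightarrow> w N x"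
    by (auto simp: measurable_on_def)
  \<comment> \<open>\<open>clip\<close> is the radial retraction onto the ball of radius
    \<open>N\<close>, and \<open>cut\<close> equals 1 on the ball that contains the support.
    Together they make the sequence dominated without changing its limit.\<close>
  define clip where "clip v = (real N / max (real N) (norm v)) *\<^sub>R v" for v :: 'b
  have clip_cont: "continuous_on UNIV clip"
    unfolding clip_def using N by (intro continuous_intros) auto
  have clip_le: "norm (clip v) \<le> real N" for v using N by (auto simp: clip_def divide_simps max_def)
  have clip_id: "norm v \<le> real N \<Longrightarrow> clip v = v" for v using N by (simp add: clip_def max_def)
  define cut where "cut x = max 0 (min 1 (r + 1 - norm x))" for x :: "real^'n"
  have cut_cont: "continuous_on UNIV cut" unfolding cut_def by (intro continuous_intros)
  define h where "h n x = cut x *\<^sub>R clip (g n x)" for n x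
  have h_cont: "continuous_on UNIV (h n)" for n unfolding h_def
    by (intro continuous_intros cut_cont continuous_on_compose2[OF clip_cont g(1)]) auto
  have h_meas [measurable]: "h n \<in> borel_measurable borel" for n
    using h_cont borel_measurable_continuous_onI by blast
  have h_supp: "bdd_supp (h n)" for n
    unfolding bdd_supp_def h_def cut_def using r(1) by (intro exI[of _ "r + 1"]) auto
  have h_le: "norm (h n x) \<le> real N * indicator (cball 0 (r + 1)) x" for n x
  proof (cases "norm x \<le> r + 1")
    case True
    have "norm (h n x) \<le> 1 * real N" unfolding h_def norm_scaleR
      by (intro mult_mono clip_le) (auto simp: cut_def)
    then show ?thesis using True by simp
  qed (auto simp: h_def cut_def)
  have w_le: "norm (w N x) \<le> real N * indicator (cball 0 (r + 1)) x" for x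
    using r(2)[of x] r(1) by (cases "norm x \<le> r + 1") (auto simp: w_def)
  have h_lim: "(\<lambda>n. h n x) \<longlonglongrightarrow> w N x" if "x \<notin> Z" for x
  proof -
    have "(\<lambda>n. clip (g n x)) \<longlonglongrightarrow> clip (w N x)"
      using continuous_on_tendsto_compose[OF clip_cont g(2)[OF that]] by simp
    then have "(\<lambda>n. h n x) \<longlonglongrightarrow> cut x *\<^sub>R clip (w N x)" unfolding h_def by (intro tendsto_intros)
    moreover have "cut x *\<^sub>R clip (w N x) = w N x"
    proof (cases "norm x \<le> r")
      case True
      then have "cut x = 1" by (simp add: cut_def)
      moreover have "clip (w N x) = w N x" by (rule clip_id) (simp add: w_def)
      ultimately show ?thesis by simp
    next
      case False
      then have "w N x = 0" using r(2) by (simp add: w_def)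
      then show ?thesis by (simp add: clip_def)
    qed
    ultimately show ?thesis by simp
  qed
  have "(\<lambda>n. LINT x|lborel. norm (w N x - h n x)) \<longlonglongrightarrow> (LINT x::real^'n|lborel. norm (0::'b))"
  proof (rule integral_dominated_convergence[where w="\<lambda>x. 2 * real N * indicator (cball 0 (r + 1)) x"])
    have "AE x in lebesgue. x \<notin> Z" using Z AE_not_in negligible_iff_null_sets by blast
    then have "AE x in lborel. x \<notin> Z" by (rule AE_completion_iff[THEN iffD1])
    then show "AE x in lborel. (\<lambda>n. norm (w N x - h n x)) \<longlonglongrightarrow> norm (0::'b)"
    proof eventually_elim
      case (elim x)
      have "(\<lambda>n. norm (w N x - h n x)) \<longlonglongrightarrow> norm (w N x - w N x)"
        by (intro tendsto_intros h_lim elim)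
      then show ?case by simp
    qed
    show "integrable lborel (\<lambda>x::real^'n. 2 * real N * indicator (cball 0 (r + 1)) x)"
      by (intro integrable_mult_right integrable_real_indicator emeasure_bounded_finite) auto
    have "norm (norm (w N x - h n x)) \<le> 2 * real N * indicator (cball 0 (r + 1)) x" for n x
      using norm_triangle_ineq4[of "w N x" "h n x"] w_le[of x] h_le[of n x] by simp
    then show "AE x in lborel. norm (norm (w N x - h n x)) \<le> 2 * real N * indicator (cball 0 (r + 1)) x" for n by simp
  qed auto
  then have "\<forall>\<^sub>F n in sequentially. (LINT x|lborel. norm (w N x - h n x)) < e / 2"
    using e by (intro order_tendstoD(2)) auto
  then obtain n where n: "(LINT x|lborel. norm (w N x - h n x)) < e / 2"
    using eventually_happens'[OF sequentially_bot] by blast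
  have ih: "integrable lborel (h n)" by (rule bdd_supp_integrable[OF h_cont h_supp])
  have iw: "integrable lborel (w N)"
    by (rule Bochner_Integration.integrable_bound[OF u(1)]) (auto simp: w_def)
  have "norm (u x - h n x) \<le> norm (u x - w N x) + norm (w N x - h n x)" for x
    using norm_triangle_ineq[of "u x - w N x" "w N x - h n x"] by simp
  then have "(LINT x|lborel. norm (u x - h n x)) \<le> (LINT x|lborel. norm (u x - w N x) + norm (w N x - h n x))"
    by (intro integral_mono) (use u ih iw in auto)
  also have "\<dots> = (LINT x|lborel. norm (u x - w N x)) + (LINT x|lborel. norm (w N x - h n x))"
    using u ih iw by simp
  also have "\<dots> < e" using N n by simp
  finally show ?thesis using h_cont h_supp by blast
qed

lemma bdd_supp_uniformly_continuous:
  fixes f :: "real^'n \<Rightarrow> 'b::real_normed_vector"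
  assumes f: "continuous_on UNIV f" "bdd_supp f" and e: "e > 0"
  shows "\<exists>d>0. \<forall>x y. norm (x - y) < d \<longrightarrow> norm (f x - f y) < e"
proof -
  obtain r where r: "r > 0" "\<And>z. r < norm z \<Longrightarrow> f z = 0" using f(2) by (auto simp: bdd_supp_def)
  have "uniformly_continuous_on (cball 0 (r + 1)) f"
    by (rule compact_uniformly_continuous[OF continuous_on_subset[OF f(1)]]) auto
  then obtain d where d: "d > 0" "\<And>x y. x \<in> cball 0 (r + 1) \<Longrightarrow> y \<in> cball 0 (r + 1) \<Longrightarrow> dist y x < d \<Longrightarrow> dist (f y) (f x) < e"
    unfolding uniformly_continuous_on_def using e by metis
  have "norm (f x - f y) < e" if xy: "norm (x - y) < min d 1" for x y
  proof (cases "norm x \<le> r + 1 \<and> norm y \<le> r + 1")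
    case True
    then show ?thesis using d(2)[of y x] xy by (simp add: dist_norm)
  next
    case False
    then have "r < norm x" "r < norm y"
      using xy norm_triangle_ineq2[of x y] norm_triangle_ineq2[of y x] by (auto simp: norm_minus_commute)
    then show ?thesis using r e by simp
  qed
  then show ?thesis using d(1) by (intro exI[of _ "min d 1"]) auto
qed

lemma lborel_integral_reflect:
  fixes f :: "'a::euclidean_space \<Rightarrow> real"
  assumes [measurable]: "f \<in> borel_measurable borel"
  shows "(LINT x|lborel. f (a - x)) = (LINT x|lborel. f x)"
proof -
  have "lborel = distr lborel borel (\<lambda>x. a - x)" using lborel_affine[of "-1" a] by (simp add: density_1)
  then have "(LINT x|lborel. f x) = (LINT x|distr lborel borel (\<lambda>x. a - x). f x)" by (rule arg_cong)
  also have "\<dots> = (LINT x|lborel. f (a - x))" by (rule integral_distr) auto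
  finally show ?thesis by simp
qed

lemma jac_diff: "jac G x (w1 - w2) = jac G x w1 - jac G x w2"
  by (simp add: jac_def vec_eq_iff right_diff_distrib sum_subtractf)

section \<open>Norm bounds and convergence of the averages\<close>

context spreading
begin

definition \<omega> :: real where "\<omega> = measure lborel (ball (0 :: real^'n) 1)"
text \<open>Chosen so that \<open>CK / \<delta> y ^ CARD('n)\<close> is \<open>C1\<close> divided by
  the volume of the ball of radius \<open>2 * R * \<delta> y\<close>: the kernel estimate becomes
  \<open>C1\<close> times a mean value.\<close>

definition C1 :: real where "C1 = CK * (2 * R) ^ CARD('n) * \<omega>"

lemma \<omega>_pos: "\<omega> > 0" using content_ball_pos[of 1 "0::real^'n"] by (simp add: \<omega>_def)
lemma C1_nonneg: "C1 \<ge> 0" using CK_nonneg R_pos \<omega>_pos by (simp add: C1_def)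

lemma measure_cball: "r \<ge> 0 \<Longrightarrow> measure lborel (cball (c :: real^'n) r) = r ^ CARD('n) * \<omega>"
  unfolding \<omega>_def by (rule measure_cball_scale)

lemma spread_bound_avg:
  assumes adm: "admissible \<delta>" and u: "integrable lborel u" and d: "\<delta> y > 0"
  shows "norm (spread \<delta> u y) \<le> C1 * ((LINT x|lborel. indicator (cball y (2 * R * \<delta> y)) x * norm (u x))
     / measure lborel (cball y (2 * R * \<delta> y)))"
proof -
  have "C1 / measure lborel (cball y (2 * R * \<delta> y)) = CK / \<delta> y ^ CARD('n)"
    using R_pos d \<omega>_pos by (simp add: C1_def measure_cball power_mult_distrib)
  then show ?thesis using spread_bound[OF assms] by (metis (no_types, lifting) times_divide_eq_left times_divide_eq_right)
qed

lemma spread_bound_sup: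
  assumes adm: "admissible \<delta>" and u: "integrable lborel u" and d: "\<delta> y > 0"
    and M: "AE x in lborel. norm (u x) \<le> M" and "M \<ge> 0"
  shows "norm (spread \<delta> u y) \<le> C1 * M"
proof -
  let ?S = "cball y (2 * R * \<delta> y)"
  have m: "measure lborel ?S > 0" using R_pos d \<omega>_pos by (simp add: measure_cball)
  have "integrable lborel (\<lambda>x. indicator ?S x *\<^sub>R norm (u x))"
    using u by (intro integrable_mult_indicator) auto
  moreover have "integrable lborel (\<lambda>x::real^'n. M * indicator ?S x)"
    by (intro integrable_mult_right integrable_real_indicator emeasure_bounded_finite) auto
  moreover have "AE x in lborel. indicator ?S x * norm (u x) \<le> M * indicator ?S x"
    using M by eventually_elim (simp add: indicator_def)
  ultimately have "(LINT x|lborel. indicator ?S x * norm (u x)) \<le> (LINT x|lborel. M * indicator ?S x)"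
    by (intro integral_mono_AE) auto
  then have "(LINT x|lborel. indicator ?S x * norm (u x)) / measure lborel ?S \<le> M"
    using m by (simp add: field_simps)
  then have "C1 * ((LINT x|lborel. indicator ?S x * norm (u x)) / measure lborel ?S) \<le> C1 * M"
    using C1_nonneg by (rule mult_left_mono)
  then show ?thesis using spread_bound_avg[of \<delta> u y, OF adm u d] by linarith
qed

text \<open>The radius of the averaging ball is the same for all \<open>y\<close>. Jensen bounds the
  power of the mean by the mean of the power, and in Tonelli the symmetry of
  \<open>x \<in> cball y r\<close> makes the volume \<open>m\<close> cancel.\<close>

lemma spread_const_Lq:
  assumes t: "0 < t" "t \<le> t0" and u: "integrable lborel u" and q: "q \<ge> 1"
  shows "(\<integral>\<^sup>+y. ennreal (norm (spread (\<lambda>_. t) u y) powr q) \<partial>lborel)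
    \<le> ennreal (C1 powr q) * (\<integral>\<^sup>+x. ennreal (norm (u x) powr q) \<partial>lborel)"
proof -
  have adm: "admissible (\<lambda>_. t)" using t by (simp add: admissible_const)
  have [measurable]: "u \<in> borel_measurable borel" using u by simp
  define r where "r = 2 * R * t"
  have r: "r > 0" using R_pos t by (simp add: r_def)
  define m where "m = r ^ CARD('n) * \<omega>"
  have m: "m > 0" using r \<omega>_pos by (simp add: m_def)
  have mc: "measure lborel (cball (y::real^'n) r) = m" for y using r by (simp add: m_def measure_cball)
  have ec: "emeasure lborel (cball (y::real^'n) r) = ennreal m" for y
    using mc[of y] emeasure_lborel_cball_finite[of y r] by (simp add: emeasure_eq_ennreal_measure)
  have pt: "ennreal (norm (spread (\<lambda>_. t) u y) powr q)
      \<le> ennreal (C1 powr q) * (ennreal (1 / m) * (\<integral>\<^sup>+x. ennreal (indicator (cball y r) x * norm (u x) powr q) \<partial>lborel))" for y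
  proof -
    define a where "a = (LINT x|lborel. indicator (cball y r) x * norm (u x)) / m"
    have a0: "a \<ge> 0" using m unfolding a_def by (intro divide_nonneg_pos integral_nonneg_AE) auto
    have "norm (spread (\<lambda>_. t) u y) \<le> C1 * a"
      using spread_bound_avg[OF adm u, of y] t mc[of y] by (simp add: r_def a_def)
    then have "norm (spread (\<lambda>_. t) u y) powr q \<le> (C1 * a) powr q"
      using q by (intro powr_mono2) auto
    also have "\<dots> = C1 powr q * a powr q" using C1_nonneg a0 by (simp add: powr_mult)
    finally have "ennreal (norm (spread (\<lambda>_. t) u y) powr q) \<le> ennreal (C1 powr q) * ennreal (a powr q)"
      by (simp add: ennreal_leI ennreal_mult'[symmetric])
    also have "ennreal (a powr q) \<le> ennreal (1 / m) * (\<integral>\<^sup>+x. ennreal (indicator (cball y r) x * norm (u x) powr q) \<partial>lborel)"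
    proof -
      have "integrable lborel (\<lambda>x. indicator (cball y r) x *\<^sub>R norm (u x))"
        using u by (intro integrable_mult_indicator) auto
      then show ?thesis
        using power_mean_set[of "cball y r" lborel "\<lambda>x. norm (u x)" q] q m mc[of y] ec[of y] by (simp add: a_def)
    qed
    finally show ?thesis by (simp add: mult_left_mono)
  qed
  have [measurable]: "(\<lambda>p::(real^'n) \<times> (real^'n). indicat_real (cball 0 r) (snd p - fst p)) \<in> borel_measurable (lborel \<Otimes>\<^sub>M lborel)"
  proof -
    have "(\<lambda>p::(real^'n) \<times> (real^'n). indicat_real (cball 0 r) (snd p - fst p)) = (\<lambda>p. if norm (snd p - fst p) \<le> r then 1 else 0)"
      by (simp add: indicator_def fun_eq_iff)
    then show ?thesis by simp
  qed
  have ind: "indicat_real (cball y r) x = indicat_real (cball 0 r) (x - y)" for x y :: "real^'n"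
    by (simp add: indicator_def dist_norm norm_minus_commute)
  have jm [measurable]: "(\<lambda>p. ennreal (indicat_real (cball (fst p) r) (snd p) * norm (u (snd p)) powr q)) \<in> borel_measurable (lborel \<Otimes>\<^sub>M lborel)"
  proof -
    have "(\<lambda>p. ennreal (indicat_real (cball (fst p) r) (snd p) * norm (u (snd p)) powr q))
        = (\<lambda>p. ennreal (indicat_real (cball 0 r) (snd p - fst p) * norm (u (snd p)) powr q))"
      by (rule ext) (subst ind, rule refl)
    then show ?thesis by (simp only:) measurable
  qed
  have "(\<integral>\<^sup>+y. ennreal (norm (spread (\<lambda>_. t) u y) powr q) \<partial>lborel)
     \<le> (\<integral>\<^sup>+y. ennreal (C1 powr q) * (ennreal (1 / m) * (\<integral>\<^sup>+x. ennreal (indicator (cball y r) x * norm (u x) powr q) \<partial>lborel)) \<partial>lborel)"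
    by (rule nn_integral_mono) (rule pt)
  also have "\<dots> = ennreal (C1 powr q) * (ennreal (1 / m) * (\<integral>\<^sup>+y. \<integral>\<^sup>+x. ennreal (indicator (cball y r) x * norm (u x) powr q) \<partial>lborel \<partial>lborel))"
    by (subst nn_integral_cmult, measurable, subst nn_integral_cmult, measurable)
  also have "(\<integral>\<^sup>+y. \<integral>\<^sup>+x. ennreal (indicator (cball y r) x * norm (u x) powr q) \<partial>lborel \<partial>lborel)
     = (\<integral>\<^sup>+x. \<integral>\<^sup>+y. ennreal (indicator (cball y r) x * norm (u x) powr q) \<partial>lborel \<partial>lborel)"
    by (rule lborel_pair.Fubini'[symmetric], unfold case_prod_unfold, rule jm)
  also have "\<dots> = (\<integral>\<^sup>+x. ennreal m * ennreal (norm (u x) powr q) \<partial>lborel)"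
  proof (rule nn_integral_cong)
    fix x :: "real^'n"
    have "(\<integral>\<^sup>+y. ennreal (indicator (cball y r) x * norm (u x) powr q) \<partial>lborel)
       = (\<integral>\<^sup>+y. indicator (cball x r) y * ennreal (norm (u x) powr q) \<partial>lborel)"
      by (rule nn_integral_cong) (simp add: indicator_def dist_commute)
    also have "\<dots> = ennreal m * ennreal (norm (u x) powr q)"
      by (subst nn_integral_multc) (auto simp: ec intro!: borel_measurable_indicator)
    finally show "(\<integral>\<^sup>+y. ennreal (indicator (cball y r) x * norm (u x) powr q) \<partial>lborel) = ennreal m * ennreal (norm (u x) powr q)" .
  qed
  also have "\<dots> = ennreal m * (\<integral>\<^sup>+x. ennreal (norm (u x) powr q) \<partial>lborel)"
    by (rule nn_integral_cmult) measurable
  also have "ennreal (1 / m) * \<dots> = (\<integral>\<^sup>+x. ennreal (norm (u x) powr q) \<partial>lborel)"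
    using m by (simp add: mult.assoc[symmetric] ennreal_mult'[symmetric])
  finally show ?thesis .
qed

lemma spread_const_L1:
  assumes t: "0 < t" "t \<le> t0" and u: "integrable lborel u"
  shows "integrable lborel (spread (\<lambda>_. t) u)"
    and "(LINT y|lborel. norm (spread (\<lambda>_. t) u y)) \<le> C1 * (LINT x|lborel. norm (u x))"
proof -
  have adm: "admissible (\<lambda>_. t)" using t by (simp add: admissible_const)
  have [measurable]: "u \<in> borel_measurable borel" using u by simp
  have [measurable]: "spread (\<lambda>_. t) u \<in> borel_measurable borel" using spread_meas[OF adm] by simp
  have iu: "(\<integral>\<^sup>+x. ennreal (norm (u x)) \<partial>lborel) = ennreal (LINT x|lborel. norm (u x))"
    using u by (intro nn_integral_eq_integral) auto
  have le: "(\<integral>\<^sup>+y. ennreal (norm (spread (\<lambda>_. t) u y)) \<partial>lborel) \<le> ennreal (C1 * (LINT x|lborel. norm (u x)))"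
    using spread_const_Lq[OF t u, of 1] C1_nonneg iu by (simp add: powr_one ennreal_mult')
  then show *: "integrable lborel (spread (\<lambda>_. t) u)"
    by (intro integrableI_bounded) (auto intro: le_less_trans)
  have "ennreal (LINT y|lborel. norm (spread (\<lambda>_. t) u y)) \<le> ennreal (C1 * (LINT x|lborel. norm (u x)))"
    using le nn_integral_eq_integral[of lborel "\<lambda>y. norm (spread (\<lambda>_. t) u y)"] * by simp
  then show "(LINT y|lborel. norm (spread (\<lambda>_. t) u y)) \<le> C1 * (LINT x|lborel. norm (u x))"
    using C1_nonneg by (subst (asm) ennreal_le_iff) auto
qed

lemma spread_const_diff:
  assumes t: "0 < t" "t \<le> t0" and u: "integrable lborel u" "integrable lborel f"
  shows "spread (\<lambda>_. t) (\<lambda>x. u x - f x) y = spread (\<lambda>_. t) u y - spread (\<lambda>_. t) f y"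
proof -
  have adm: "admissible (\<lambda>_. t)" using t by (simp add: admissible_const)
  have "integrand (\<lambda>_. t) (\<lambda>x. u x - f x) y = (\<lambda>x. integrand (\<lambda>_. t) u y x - integrand (\<lambda>_. t) f y x)"
    by (simp add: integrand_def jac_diff scaleR_diff_right fun_eq_iff)
  then show ?thesis using t integrand_integrable[OF adm u(1)] integrand_integrable[OF adm u(2)]
    by (simp add: spread_def)
qed

text \<open>Three errors are compared with \<open>\<kappa> x *\<^sub>R f y\<close>: the Jacobian
  against the identity and the motion by \<open>V x\<close> against that by \<open>V y\<close>, both
  of order \<open>t\<close>, and \<open>f x\<close> against \<open>f y\<close>, at most
  \<open>e\<close> as the averaging radius \<open>R * t\<close> is below \<open>d\<close>.
  \<open>K\<close> depends on \<open>f\<close> only through its supremum.\<close>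

lemma spread_const_continuous_close:
  assumes f: "continuous_on UNIV f" "bdd_supp f"
  shows "\<exists>K. \<forall>e d t y. e > 0 \<longrightarrow> (\<forall>x y. norm (x - y) < d \<longrightarrow> norm (f x - f y) < e) \<longrightarrow> 0 < t \<longrightarrow> t \<le> t0 \<longrightarrow> R * t < d \<longrightarrow>
    norm (spread (\<lambda>_. t) f y - f y) \<le> K * (t + e)"
proof -
  obtain M where M: "M > 0" "\<And>x. norm (f x) \<le> M" using bounded_if_bdd_supp[OF f] by blast
  obtain L\<rho> where L\<rho>: "L\<rho> > 0" "\<And>x y. norm (\<rho> x - \<rho> y) \<le> L\<rho> * norm (x - y)" using smooth_lipschitz[OF \<rho>_smooth] by blast
  obtain LV where LV: "LV > 0" "\<And>x y. norm (V x - V y) \<le> LV * norm (x - y)" using smooth_lipschitz[OF V] by blast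
  have [measurable]: "f \<in> borel_measurable borel" using f borel_measurable_continuous_onI by blast
  \<comment> \<open>The first summand measures the Jacobian error, the second the replacement of
    \<open>V x\<close> by \<open>V y\<close>, both per unit of \<open>t\<close>.\<close>
  define a where "a = B * (real CARD('n) ^ 2 * A * M) + L\<rho> * LV * R * M"
  define K where "K = R ^ CARD('n) * \<omega> * (a + B)"
  have a0: "a \<ge> 0" using B_nonneg A_nonneg M L\<rho> LV R_pos by (simp add: a_def)
  have "norm (spread (\<lambda>_. t) f y - f y) \<le> K * (t + e)"
    if e: "e > 0" "\<And>x y. norm (x - y) < d \<Longrightarrow> norm (f x - f y) < e" and t: "0 < t" "t \<le> t0" "R * t < d" for e d t y
  proof -
    have adm: "admissible (\<lambda>_. t)" using t by (simp add: admissible_const)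
    \<comment> \<open>The kernel with \<open>V x\<close> frozen at \<open>V y\<close>. It depends on
      \<open>x\<close> only through \<open>y - x\<close>, so reflection and scaling give it mass 1
      in \<open>x\<close>, whereas \<open>ker\<close> is normalised in \<open>y\<close>.\<close>
    define \<kappa> where "\<kappa> x = \<rho> ((1 / t) *\<^sub>R (y - x) - V y) / t ^ CARD('n)" for x
    have if0: "integrable lborel (integrand (\<lambda>_. t) f y)"
      by (rule integrand_integrable[OF adm bdd_supp_integrable[OF f]]) (use t in simp)
    have \<kappa>_supp: "\<kappa> x = 0" if "x \<notin> cball y (R * t)" for x
    proof (rule ccontr)
      assume "\<kappa> x \<noteq> 0"
      then have "norm ((1 / t) *\<^sub>R (y - x) - V y) < \<eta>" using \<rho>_0 by (force simp: \<kappa>_def)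
      then have "norm ((1 / t) *\<^sub>R (y - x)) < R"
        using R[of y] norm_triangle_ineq2[of "(1 / t) *\<^sub>R (y - x)" "V y"] by linarith
      moreover have "norm ((1 / t) *\<^sub>R (y - x)) = norm (y - x) / t" using t by simp
      ultimately have "norm (y - x) / t < R" by (simp only:)
      then show False using that t by (simp add: dist_norm pos_divide_less_eq)
    qed
    have [measurable]: "\<kappa> \<in> borel_measurable borel" unfolding \<kappa>_def by measurable
    have \<kappa>_int: "integrable lborel \<kappa>"
    proof (rule Bochner_Integration.integrable_bound)
      show "integrable lborel (\<lambda>x. B / t ^ CARD('n) * indicator (cball y (R * t)) x)"
        by (intro integrable_mult_right integrable_real_indicator emeasure_bounded_finite) auto
      have "norm (\<kappa> x) \<le> norm (B / t ^ CARD('n) * indicator (cball y (R * t)) x)" for x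
        using \<kappa>_supp[of x] B[of "(1 / t) *\<^sub>R (y - x) - V y"] \<rho>_nonneg[of "(1 / t) *\<^sub>R (y - x) - V y"] t B_nonneg
        by (auto simp: \<kappa>_def indicator_def divide_right_mono)
      then show "AE x in lborel. norm (\<kappa> x) \<le> norm (B / t ^ CARD('n) * indicator (cball y (R * t)) x)" by simp
    qed simp
    have \<kappa>_1: "(LINT x|lborel. \<kappa> x) = 1"
    proof -
      let ?g = "\<lambda>w. \<rho> ((1 / t) *\<^sub>R w - V y) / t ^ CARD('n)"
      have "(LINT x|lborel. \<kappa> x) = (LINT x|lborel. ?g (y - x))" by (simp add: \<kappa>_def)
      also have "\<dots> = (LINT w|lborel. ?g w)" by (rule lborel_integral_reflect) measurable
      also have "\<dots> = t ^ DIM(real^'n) *\<^sub>R (LINT z|lborel. ?g (t *\<^sub>R V y + t *\<^sub>R z))"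
        by (rule lborel_integral_affine[OF _ t(1)]) measurable
      also have "\<dots> = (LINT z|lborel. \<rho> z)" using t by (simp add: algebra_simps)
      finally show ?thesis using \<rho>_int by simp
    qed
    have bd: "norm (integrand (\<lambda>_. t) f y x - \<kappa> x *\<^sub>R f y) \<le> (a * t + B * e) / t ^ CARD('n) * indicator (cball y (R * t)) x" for x
    proof (cases "x \<in> cball y (R * t)")
      case False
      have "ker (\<lambda>_. t) y x = 0"
        using ker_support(4)[OF adm, of y x] False by (force simp: dist_norm)
      then show ?thesis using False \<kappa>_supp[OF False] by (simp add: integrand_def)
    next
      case True
      then have xy: "norm (y - x) \<le> R * t" by (simp add: dist_norm)
      let ?k = "ker (\<lambda>_. t) y x"
      let ?G = "displace (\<lambda>_. t) V (pos (\<lambda>_. t) y x)"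
      have jac: "jac ?G x w = w + of_real t *s jac V x w" for w
      proof -
        have "jac ?G x w $ i = w $ i + of_real t * jac V x w $ i" for i
        proof -
          have "jac ?G x w $ i = (\<Sum>j\<in>UNIV. of_real (axis j 1 $ i) * w $ j) + (\<Sum>j\<in>UNIV. of_real t * (of_real (partial j V x $ i) * w $ j))"
            by (simp add: jac_def partial_displace[OF adm] sum.distrib[symmetric] algebra_simps)
          also have "(\<Sum>j\<in>UNIV. of_real (axis j 1 $ i) * w $ j) = w $ i"
            using jac_id[of "\<lambda>x. x" x w] by (simp add: partial_id jac_def vec_eq_iff)
          finally show ?thesis by (simp add: jac_def sum_distrib_left)
        qed
        then show ?thesis by (simp add: vec_eq_iff)
      qed
      have "norm (jac ?G x (f x) - f x) \<le> t * (real CARD('n) ^ 2 * A * M)"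
      proof -
        have "jac ?G x (f x) - f x = t *\<^sub>R jac V x (f x)"
          unfolding jac by (simp add: vec_eq_iff scaleR_conv_of_real[symmetric])
        moreover have "norm (jac V x (f x)) \<le> real CARD('n) ^ 2 * A * norm (f x)" by (rule norm_jac_le) (rule A)
        moreover have "\<dots> \<le> real CARD('n) ^ 2 * A * M" using M A_nonneg by (intro mult_left_mono) auto
        ultimately have "norm (jac V x (f x)) \<le> real CARD('n) ^ 2 * A * M" by linarith
        then have "t * norm (jac V x (f x)) \<le> t * (real CARD('n) ^ 2 * A * M)"
          using t(1) by (intro mult_left_mono) auto
        then show ?thesis using t(1) by (simp add: \<open>jac ?G x (f x) - f x = t *\<^sub>R jac V x (f x)\<close>)
      qed
      moreover have kB: "0 \<le> ?k" "?k \<le> B / t ^ CARD('n)"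
        using ker_nonneg[OF adm] B t by (auto simp: ker_def divide_right_mono)
      ultimately have 1: "norm (?k *\<^sub>R (jac ?G x (f x) - f x)) \<le> B / t ^ CARD('n) * (t * (real CARD('n) ^ 2 * A * M))"
        unfolding norm_scaleR by (intro mult_mono) (use B_nonneg t in auto)
      have "norm (f x - f y) \<le> e" using e(2)[of x y] xy t(3) by (simp add: norm_minus_commute)
      then have 2: "norm (?k *\<^sub>R (f x - f y)) \<le> B / t ^ CARD('n) * e"
        unfolding norm_scaleR using kB by (intro mult_mono) (use B_nonneg t in auto)
      have "\<bar>\<rho> (pos (\<lambda>_. t) y x) - \<rho> ((1 / t) *\<^sub>R (y - x) - V y)\<bar> \<le> L\<rho> * norm (V y - V x)"
        using L\<rho>(2)[of "pos (\<lambda>_. t) y x" "(1 / t) *\<^sub>R (y - x) - V y"] by (simp add: pos_def)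
      also have "\<dots> \<le> L\<rho> * (LV * (R * t))"
        using LV(2)[of y x] xy LV(1) L\<rho>(1) by (intro mult_left_mono) (auto intro: order_trans[OF _ mult_left_mono])
      finally have "\<bar>?k - \<kappa> x\<bar> \<le> L\<rho> * (LV * (R * t)) / t ^ CARD('n)"
        using t by (simp add: ker_def \<kappa>_def diff_divide_distrib[symmetric] divide_right_mono)
      then have 3: "norm ((?k - \<kappa> x) *\<^sub>R f y) \<le> L\<rho> * (LV * (R * t)) / t ^ CARD('n) * M"
        unfolding norm_scaleR using M(2)[of y] by (intro mult_mono) (use L\<rho> LV R_pos t in auto)
      have "integrand (\<lambda>_. t) f y x - \<kappa> x *\<^sub>R f y
         = ?k *\<^sub>R (jac ?G x (f x) - f x) + ?k *\<^sub>R (f x - f y) + (?k - \<kappa> x) *\<^sub>R f y"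
        by (simp add: integrand_def algebra_simps)
      then have "norm (integrand (\<lambda>_. t) f y x - \<kappa> x *\<^sub>R f y) \<le>
         B / t ^ CARD('n) * (t * (real CARD('n) ^ 2 * A * M)) + B / t ^ CARD('n) * e + L\<rho> * (LV * (R * t)) / t ^ CARD('n) * M"
        using order_trans[OF norm_triangle_ineq add_mono[OF order_trans[OF norm_triangle_ineq add_mono[OF 1 2]] 3]]
        by (simp only:)
      also have "\<dots> = (a * t + B * e) / t ^ CARD('n)"
        using t by (simp add: a_def field_simps)
      finally show ?thesis using True by simp
    qed
    have "spread (\<lambda>_. t) f y - f y = (LINT x|lborel. integrand (\<lambda>_. t) f y x - \<kappa> x *\<^sub>R f y)"
      using t if0 \<kappa>_int \<kappa>_1 by (simp add: spread_def)
    also have "norm \<dots> \<le> (LINT x|lborel. (a * t + B * e) / t ^ CARD('n) * indicator (cball y (R * t)) x)"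
    proof (rule Bochner_Integration.integral_norm_bound_integral[OF _ _ bd])
      show "integrable lborel (\<lambda>x. integrand (\<lambda>_. t) f y x - \<kappa> x *\<^sub>R f y)" using if0 \<kappa>_int by simp
      show "integrable lborel (\<lambda>x. (a * t + B * e) / t ^ CARD('n) * indicator (cball y (R * t)) x)"
        by (intro integrable_mult_right integrable_real_indicator emeasure_bounded_finite) auto
    qed
    also have "\<dots> = (a * t + B * e) * (R ^ CARD('n) * \<omega>)"
      using t R_pos by (simp add: measure_cball power_mult_distrib)
    also have "\<dots> \<le> ((a + B) * (t + e)) * (R ^ CARD('n) * \<omega>)"
    proof (rule mult_right_mono)
      have "a * t + B * e \<le> a * (t + e) + B * (t + e)"
        using a0 B_nonneg t e by (intro add_mono mult_left_mono) auto
      then show "a * t + B * e \<le> (a + B) * (t + e)" by (simp add: algebra_simps)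
    qed (use R_pos \<omega>_pos in simp)
    finally show ?thesis by (simp add: K_def ac_simps)
  qed
  then show ?thesis by blast
qed

end

context spreading
begin

text \<open>Density: approximate \<open>u\<close> by a continuous \<open>f\<close>. The bound by
  \<open>C1\<close>, uniform in the step, disposes of \<open>u - f\<close>; for \<open>f\<close> the
  pointwise estimate is integrated over one ball containing the supports of \<open>f\<close> and of
  all its averages.\<close>

lemma spread_L1_tendsto:
  assumes u: "integrable lborel u" "bdd_supp u"
  shows "(\<lambda>k. LINT y|lborel. norm (spread (\<lambda>_. t0 / real (Suc k)) u y - u y)) \<longlonglongrightarrow> 0"
proof (rule LIMSEQ_I)
  fix \<epsilon> :: real assume \<epsilon>: "\<epsilon> > 0"
  define e1 where "e1 = \<epsilon> / (2 * (C1 + 2))"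
  have e1: "e1 > 0" using \<epsilon> C1_nonneg by (simp add: e1_def)
  obtain f where f: "continuous_on UNIV f" "bdd_supp f" and uf: "(LINT x|lborel. norm (u x - f x)) < e1"
    using bounded_continuous_approx[OF u e1] by blast
  have fi: "integrable lborel f" by (rule bdd_supp_integrable[OF f])
  obtain K where K: "\<And>e d t y. e > 0 \<Longrightarrow> (\<And>x y. norm (x - y) < d \<Longrightarrow> norm (f x - f y) < e) \<Longrightarrow> 0 < t \<Longrightarrow> t \<le> t0 \<Longrightarrow>
      R * t < d \<Longrightarrow> norm (spread (\<lambda>_. t) f y - f y) \<le> K * (t + e)"
    using spread_const_continuous_close[OF f] by blast
  obtain rf where rf: "rf > 0" "\<And>z. rf < norm z \<Longrightarrow> f z = 0" using f(2) by (auto simp: bdd_supp_def)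
  let ?S = "cball (0::real^'n) (rf + 2 * R)"
  define v where "v = measure lborel ?S"
  define q where "q = \<bar>K\<bar> * v + 1"
  \<comment> \<open>For \<open>t < e\<close> the pointwise error of \<open>f\<close> is at most
    \<open>2 * \<bar>K\<bar> * e\<close>, which integrates to at most
    \<open>q * (2 * e) = \<epsilon> / 2\<close>.\<close>
  define e where "e = \<epsilon> / (4 * q)"
  have q: "q > 0" by (simp add: q_def v_def add_nonneg_pos)
  have e: "e > 0" using \<epsilon> q by (simp add: e_def)
  obtain d where d: "d > 0" "\<And>x y. norm (x - y) < d \<Longrightarrow> norm (f x - f y) < e"
    using bdd_supp_uniformly_continuous[OF f e] by blast
  have "(\<lambda>k. t0 / real (Suc k)) \<longlonglongrightarrow> 0" by (rule LIMSEQ_Suc[OF lim_const_over_n])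
  then have "\<forall>\<^sub>F k in sequentially. t0 / real (Suc k) < min e (d / R)"
    using e d R_pos by (intro order_tendstoD(2)) auto
  then obtain N where N: "\<And>k. k \<ge> N \<Longrightarrow> t0 / real (Suc k) < min e (d / R)" unfolding eventually_sequentially by blast
  have "norm ((LINT y|lborel. norm (spread (\<lambda>_. t0 / real (Suc k)) u y - u y)) - 0) < \<epsilon>" if k: "k \<ge> N" for k
  proof -
    define t where "t = t0 / real (Suc k)"
    have t: "0 < t" "t \<le> t0" using t0 by (auto simp: t_def divide_simps mult_le_cancel_left1)
    have te: "t < e" "R * t < d" using N[OF k] R_pos by (auto simp: t_def field_simps)
    have adm: "admissible (\<lambda>_. t)" using t by (simp add: admissible_const)
    let ?s = "spread (\<lambda>_. t)"
    have si: "integrable lborel (?s u)" "integrable lborel (?s f)" "integrable lborel (?s (\<lambda>x. u x - f x))"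
      using spread_const_L1(1)[OF t] u fi by auto
    have far: "?s f y = 0" if "y \<notin> ?S" for y
    proof -
      have "integrand (\<lambda>_. t) f y x = 0" for x
      proof (cases "x \<in> cball y (2 * R * t)")
        case True
        have "2 * R * t \<le> 2 * R" using t t0 R_pos by simp
        then have "rf < norm x" using True that norm_triangle_ineq2[of y "y - x"] by (auto simp: dist_norm)
        then show ?thesis using integrand_bound[OF adm, where y=y and u=f and x=x] rf t by simp
      qed (use integrand_bound[OF adm, where y=y and u=f and x=x] t in simp)
      then have "integrand (\<lambda>_. t) f y = (\<lambda>x. 0)" by blast
      then show ?thesis using t by (simp add: spread_def)
    qed
    have pt: "norm (?s f y - f y) \<le> \<bar>K\<bar> * (2 * e) * indicator ?S y" for y
    proof (cases "y \<in> ?S")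
      case True
      have "norm (?s f y - f y) \<le> K * (t + e)" by (rule K[OF e d(2) t te(2)])
      also have "\<dots> \<le> \<bar>K\<bar> * (2 * e)" using t te e by (intro mult_mono) auto
      finally show ?thesis using True by simp
    next
      case False
      then have "f y = 0" using rf R_pos by auto
      then show ?thesis using far[OF False] False by simp
    qed
    have "(LINT y|lborel. norm (?s f y - f y)) \<le> (LINT y|lborel. \<bar>K\<bar> * (2 * e) * indicator ?S y)"
    proof (rule integral_mono[OF _ _ pt])
      show "integrable lborel (\<lambda>y. \<bar>K\<bar> * (2 * e) * indicator ?S y)"
        by (intro integrable_mult_right integrable_real_indicator emeasure_bounded_finite) auto
    qed (use si fi in auto)
    also have "\<dots> = (\<bar>K\<bar> * v) * (2 * e)" by (simp add: v_def)
    also have "\<dots> \<le> q * (2 * e)" using e by (intro mult_right_mono) (auto simp: q_def)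
    also have "\<dots> = \<epsilon> / 2" using q by (simp add: e_def)
    finally have B1: "(LINT y|lborel. norm (?s f y - f y)) \<le> \<epsilon> / 2" .
    have B2: "(LINT y|lborel. norm (?s (\<lambda>x. u x - f x) y)) \<le> C1 * e1"
    proof -
      have "integrable lborel (\<lambda>x. u x - f x)" using u fi by simp
      from spread_const_L1(2)[OF t this] mult_left_mono[OF less_imp_le[OF uf] C1_nonneg]
      show ?thesis by linarith
    qed
    have "norm (?s u y - u y) \<le> norm (?s (\<lambda>x. u x - f x) y) + norm (?s f y - f y) + norm (u y - f y)" for y
      unfolding spread_const_diff[OF t u(1) fi]
      using norm_triangle_ineq[of "(?s u y - ?s f y) + (?s f y - f y)" "f y - u y"]
        norm_triangle_ineq[of "?s u y - ?s f y" "?s f y - f y"] by (simp add: norm_minus_commute)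
    then have "(LINT y|lborel. norm (?s u y - u y)) \<le>
       (LINT y|lborel. norm (?s (\<lambda>x. u x - f x) y) + norm (?s f y - f y) + norm (u y - f y))"
      by (intro integral_mono) (use si u fi in auto)
    also have "\<dots> = (LINT y|lborel. norm (?s (\<lambda>x. u x - f x) y)) + (LINT y|lborel. norm (?s f y - f y)) + (LINT y|lborel. norm (u y - f y))"
      using si u fi by simp
    also have "\<dots> < C1 * e1 + \<epsilon> / 2 + e1" using B1 B2 uf by linarith
    also have "\<dots> \<le> (C1 + 2) * e1 + \<epsilon> / 2" using e1 by (simp add: algebra_simps)
    also have "(C1 + 2) * e1 = \<epsilon> / 2" using C1_nonneg by (simp add: e1_def field_simps)
    finally show ?thesis using si u by (simp add: t_def)
  qed
  then show "\<exists>N. \<forall>k\<ge>N. norm ((LINT y|lborel. norm (spread (\<lambda>_. t0 / real (Suc k)) u y - u y)) - 0) < \<epsilon>" by blast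
qed

end

section \<open>Test functions as fields on the whole space\<close>

lemma test_functionD:
  assumes "u \<in> test_functions \<Omega>"
  shows "smooth u" "bdd_supp u" "\<And>x. x \<notin> \<Omega> \<Longrightarrow> u x = 0"
    "\<And>x i. x \<notin> \<Omega> \<Longrightarrow> partial i u x = 0"
proof -
  let ?S = "closure {x. u x \<noteq> 0}"
  have u: "\<And>k. C_k k u" "compact ?S" "?S \<subseteq> \<Omega>" using assms by (auto simp: test_functions_def)
  show "smooth u" using u by (simp add: smooth_def)
  obtain r where r: "r > 0" "\<And>x. x \<in> ?S \<Longrightarrow> norm x \<le> r"
    using compact_imp_bounded[OF u(2)] bounded_pos by metis
  have "u z = 0" if "r < norm z" for z
  proof (rule ccontr)
    assume "u z \<noteq> 0"
    then have "z \<in> ?S" using closure_subset[of "{x. u x \<noteq> 0}"] by auto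
    then show False using r that by fastforce
  qed
  then show "bdd_supp u" using r(1) by (auto simp: bdd_supp_def)
  show "u x = 0" if "x \<notin> \<Omega>" for x using that u(3) closure_subset[of "{x. u x \<noteq> 0}"] by auto
  show "partial i u x = 0" if "x \<notin> \<Omega>" for x i
  proof -
    have "partial i u x = partial i (\<lambda>_. 0) x"
    proof (rule partial_cong_open[of "- ?S" x "\<lambda>_. 0" u 0])
      show "x \<in> - ?S" using that u(3) by auto
      show "0 = u y" if "y \<in> - ?S" for y using that closure_subset[of "{x. u x \<noteq> 0}"] by auto
    qed (auto intro: C_k_const)
    then show ?thesis by simp
  qed
qed

text \<open>By the product rule the pairing of \<open>u\<close> with the gradient of
  \<open>\<phi>\<close> is the divergence of \<open>\<phi> u\<close>, whose integral vanishes. The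
  divergence of \<open>u\<close> is 0 outside \<Omega> as well, because \<open>u\<close> vanishes
  near every such point.\<close>

lemma sol_test_function_weakly_div_free:
  assumes "u \<in> sol_test_functions \<Omega>" shows "weakly_div_free u"
  unfolding weakly_div_free_def
proof (intro allI impI)
  fix \<phi> :: "real^'a \<Rightarrow> complex" assume \<phi>: "smooth \<phi>" "bdd_supp \<phi>"
  have u: "u \<in> test_functions \<Omega>" and div: "\<And>x. x \<in> \<Omega> \<Longrightarrow> divergence u x = 0"
    using assms by (auto simp: sol_test_functions_def)
  note u' = test_functionD[OF u]
  have div0: "(\<Sum>i\<in>UNIV. partial i u x $ i) = 0" for x
  proof (cases "x \<in> \<Omega>")
    case True
    have "partial i (\<lambda>y. u y $ i) x = partial i u x $ i" for i
      by (rule partial_bounded_linear[OF bounded_linear_vec_nth smoothD[OF u'(1)]])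
    then show ?thesis using div[OF True] by (simp add: divergence_def)
  qed (simp add: u'(4))
  define h where "h i x = u x $ i * \<phi> x" for i x
  have c: "C_k k (\<lambda>x. u x $ i)" for k i by (rule C_k_nth[OF smoothD[OF u'(1)]])
  have h: "smooth (h i)" "bdd_supp (h i)" for i
  proof -
    show "smooth (h i)" unfolding h_def smooth_def by (intro allI C_k_mult c smoothD[OF \<phi>(1)])
    show "bdd_supp (h i)" using \<phi>(2) by (auto simp: h_def bdd_supp_def)
  qed
  have ph: "partial i (h i) x = u x $ i * partial i \<phi> x + partial i u x $ i * \<phi> x" for i x
    unfolding h_def partial_mult[OF c smoothD[OF \<phi>(1)]]
    by (simp add: partial_bounded_linear[OF bounded_linear_vec_nth smoothD[OF u'(1)]])
  have "(\<Sum>i\<in>UNIV. u x $ i * partial i \<phi> x) = (\<Sum>i\<in>UNIV. partial i (h i) x)" for x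
    unfolding ph sum.distrib sum_distrib_right[symmetric] div0 by simp
  moreover have "integrable lborel (partial i (h i))" for i
    by (rule bdd_supp_integrable[OF smooth_continuous[OF smooth_partial[OF h(1)]] bdd_supp_partial[OF h(2)]])
  ultimately show "(LINT x|lborel. (\<Sum>i\<in>UNIV. u x $ i * partial i \<phi> x)) = 0"
    using integral_partial_eq_0[OF h] by simp
qed

section \<open>The maximal set\<close>

definition bad_ball :: "(real^'n \<Rightarrow> 'b::euclidean_space) \<Rightarrow> real \<Rightarrow> real^'n \<Rightarrow> real \<Rightarrow> bool" where
  "bad_ball u s a r \<longleftrightarrow> r > 0 \<and> s * measure lborel (ball a r) < (LINT x|lborel. indicator (ball a r) x * norm (u x))"

text \<open>The superlevel set at \<open>s\<close> of the uncentred maximal function. In this form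
  it is open by construction, and a ball containing any point outside it is not bad.\<close>

definition maximal_set :: "(real^'n \<Rightarrow> 'b::euclidean_space) \<Rightarrow> real \<Rightarrow> (real^'n) set" where
  "maximal_set u s = (\<Union>(a, r) \<in> {(a, r). bad_ball u s a r}. ball a r)"

text \<open>The threshold is half of \<open>s\<close>: in a mean exceeding \<open>s\<close>, values
  up to \<open>s / 2\<close> account for at most half, so the large values must supply the
  rest.\<close>

definition large_part :: "(real^'n \<Rightarrow> 'b::euclidean_space) \<Rightarrow> real \<Rightarrow> real^'n \<Rightarrow> real" where
  "large_part u s x = (if norm (u x) > s / 2 then norm (u x) ^ 2 else 0)"

lemma open_maximal_set: "open (maximal_set u s)"
  unfolding maximal_set_def by (intro open_UN) auto

lemma large_part_bounds:
  assumes "s > 0"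
  shows "norm (u x) ^ 2 \<le> s ^ 2 / 4 + large_part u s x" "norm (u x) \<le> s / 2 + (2 / s) * large_part u s x"
proof -
  have "norm (u x) ^ 2 \<le> (s / 2) ^ 2" if "norm (u x) \<le> s / 2" using that by (intro power_mono) auto
  then show "norm (u x) ^ 2 \<le> s ^ 2 / 4 + large_part u s x" by (auto simp: large_part_def power_divide)
  have "norm (u x) \<le> (2 / s) * norm (u x) ^ 2" if "norm (u x) > s / 2"
    using that assms mult_left_mono[of "s / 2" "norm (u x)" "norm (u x)"] by (simp add: power2_eq_square field_simps)
  then show "norm (u x) \<le> s / 2 + (2 / s) * large_part u s x" using assms by (auto simp: large_part_def)
qed

text \<open>Continuity plays the part of Lebesgue differentiation: if \<open>norm (u x) > s\<close>,
  then on a small ball about \<open>x\<close> the field exceeds the midpoint between the two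
  numbers, and this ball is bad.\<close>

lemma norm_le_off_maximal_set:
  fixes u :: "real^'n \<Rightarrow> 'b::euclidean_space"
  assumes u: "continuous_on UNIV u" "integrable lborel u" and s: "s > 0" and x: "x \<notin> maximal_set u s"
  shows "norm (u x) \<le> s"
proof (rule ccontr)
  assume "\<not> norm (u x) \<le> s"
  then have s': "s < (s + norm (u x)) / 2" "(s + norm (u x)) / 2 < norm (u x)" by auto
  define s' where "s' = (s + norm (u x)) / 2"
  have "open {y. s' < norm (u y)}" by (intro open_Collect_less continuous_intros u)
  then obtain r where r: "r > 0" "ball x r \<subseteq> {y. s' < norm (u y)}"
    using s' by (metis (mono_tags, lifting) mem_Collect_eq open_contains_ball s'_def)
  have i: "integrable lborel (\<lambda>y. indicator (ball x r) y *\<^sub>R norm (u y))"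
    using u by (intro integrable_mult_indicator) auto
  have "s' * measure lborel (ball x r) = (LINT y|lborel. s' * indicator (ball x r) y)" by simp
  also have "\<dots> \<le> (LINT y|lborel. indicator (ball x r) y * norm (u y))"
  proof (rule integral_mono)
    show "integrable lborel (\<lambda>y. s' * indicator (ball x r) y)"
      by (intro integrable_mult_right integrable_real_indicator emeasure_bounded_finite) auto
    show "s' * indicator (ball x r) y \<le> indicator (ball x r) y * norm (u y)" for y
      using r(2) by (auto simp: indicator_def)
  qed (use i in simp)
  finally have "s' * measure lborel (ball x r) \<le> (LINT y|lborel. indicator (ball x r) y * norm (u y))" .
  moreover have "s * measure lborel (ball x r) < s' * measure lborel (ball x r)"
    using content_ball_pos[OF r(1), of x] s' by (simp add: s'_def)
  ultimately have "s * measure lborel (ball x r) < (LINT y|lborel. indicator (ball x r) y * norm (u y))" by linarith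
  then have "bad_ball u s x r" unfolding bad_ball_def using r(1) by (intro conjI)
  then show False using x r(1) by (force simp: maximal_set_def)
qed

text \<open>On a bad ball, splitting at \<open>s / 2\<close> bounds \<open>s ^ 2\<close> times its
  volume by four times the integral of \<open>large_part\<close> over it. A disjoint Vitali
  subfamily covers the set after fivefold enlargement; the covering lemma asks for the bound
  \<open>r1\<close> on the radii.\<close>

lemma maximal_set_measure:
  fixes u :: "real^'n \<Rightarrow> 'b::euclidean_space"
  assumes u: "continuous_on UNIV u" "bdd_supp u" and s: "s > 0" and rb: "\<And>a r. bad_ball u s a r \<Longrightarrow> r \<le> r1"
  shows "ennreal (s ^ 2) * emeasure lborel (maximal_set u s)
    \<le> ennreal (4 * 5 ^ CARD('n)) * (\<integral>\<^sup>+x. ennreal (large_part u s x) \<partial>lborel)"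
proof -
  have ui: "integrable lborel u" by (rule bdd_supp_integrable[OF u])
  have [measurable]: "u \<in> borel_measurable borel" using ui by simp
  have lm [measurable]: "large_part u s \<in> borel_measurable borel" unfolding large_part_def by measurable
  have l0: "large_part u s x \<ge> 0" for x by (simp add: large_part_def)
  let ?P = "{(a, r). bad_ball u s a r}"
  obtain C where C: "countable C" "C \<subseteq> ?P" "pairwise (\<lambda>i j. disjnt (ball (fst i) (snd i)) (ball (fst j) (snd j))) C"
    "(\<Union>i\<in>?P. ball (fst i) (snd i)) \<subseteq> (\<Union>i\<in>C. ball (fst i) (5 * snd i))"
  proof (rule Vitali_covering_lemma_balls[where S="\<Union>i\<in>?P. ball (fst i) (snd i)" and K="?P" and a=fst and r=snd and B=r1])
    show "0 < snd i \<and> snd i \<le> r1" if "i \<in> ?P" for i using that rb by (auto simp: bad_ball_def)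
  qed (use that in auto)
  have one: "ennreal (s ^ 2) * emeasure lborel (ball a (5 * r))
     \<le> ennreal (4 * 5 ^ CARD('n)) * (\<integral>\<^sup>+x. ennreal (large_part u s x) * indicator (ball a r) x \<partial>lborel)"
    if b: "bad_ball u s a r" for a r
  proof -
    let ?m = "measure lborel (ball a r)" and ?h = "\<lambda>x. large_part u s x * indicator (ball a r) x"
    have r: "r > 0" using b by (simp add: bad_ball_def)
    obtain M where M: "M > 0" "\<And>x. norm (u x) \<le> M" using bounded_if_bdd_supp[OF u] by blast
    have ih: "integrable lborel ?h"
    proof (rule Bochner_Integration.integrable_bound)
      show "integrable lborel (\<lambda>x. M ^ 2 * indicator (ball a r) x)"
        by (intro integrable_mult_right integrable_real_indicator emeasure_bounded_finite) auto
      have "large_part u s x \<le> M ^ 2" for x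
        using M by (auto simp: large_part_def intro!: power_mono)
      then show "AE x in lborel. norm (?h x) \<le> norm (M ^ 2 * indicator (ball a r) x)"
        using l0 by (auto simp: indicator_def)
    qed (use lm in \<open>auto intro!: borel_measurable_times borel_measurable_indicator\<close>)
    have ib: "integrable lborel (\<lambda>x. (s / 2) * indicator (ball a r) x)"
      by (intro integrable_mult_right integrable_real_indicator emeasure_bounded_finite) auto
    have iu: "integrable lborel (\<lambda>y. indicator (ball a r) y *\<^sub>R norm (u y))"
      using ui by (intro integrable_mult_indicator) auto
    have "s * ?m < (LINT x|lborel. indicator (ball a r) x * norm (u x))" using b by (simp add: bad_ball_def)
    also have "\<dots> \<le> (LINT x|lborel. (s / 2) * indicator (ball a r) x + (2 / s) * ?h x)"
      by (intro integral_mono) (use ih ib iu large_part_bounds(2)[OF s, of u] in \<open>auto simp: indicator_def\<close>)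
    also have "\<dots> = (s / 2) * ?m + (2 / s) * (LINT x|lborel. ?h x)" using ih ib by simp
    finally have "s ^ 2 * ?m \<le> 4 * (LINT x|lborel. ?h x)" using s by (simp add: field_simps power2_eq_square)
    moreover have "measure lborel (ball a (5 * r)) = 5 ^ CARD('n) * ?m"
      using content_ball_conv_unit_ball[of "5 * r" a] content_ball_conv_unit_ball[of r a] r by (simp add: power_mult_distrib)
    ultimately have "s ^ 2 * measure lborel (ball a (5 * r)) \<le> (4 * 5 ^ CARD('n)) * (LINT x|lborel. ?h x)"
      by (simp add: mult.left_commute)
    then have "ennreal (s ^ 2 * measure lborel (ball a (5 * r))) \<le> ennreal ((4 * 5 ^ CARD('n)) * (LINT x|lborel. ?h x))"
      by (rule ennreal_leI)
    moreover have "emeasure lborel (ball a (5 * r)) = ennreal (measure lborel (ball a (5 * r)))"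
      using emeasure_lborel_ball_finite[of a "5 * r"] by (intro emeasure_eq_ennreal_measure) auto
    moreover have "ennreal (LINT x|lborel. ?h x) = (\<integral>\<^sup>+x. ennreal (?h x) \<partial>lborel)"
      by (rule nn_integral_eq_integral[OF ih, symmetric]) (use l0 in simp)
    moreover have "(\<integral>\<^sup>+x. ennreal (?h x) \<partial>lborel) = (\<integral>\<^sup>+x. ennreal (large_part u s x) * indicator (ball a r) x \<partial>lborel)"
      by (rule nn_integral_cong) (simp add: indicator_def)
    ultimately show ?thesis using s by (simp add: ennreal_mult')
  qed
  let ?B = "\<lambda>i. ball (fst i) (snd i) :: (real^'n) set" and ?B5 = "\<lambda>i. ball (fst i) (5 * snd i) :: (real^'n) set"
  have sub: "maximal_set u s \<subseteq> (\<Union>i\<in>C. ?B5 i)"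
    using C(4) by (auto simp: maximal_set_def split_beta)
  have "emeasure lborel (maximal_set u s) = (\<integral>\<^sup>+x. indicator (maximal_set u s) x \<partial>lborel)"
    by (rule nn_integral_indicator[symmetric]) (simp add: open_maximal_set)
  also have "\<dots> \<le> (\<integral>\<^sup>+x. \<integral>\<^sup>+i. indicator (?B5 i) x \<partial>count_space C \<partial>lborel)"
  proof (rule nn_integral_mono)
    fix x :: "real^'n"
    show "indicator (maximal_set u s) x \<le> (\<integral>\<^sup>+i. (indicator (?B5 i) x :: ennreal) \<partial>count_space C)"
    proof (cases "x \<in> maximal_set u s")
      case True
      then obtain i where "i \<in> C" "x \<in> ?B5 i" using sub by blast
      then show ?thesis using nn_integral_ge_point[of i C "\<lambda>i. indicator (?B5 i) x"] True by simp
    qed simp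
  qed
  also have "\<dots> = (\<integral>\<^sup>+i. emeasure lborel (?B5 i) \<partial>count_space C)"
    by (subst nn_integral_count_space_nn_integral[OF C(1)]) (auto intro!: borel_measurable_indicator)
  finally have "ennreal (s ^ 2) * emeasure lborel (maximal_set u s) \<le> ennreal (s ^ 2) * (\<integral>\<^sup>+i. emeasure lborel (?B5 i) \<partial>count_space C)"
    by (rule mult_left_mono) simp
  also have "\<dots> = (\<integral>\<^sup>+i. ennreal (s ^ 2) * emeasure lborel (?B5 i) \<partial>count_space C)"
    by (simp add: nn_integral_cmult)
  also have "\<dots> \<le> (\<integral>\<^sup>+i. ennreal (4 * 5 ^ CARD('n)) * (\<integral>\<^sup>+x. ennreal (large_part u s x) * indicator (?B i) x \<partial>lborel) \<partial>count_space C)"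
    by (rule nn_integral_mono) (use C(2) one in auto)
  also have "\<dots> = ennreal (4 * 5 ^ CARD('n)) * (\<integral>\<^sup>+i. (\<integral>\<^sup>+x. ennreal (large_part u s x) * indicator (?B i) x \<partial>lborel) \<partial>count_space C)"
    by (simp add: nn_integral_cmult)
  \<comment> \<open>Summation over the disjoint balls is countable additivity of the measure with
    density \<open>large_part\<close>.\<close>
  also have "(\<integral>\<^sup>+i. (\<integral>\<^sup>+x. ennreal (large_part u s x) * indicator (?B i) x \<partial>lborel) \<partial>count_space C)
      = (\<integral>\<^sup>+i. emeasure (density lborel (\<lambda>x. ennreal (large_part u s x))) (?B i) \<partial>count_space C)"
    by (rule nn_integral_cong) (simp add: emeasure_density)
  also have "\<dots> = emeasure (density lborel (\<lambda>x. ennreal (large_part u s x))) (\<Union>i\<in>C. ?B i)"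
    using C(1,3) by (intro emeasure_UN_countable[symmetric]) (auto simp: disjoint_family_on_def pairwise_def disjnt_def)
  also have "\<dots> \<le> emeasure (density lborel (\<lambda>x. ennreal (large_part u s x))) UNIV"
    by (rule emeasure_mono) auto
  also have "\<dots> = (\<integral>\<^sup>+x. ennreal (large_part u s x) \<partial>lborel)"
    by (subst emeasure_density) auto
  finally show ?thesis by (simp add: mult_left_mono)
qed

section \<open>Solenoidal truncation\<close>

lemma partial_le_lipschitz:
  fixes f :: "real^'n \<Rightarrow> real"
  assumes f: "C_k (Suc k) f" and L: "\<And>x y. \<bar>f x - f y\<bar> \<le> c * norm (x - y)"
  shows "\<bar>partial j f x\<bar> \<le> c"
proof -
  let ?e = "axis j 1 :: real^'n"
  have d1: "((\<lambda>h. x + h *\<^sub>R ?e) has_derivative (\<lambda>h. h *\<^sub>R ?e)) (at 0)"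
    by (auto intro!: derivative_eq_intros)
  have "((\<lambda>h. f (x + h *\<^sub>R ?e)) has_derivative (\<lambda>h. frechet_derivative f (at x) (h *\<^sub>R ?e))) (at 0)"
    by (rule has_derivative_compose[OF d1]) (use C_k_has_derivative[OF f, of x] in simp)
  moreover have "frechet_derivative f (at x) (h *\<^sub>R ?e) = h * partial j f x" for h
    using linear_scale[OF has_derivative_linear[OF C_k_has_derivative[OF f, of x]]] by (simp add: partial_def)
  ultimately have "((\<lambda>h. f (x + h *\<^sub>R ?e)) has_field_derivative partial j f x) (at 0)"
    by (simp add: has_field_derivative_def mult.commute[of "partial j f x"] mult_commute_abs)
  then have lim: "((\<lambda>h. (f (x + h *\<^sub>R ?e) - f x) / h) \<longlongrightarrow> partial j f x) (at 0)"
    by (simp add: DERIV_def)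
  have "norm (partial j f x) \<le> c"
  proof (rule Lim_norm_ubound[OF _ lim])
    have "norm ((f (x + h *\<^sub>R ?e) - f x) / h) \<le> c" if "h \<noteq> 0" for h
      using L[of "x + h *\<^sub>R ?e" x] that by (simp add: abs_divide divide_le_eq)
    then show "\<forall>\<^sub>F h in at 0. norm ((f (x + h *\<^sub>R ?e) - f x) / h) \<le> c"
      by (simp add: eventually_at_filter)
  qed simp
  then show ?thesis by simp
qed

text \<open>Averaging over the ball of radius \<open>h\<close> preserves the Lipschitz constant and
  every one-sided bound valid on that ball. The truncation uses the mollified function only through
  these bounds.\<close>

lemma mollified_lipschitz:
  fixes f :: "real^'n \<Rightarrow> real"
  assumes f: "bdd_supp f" "\<And>x y. \<bar>f x - f y\<bar> \<le> c * norm (x - y)" and h: "h > 0"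
  shows "\<exists>\<delta>. smooth \<delta> \<and> (\<forall>x y. \<bar>\<delta> x - \<delta> y\<bar> \<le> c * norm (x - y)) \<and>
    (\<forall>x M. (\<forall>y. norm (x - y) < h \<longrightarrow> f y \<le> M) \<longrightarrow> \<delta> x \<le> M) \<and>
    (\<forall>x M. (\<forall>y. norm (x - y) < h \<longrightarrow> M \<le> f y) \<longrightarrow> M \<le> \<delta> x)"
proof -
  obtain \<mu> :: "real^'n \<Rightarrow> real" where \<mu>: "mollifier h \<mu>" using mollifier_exists[OF h] by blast
  then have \<mu>': "smooth \<mu>" "bdd_supp \<mu>" "\<And>z. \<mu> z \<ge> 0" "\<And>z. norm z \<ge> h \<Longrightarrow> \<mu> z = 0" "integrable lborel \<mu>" "(LINT z|lborel. \<mu> z) = 1"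
    by (auto simp: mollifier_def)
  have fc: "continuous_on UNIV f"
  proof (rule lipschitz_on_continuous_on[of "\<bar>c\<bar>"], rule lipschitz_onI)
    fix x y :: "real^'n"
    have "c * norm (x - y) \<le> \<bar>c\<bar> * norm (x - y)" by (intro mult_right_mono) auto
    then show "dist (f x) (f y) \<le> \<bar>c\<bar> * dist x y" using f(2)[of x y] by (simp add: dist_norm)
  qed simp
  have fi: "integrable lborel f" by (rule bdd_supp_integrable[OF fc f(1)])
  obtain Bf where Bf: "Bf > 0" "\<And>x. norm (f x) \<le> Bf" using bounded_if_bdd_supp[OF fc f(1)] by blast
  have [measurable]: "f \<in> borel_measurable borel" "\<mu> \<in> borel_measurable borel" using fi \<mu>'(5) by auto
  define I where "I \<phi> = (LINT z|lborel. \<mu> z * \<phi> z)" for \<phi> :: "real^'n \<Rightarrow> real"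
  have int: "integrable lborel (\<lambda>z. \<mu> z * \<phi> z)" if [measurable]: "\<phi> \<in> borel_measurable borel" and b: "\<And>z. \<bar>\<phi> z\<bar> \<le> b" for \<phi> b
  proof (rule Bochner_Integration.integrable_bound)
    show "integrable lborel (\<lambda>z. b * \<mu> z)" using \<mu>' by simp
    have "b \<ge> 0" using b[of 0] by linarith
    then have "norm (\<mu> z * \<phi> z) \<le> norm (b * \<mu> z)" for z
      using mult_right_mono[OF b[of z] \<mu>'(3)[of z]] \<mu>'(3)[of z] by (simp add: abs_mult mult.commute)
    then show "AE z in lborel. norm (\<mu> z * \<phi> z) \<le> norm (b * \<mu> z)" by simp
  qed measurable
  have le: "I \<phi> \<le> M" if m: "\<phi> \<in> borel_measurable borel" "\<And>z. \<bar>\<phi> z\<bar> \<le> b" and M: "\<And>z. norm z < h \<Longrightarrow> \<phi> z \<le> M" for \<phi> b M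
  proof -
    have "I \<phi> \<le> (LINT z|lborel. \<mu> z * M)" unfolding I_def
    proof (rule integral_mono)
      show "integrable lborel (\<lambda>z. \<mu> z * \<phi> z)" by (rule int[OF m])
      show "integrable lborel (\<lambda>z. \<mu> z * M)" using \<mu>' by simp
      show "\<mu> z * \<phi> z \<le> \<mu> z * M" for z
        using M[of z] \<mu>'(3,4)[of z] by (cases "norm z < h") (auto intro: mult_left_mono)
    qed
    then show ?thesis using \<mu>' by simp
  qed
  define \<delta> where "\<delta> y = (LINT x|lborel. \<mu> (y - x) *\<^sub>R f x)" for y
  have \<delta>: "\<delta> y = I (\<lambda>z. f (y - z))" for y
    unfolding \<delta>_def I_def using lborel_integral_reflect[of "\<lambda>z. \<mu> z * f (y - z)" y] by simp
  have mf: "(\<lambda>z. f (y - z)) \<in> borel_measurable borel" for y by measurable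
  have bf: "\<bar>f (y - z)\<bar> \<le> Bf" for y z using Bf(2)[of "y - z"] by simp
  have diff: "\<delta> x - \<delta> y \<le> c * norm (x - y)" for x y
  proof -
    have "\<delta> x - \<delta> y = I (\<lambda>z. f (x - z) - f (y - z))"
      unfolding \<delta> I_def using int[OF mf bf, of x] int[OF mf bf, of y] by (simp add: right_diff_distrib)
    also have "\<dots> \<le> c * norm (x - y)"
    proof (rule le)
      show "\<bar>f (x - z) - f (y - z)\<bar> \<le> c * norm (x - y)" for z using f(2)[of "x - z" "y - z"] by simp
      then show "f (x - z) - f (y - z) \<le> c * norm (x - y)" for z using abs_le_D1 by blast
    qed measurable
    finally show ?thesis .
  qed
  have "smooth \<delta>" unfolding \<delta>_def by (rule smooth_smoothing[OF \<mu>'(1,2) _ fi]) simp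
  moreover have "\<bar>\<delta> x - \<delta> y\<bar> \<le> c * norm (x - y)" for x y
    using diff[of x y] diff[of y x] by (simp add: norm_minus_commute)
  moreover have "\<delta> x \<le> M" if "\<forall>y. norm (x - y) < h \<longrightarrow> f y \<le> M" for x M
    unfolding \<delta> by (rule le[OF mf bf]) (use that in simp)
  moreover have "M \<le> \<delta> x" if M: "\<forall>y. norm (x - y) < h \<longrightarrow> M \<le> f y" for x M
  proof -
    have "I (\<lambda>z. - f (x - z)) \<le> - M"
      by (rule le[of _ Bf]) (use M bf mf in auto)
    then show ?thesis unfolding \<delta> by (simp add: I_def)
  qed
  ultimately show ?thesis by blast
qed

context spreading
begin

text \<open>The order of the quantifiers is the point: \<open>K\<close> precedes \<open>u\<close>
  and \<open>s\<close>. What depends on \<open>u\<close>, such as \<open>L\<close> and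
  \<open>h\<close>, enters the construction of \<open>g\<close> but none of the estimates.\<close>

lemma solenoidal_truncation:
  "\<exists>K>0. \<forall>u s. u \<in> sol_test_functions \<Omega> \<longrightarrow> s > 0 \<longrightarrow>
    (\<exists>g. integrable lborel g \<and> weakly_div_free g \<and> (\<forall>x. x \<notin> \<Omega> \<longrightarrow> g x = 0) \<and> (\<forall>x. norm (g x) \<le> K * s) \<and>
       (\<integral>\<^sup>+x. ennreal (norm (u x - g x) ^ 2) \<partial>lborel) \<le> ennreal K * (\<integral>\<^sup>+x. ennreal (large_part u s x) \<partial>lborel))"
proof -
  obtain rO where rO: "rO > 0" "\<And>x. x \<in> \<Omega> \<Longrightarrow> norm x \<le> rO" using bounded_\<Omega> bounded_pos by blast
  define m where "m = measure lborel \<Omega>"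
  \<comment> \<open>A ball of radius above \<open>r1\<close> has at least the volume of \<Omega>:
    for \<open>r \<ge> 1\<close> its volume is at least \<open>r * \<omega>\<close>.\<close>
  define r1 where "r1 = max 1 (m / \<omega>)"
  have r1: "r1 \<ge> 1" "m \<le> r1 * \<omega>" using \<omega>_pos by (auto simp: r1_def max_def field_simps)
  \<comment> \<open>A bad ball meets \<Omega>, as \<open>u\<close> vanishes elsewhere, and its
    radius will be at most \<open>r1\<close>. So \<open>F\<close> lies in the ball of radius
    \<open>r0\<close> about the origin.\<close>
  define r0 where "r0 = rO + 2 * r1"
  have r0: "r0 > 0" using rO r1 by (simp add: r0_def)
  \<comment> \<open>The slope of \<delta> against the distance: \<open>dF \<le> 2 * r0\<close> then
    gives \<open>\<delta> \<le> t0\<close>, and both the Lipschitz bound \<open>1 / (2 * R)\<close>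
    and the bound 1 on the partials hold.\<close>
  define c where "c = min 1 (min (t0 / (2 * r0)) (1 / (2 * R)))"
  have c: "c > 0" "c \<le> 1" "c \<le> t0 / (2 * r0)" "c \<le> 1 / (2 * R)" using t0 r0 R_pos by (auto simp: c_def)
  have cR: "2 * R * c \<le> 1" using c(4) R_pos by (simp add: field_simps)
  \<comment> \<open>Bounds, with room to spare, the ratio of the volume of the ball of radius
    \<open>2 * dF y\<close> to that of the averaging ball, given
    \<open>\<delta> y \<ge> c * dF y / 2\<close>.\<close>
  define q where "q = (16 / (3 * (2 * R) * c)) ^ CARD('n)"
  have q: "q \<ge> 0" using c R_pos by (simp add: q_def)
  define Kg where "Kg = 2 + C1 * (2 + q)"
  have Kg: "Kg \<ge> 2" using q C1_nonneg by (simp add: Kg_def)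
  \<comment> \<open>In the square of \<open>u - g\<close> the large part has coefficient 2, and the
    rest is at most \<open>(1 / 2 + 2 * Kg ^ 2) * s ^ 2\<close> on \<open>F\<close>; the factor
    \<open>4 * 5 ^ CARD('n)\<close> is the cost of the measure of \<open>F\<close>. Adding
    \<open>Kg\<close> also covers the bound on \<open>g\<close>.\<close>
  define K where "K = Kg + 2 + (1 / 2 + 2 * Kg ^ 2) * (4 * 5 ^ CARD('n))"
  have K: "K \<ge> Kg" "K \<ge> 2" "K \<ge> 2 + (1 / 2 + 2 * Kg ^ 2) * (4 * 5 ^ CARD('n))" using Kg by (auto simp: K_def)
  have sO: "\<Omega> \<in> sets lborel" "emeasure lborel \<Omega> < \<infinity>" using open_\<Omega> bounded_\<Omega> emeasure_bounded_finite by auto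
  have iO: "integrable lborel (\<lambda>x. k * indicator \<Omega> x :: real)" for k
    by (intro integrable_mult_right integrable_real_indicator sO)
  have "\<exists>g. integrable lborel g \<and> weakly_div_free g \<and> (\<forall>x. x \<notin> \<Omega> \<longrightarrow> g x = 0) \<and> (\<forall>x. norm (g x) \<le> K * s) \<and>
       (\<integral>\<^sup>+x. ennreal (norm (u x - g x) ^ 2) \<partial>lborel) \<le> ennreal K * (\<integral>\<^sup>+x. ennreal (large_part u s x) \<partial>lborel)"
    if u: "u \<in> sol_test_functions \<Omega>" and s: "s > 0" for u s
  proof -
    have ut: "u \<in> test_functions \<Omega>" using u by (simp add: sol_test_functions_def)
    note u' = test_functionD[OF ut]
    have uc: "continuous_on UNIV u" by (rule smooth_continuous[OF u'(1)])
    have ui: "integrable lborel u" by (rule bdd_supp_integrable[OF uc u'(2)])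
    have [measurable]: "u \<in> borel_measurable borel" using ui by simp
    have udf: "weakly_div_free u" by (rule sol_test_function_weakly_div_free[OF u])
    obtain L where L: "L > 0" "\<And>x y. norm (u x - u y) \<le> L * norm (x - y)" using smooth_lipschitz[OF u'(1,2)] by blast
    obtain M where M: "M > 0" "\<And>x. norm (u x) \<le> M" using bounded_if_bdd_supp[OF uc u'(2)] by blast
    have i2: "integrable lborel (\<lambda>x. norm (u x) ^ 2)"
    proof (rule Bochner_Integration.integrable_bound)
      show "integrable lborel (\<lambda>x. M * norm (u x))" using ui by simp
      show "AE x in lborel. norm ((norm (u x))\<^sup>2) \<le> norm (M * norm (u x))"
        using M by (simp add: power2_eq_square mult_right_mono abs_of_pos)
    qed measurable
    have [measurable]: "large_part u s \<in> borel_measurable borel" unfolding large_part_def by measurable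
    have l0: "large_part u s x \<ge> 0" for x by (simp add: large_part_def)
    have il: "integrable lborel (large_part u s)"
      by (rule Bochner_Integration.integrable_bound[OF i2]) (auto simp: large_part_def)
    define D where "D = (LINT x|lborel. norm (u x) ^ 2)"
    define I where "I = (LINT x|lborel. large_part u s x)"
    have nI: "(\<integral>\<^sup>+x. ennreal (large_part u s x) \<partial>lborel) = ennreal I"
      unfolding I_def by (rule nn_integral_eq_integral[OF il]) (simp add: l0)
    have nD: "(\<integral>\<^sup>+x. ennreal (norm (u x) ^ 2) \<partial>lborel) = ennreal D"
      unfolding D_def by (rule nn_integral_eq_integral[OF i2]) simp
    have I0: "I \<ge> 0" unfolding I_def by (rule integral_nonneg_AE) (simp add: l0)
    show ?thesis
      \<comment> \<open>For small \<open>s\<close> the choice \<open>g = 0\<close> is good enough; for large \<open>s\<close> the radii of bad balls are bounded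
        in terms of \<open>\<Omega>\<close>, which keeps \<open>\<delta>\<close> admissible with a factor \<open>c\<close> depending only on \<open>\<Omega>\<close>.\<close>
    proof (cases "s ^ 2 * m \<le> D")
      case True
      \<comment> \<open>In this case \<open>s ^ 2 / 4 * m\<close> is at most \<open>D / 4\<close>,
        which is absorbed by the left-hand side.\<close>
      have "D \<le> (LINT x|lborel. s ^ 2 / 4 * indicator \<Omega> x + large_part u s x)"
        unfolding D_def
      proof (rule integral_mono[OF i2])
        show "integrable lborel (\<lambda>x. s ^ 2 / 4 * indicator \<Omega> x + large_part u s x)"
          by (intro Bochner_Integration.integrable_add iO il)
        show "norm (u x) ^ 2 \<le> s ^ 2 / 4 * indicator \<Omega> x + large_part u s x" for x
          using large_part_bounds(1)[OF s, of u x] u'(3)[of x] l0[of x] by (cases "x \<in> \<Omega>") auto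
      qed
      also have "\<dots> = s ^ 2 / 4 * m + I" using iO[of "s ^ 2 / 4"] il by (simp add: I_def m_def)
      finally have "D \<le> 2 * I" using True I0 by simp
      also have "\<dots> \<le> K * I" using K I0 by (intro mult_right_mono) auto
      finally have "ennreal D \<le> ennreal K * ennreal I" using K I0 by (simp add: ennreal_mult'[symmetric] ennreal_leI)
      then show ?thesis
        using nD nI K s Kg by (intro exI[of _ "\<lambda>_. 0"]) (auto simp: weakly_div_free_def)
    next
      case False
      \<comment> \<open>A larger ball would have volume at least \<open>m\<close>, while
        \<open>2 * s * norm (u x) \<le> s ^ 2 + norm (u x) ^ 2\<close> shows that
        \<open>s ^ 2\<close> times the volume of a bad ball is below \<open>D\<close>, and
        \<open>D < s ^ 2 * m\<close>.\<close>
      have rb: "r \<le> r1" if b: "bad_ball u s a r" for a r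
      proof (rule ccontr)
        assume "\<not> r \<le> r1"
        then have r: "r > r1" "r > 1" using r1 by auto
        let ?mb = "measure lborel (ball a r)"
        have mb: "?mb = r ^ CARD('n) * \<omega>" using measure_cball[of r a] r content_cball_conv_ball[of a r] by simp
        have "r ^ 1 \<le> r ^ CARD('n)" using r by (intro power_increasing) auto
        then have "r1 * \<omega> \<le> ?mb" unfolding mb using r \<omega>_pos by (intro mult_right_mono) auto
        then have mm: "m \<le> ?mb" using r1 by linarith
        have ib: "integrable lborel (\<lambda>x. (s / 2) * indicator (ball a r) x)"
          by (intro integrable_mult_right integrable_real_indicator emeasure_bounded_finite) auto
        have iu: "integrable lborel (\<lambda>y. indicator (ball a r) y *\<^sub>R norm (u y))"
          using ui by (intro integrable_mult_indicator) auto
        have am: "norm (u x) \<le> s / 2 + (1 / (2 * s)) * norm (u x) ^ 2" for x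
        proof -
          have "2 * s * norm (u x) \<le> s ^ 2 + norm (u x) ^ 2" using sum_squares_bound[of s "norm (u x)"] by simp
          then show ?thesis using s by (simp add: field_simps power2_eq_square)
        qed
        have "s * ?mb < (LINT x|lborel. indicator (ball a r) x * norm (u x))" using b by (simp add: bad_ball_def)
        also have "\<dots> \<le> (LINT x|lborel. (s / 2) * indicator (ball a r) x + (1 / (2 * s)) * norm (u x) ^ 2)"
        proof (rule integral_mono)
          show "indicator (ball a r) x * norm (u x) \<le> (s / 2) * indicator (ball a r) x + (1 / (2 * s)) * norm (u x) ^ 2" for x
            using am[of x] s by (cases "x \<in> ball a r") auto
        qed (use iu ib i2 in auto)
        also have "\<dots> = (s / 2) * ?mb + (1 / (2 * s)) * D" using ib i2 by (simp add: D_def)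
        finally have "s ^ 2 * ?mb < D" using s by (simp add: field_simps power2_eq_square)
        moreover have "s ^ 2 * m \<le> s ^ 2 * ?mb" using mm by (intro mult_left_mono) auto
        ultimately show False using False by linarith
      qed
      define F where "F = maximal_set u s"
      have oF: "open F" by (simp add: F_def open_maximal_set)
      have Fb: "norm y < r0" if "y \<in> F" for y
      proof -
        obtain a r where b: "bad_ball u s a r" and y: "y \<in> ball a r" using \<open>y \<in> F\<close> by (auto simp: F_def maximal_set_def)
        have "\<exists>x\<in>ball a r. u x \<noteq> 0"
        proof (rule ccontr)
          assume "\<not> ?thesis"
          then have "(\<lambda>x. indicator (ball a r) x * norm (u x)) = (\<lambda>x. 0)" by (auto simp: indicator_def fun_eq_iff)
          moreover have "0 \<le> s * measure lborel (ball a r)" using s by simp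
          ultimately show False using b by (simp add: bad_ball_def)
        qed
        then obtain x where x: "x \<in> ball a r" "u x \<noteq> 0" by blast
        then have "norm x \<le> rO" using u'(3) rO by blast
        moreover have "dist x y < 2 * r" using x(1) y dist_triangle2[of x y a] by (simp add: dist_commute)
        moreover have "norm y \<le> norm x + dist x y" using norm_triangle_ineq2[of y x] by (simp add: dist_norm norm_minus_commute)
        ultimately show ?thesis using rb[OF b] by (simp add: r0_def)
      qed
      \<comment> \<open>Shows that the complement of \<open>F\<close> is nonempty, so that
        \<open>infdist\<close> is a genuine distance that is attained, and bounds it by
        \<open>2 * r0\<close>.\<close>
      obtain q0 :: "real^'n" where q0: "norm q0 = r0" using vector_choose_size[of r0] r0 by auto
      have q0F: "q0 \<in> - F" using Fb q0 by auto
      define dF where "dF y = infdist y (- F)" for y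
      have dF0: "dF y \<ge> 0" for y by (simp add: dF_def infdist_nonneg)
      have dFF: "dF y = 0" if "y \<notin> F" for y using that by (simp add: dF_def)
      have dFD: "dF y \<le> 2 * r0" for y
      proof (cases "y \<in> F")
        case True
        have "dF y \<le> dist y q0" unfolding dF_def by (rule infdist_le[OF q0F])
        also have "\<dots> \<le> norm y + norm q0" unfolding dist_norm by (rule norm_triangle_ineq4)
        finally show ?thesis using Fb[OF True] q0 by simp
      qed (use dFF r0 in simp)
      have dFL: "\<bar>dF x - dF y\<bar> \<le> norm (x - y)" for x y
        unfolding dF_def using infdist_triangle_abs[of x "- F" y] by (simp add: dist_norm)
      have near: "\<exists>x'. x' \<notin> F \<and> norm (y - x') = dF y" for y
      proof -
        obtain x' where "x' \<in> - F" "infdist y (- F) = dist y x'"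
          using infdist_attains_inf[of "- F" y] oF q0F by (auto simp: closed_Compl)
        then show ?thesis by (auto simp: dF_def dist_norm)
      qed
      \<comment> \<open>Over a distance of \<open>8 * h\<close> the field \<open>u\<close> changes
        by at most \<open>s\<close>.\<close>
      define h where "h = s / (8 * L)"
      have h: "h > 0" "L * h * 8 = s" using s L by (auto simp: h_def)
      \<comment> \<open>Lowering the distance by \<open>h\<close> before mollifying at scale
        \<open>h / 4\<close> keeps \<delta> below \<open>c * dF\<close>, so that it vanishes off
        \<open>F\<close>. The price is a loss of \<open>2 * h\<close> in the lower bound, affordable
        where \<open>dF y \<ge> 4 * h\<close>.\<close>
      define f where "f x = c * max 0 (dF x - h)" for x
      have f_supp: "bdd_supp f"
      proof -
        have "f z = 0" if "r0 < norm z" for z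
        proof -
          have "z \<notin> F" using Fb that by force
          then show ?thesis using dFF h by (simp add: f_def)
        qed
        then show ?thesis unfolding bdd_supp_def using r0 by blast
      qed
      have f_lip: "\<bar>f x - f y\<bar> \<le> c * norm (x - y)" for x y
      proof -
        have "\<bar>max 0 (dF x - h) - max 0 (dF y - h)\<bar> \<le> norm (x - y)" using dFL[of x y] by (auto simp: max_def)
        then show ?thesis using c(1) by (simp add: f_def right_diff_distrib[symmetric] abs_mult)
      qed
      have "h / 4 > 0" using h by simp
      then obtain \<delta> where \<delta>: "smooth \<delta>" "\<And>x y. \<bar>\<delta> x - \<delta> y\<bar> \<le> c * norm (x - y)"
        and \<delta>up: "\<And>x b. (\<And>y. norm (x - y) < h / 4 \<Longrightarrow> f y \<le> b) \<Longrightarrow> \<delta> x \<le> b"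
        and \<delta>lo: "\<And>x b. (\<And>y. norm (x - y) < h / 4 \<Longrightarrow> b \<le> f y) \<Longrightarrow> b \<le> \<delta> x"
        using mollified_lipschitz[OF f_supp f_lip] by metis
      have \<delta>0: "\<delta> x \<ge> 0" for x by (rule \<delta>lo) (use c in \<open>simp add: f_def\<close>)
      have \<delta>dF: "\<delta> x \<le> c * dF x" for x
      proof (rule \<delta>up)
        fix y assume "norm (x - y) < h / 4"
        then have "max 0 (dF y - h) \<le> dF x" using dFL[of x y] dF0[of x] h by linarith
        then show "f y \<le> c * dF x" using c by (simp add: f_def)
      qed
      have \<delta>lower: "c * (dF x - 2 * h) \<le> \<delta> x" for x
      proof (rule \<delta>lo)
        fix y assume "norm (x - y) < h / 4"
        then have "dF x - 2 * h \<le> max 0 (dF y - h)" using dFL[of x y] h by linarith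
        then show "c * (dF x - 2 * h) \<le> f y" using c by (simp add: f_def)
      qed
      have adm: "admissible \<delta>"
        unfolding admissible_def
      proof (intro conjI allI)
        show "\<delta> x \<le> t0" for x
        proof -
          have "c * dF x \<le> t0 / (2 * r0) * (2 * r0)" using c dFD[of x] dF0[of x] by (intro mult_mono) auto
          then show ?thesis using \<delta>dF[of x] r0 by simp
        qed
        show "\<bar>\<delta> x - \<delta> y\<bar> * (2 * R) \<le> norm (x - y)" for x y
        proof -
          have "\<bar>\<delta> x - \<delta> y\<bar> * (2 * R) \<le> c * norm (x - y) * (2 * R)" using \<delta>(2) R_pos by (intro mult_right_mono) auto
          also have "\<dots> = (2 * R * c) * norm (x - y)" by simp
          also have "\<dots> \<le> 1 * norm (x - y)" by (rule mult_right_mono[OF cR]) simp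
          finally show ?thesis by simp
        qed
        show "\<bar>partial j \<delta> x\<bar> \<le> 1" for j x
          using partial_le_lipschitz[OF smoothD[OF \<delta>(1)] \<delta>(2), of j x] c(2) by linarith
      qed (use \<delta>(1) \<delta>0 in auto)
      define g where "g = spread \<delta> u"
      have gO: "g x = 0" if "x \<notin> \<Omega>" for x unfolding g_def by (rule spread_eq_0[OF adm u'(3) that])
      have gF: "g x = u x" if "x \<notin> F" for x
        using \<delta>dF[of x] \<delta>0[of x] dFF[OF that] by (simp add: g_def spread_def)
      have uF: "norm (u x) \<le> s" if "x \<notin> F" for x
        by (rule norm_le_off_maximal_set[OF uc ui s]) (use that in \<open>simp add: F_def\<close>)
      have u2: "norm (u x) \<le> 2 * s" if "norm (x - y) \<le> 8 * h" "y \<notin> F" for x y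
      proof -
        have "norm (u x - u y) \<le> L * (8 * h)" using L(2)[of x y] mult_left_mono[OF that(1), of L] L(1) by linarith
        then show ?thesis using uF[OF that(2)] norm_triangle_ineq2[of "u x" "u y"] h(2) by (simp add: ac_simps)
      qed
      \<comment> \<open>Within \<open>4 * h\<close> of the complement of \<open>F\<close> the
        Lipschitz bound keeps \<open>u\<close> below \<open>2 * s\<close> at \<open>y\<close> and on
        the averaging ball, whose radius is at most \<open>dF y\<close>. Further inside, \<delta> is
        comparable to \<open>dF\<close> and the maximal function takes over.\<close>
      have gb: "norm (g y) \<le> Kg * s" for y
      proof (cases "dF y < 4 * h")
        case True
        obtain x' where x': "x' \<notin> F" "norm (y - x') = dF y" using near by blast
        show ?thesis
        proof (cases "\<delta> y = 0")
          case True
          have "norm (u y) \<le> 2 * s" using u2[of y x'] x' \<open>dF y < 4 * h\<close> h by simp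
          also have "\<dots> \<le> Kg * s" using Kg s by (intro mult_right_mono) auto
          finally show ?thesis using True by (simp add: g_def spread_def)
        next
          case False
          then have d: "\<delta> y > 0" using \<delta>0[of y] by simp
          let ?S = "cball y (2 * R * \<delta> y)"
          have mS: "measure lborel ?S > 0" using d R_pos \<omega>_pos by (simp add: measure_cball)
          have "2 * R * \<delta> y \<le> dF y"
          proof -
            have "2 * R * \<delta> y \<le> 2 * R * (c * dF y)" using \<delta>dF[of y] R_pos by (intro mult_left_mono) auto
            also have "\<dots> = (2 * R * c) * dF y" by simp
            also have "\<dots> \<le> 1 * dF y" by (rule mult_right_mono[OF cR dF0])
            finally show ?thesis by simp
          qed
          then have "norm (u x) \<le> 2 * s" if "x \<in> ?S" for x
            using u2[of x x'] x' True that norm_triangle_ineq[of "x - y" "y - x'"] by (simp add: dist_norm norm_minus_commute)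
          moreover have "integrable lborel (\<lambda>x. indicator ?S x *\<^sub>R norm (u x))"
            using ui by (intro integrable_mult_indicator) auto
          moreover have "integrable lborel (\<lambda>x. 2 * s * indicator ?S x)"
            by (intro integrable_mult_right integrable_real_indicator emeasure_bounded_finite) auto
          ultimately have "(LINT x|lborel. indicator ?S x * norm (u x)) \<le> (LINT x|lborel. 2 * s * indicator ?S x)"
            by (intro integral_mono) (auto simp: indicator_def)
          then have "(LINT x|lborel. indicator ?S x * norm (u x)) / measure lborel ?S \<le> 2 * s"
            using mS by (simp add: pos_divide_le_eq)
          then have "norm (g y) \<le> C1 * (2 * s)"
            using spread_bound_avg[OF adm ui d] C1_nonneg mult_left_mono unfolding g_def by (meson order_trans)
          also have "\<dots> = (C1 * 2) * s" by simp
          also have "\<dots> \<le> Kg * s" using s q C1_nonneg by (intro mult_right_mono) (auto simp: Kg_def algebra_simps)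
          finally show ?thesis .
        qed
      next
        case False
        have dl: "c * dF y / 2 \<le> \<delta> y"
        proof -
          have "dF y / 2 \<le> dF y - 2 * h" using False by simp
          then have "c * (dF y / 2) \<le> c * (dF y - 2 * h)" using c by (intro mult_left_mono) auto
          then show ?thesis using \<delta>lower[of y] by simp
        qed
        have dFp: "dF y > 0" using False h by linarith
        have "c * dF y / 2 > 0" using c(1) dFp by simp
        then have d: "\<delta> y > 0" using dl by linarith
        let ?S = "cball y (2 * R * \<delta> y)" and ?T = "ball y (2 * dF y)"
        have "2 * R * \<delta> y \<le> 2 * R * (c * dF y)" using \<delta>dF[of y] R_pos by (intro mult_left_mono) auto
        also have "\<dots> = (2 * R * c) * dF y" by simp
        also have "\<dots> \<le> 1 * dF y" by (rule mult_right_mono[OF cR dF0])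
        finally have ST: "?S \<subseteq> ?T" using dFp by auto
        obtain x' where x': "x' \<notin> F" "norm (y - x') = dF y" using near by blast
        \<comment> \<open>The ball contains the nearest point \<open>x'\<close> of the complement of
          \<open>F\<close>, which belongs to no bad ball; so the mean of \<open>norm u\<close> over
          it is at most \<open>s\<close>.\<close>
        have "\<not> bad_ball u s y (2 * dF y)"
        proof
          assume "bad_ball u s y (2 * dF y)"
          then have "x' \<in> F" using x'(2) dFp by (force simp: F_def maximal_set_def dist_norm)
          then show False using x' by simp
        qed
        then have T: "(LINT x|lborel. indicator ?T x * norm (u x)) \<le> s * measure lborel ?T"
          using dFp by (simp add: bad_ball_def)
        have mS: "measure lborel ?S = (2 * R * \<delta> y) ^ CARD('n) * \<omega>" using d R_pos by (simp add: measure_cball)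
        have mT: "measure lborel ?T = (2 * dF y) ^ CARD('n) * \<omega>"
          using measure_cball[of "2 * dF y" y] dFp content_cball_conv_ball[of y "2 * dF y"] by simp
        have mS0: "measure lborel ?S > 0" unfolding mS using d R_pos \<omega>_pos by simp
        have qq: "measure lborel ?T \<le> q * measure lborel ?S"
        proof -
          have "2 * dF y \<le> 16 / (3 * (2 * R) * c) * (2 * R * \<delta> y)"
          proof -
            have "16 / (3 * (2 * R) * c) * (2 * R * (c * dF y / 2)) \<le> 16 / (3 * (2 * R) * c) * (2 * R * \<delta> y)"
              using dl c R_pos by (intro mult_left_mono) auto
            moreover have "16 / (3 * (2 * R) * c) * (2 * R * (c * dF y / 2)) = 8 / 3 * dF y" using c R_pos by (simp add: field_simps)
            ultimately show ?thesis using dFp by linarith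
          qed
          then have "(2 * dF y) ^ CARD('n) \<le> (16 / (3 * (2 * R) * c) * (2 * R * \<delta> y)) ^ CARD('n)"
            using dFp by (intro power_mono) auto
          then have "(2 * dF y) ^ CARD('n) * \<omega> \<le> (16 / (3 * (2 * R) * c) * (2 * R * \<delta> y)) ^ CARD('n) * \<omega>"
            using \<omega>_pos by (intro mult_right_mono) auto
          then show ?thesis unfolding mS mT q_def by (simp only: power_mult_distrib mult.assoc)
        qed
        have "(LINT x|lborel. indicator ?S x * norm (u x)) \<le> (LINT x|lborel. indicator ?T x * norm (u x))"
        proof (rule integral_mono)
          have "integrable lborel (\<lambda>x. indicator S x *\<^sub>R norm (u x))" if "S \<in> sets borel" for S
            using ui that by (intro integrable_mult_indicator) auto
          then show "integrable lborel (\<lambda>x. indicator ?S x * norm (u x))" "integrable lborel (\<lambda>x. indicator ?T x * norm (u x))"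
            by auto
          show "indicator ?S x * norm (u x) \<le> indicator ?T x * norm (u x)" for x
            using ST by (auto simp: indicator_def)
        qed
        also have "\<dots> \<le> s * (q * measure lborel ?S)" using T mult_left_mono[OF qq, of s] s by linarith
        finally have "(LINT x|lborel. indicator ?S x * norm (u x)) / measure lborel ?S \<le> s * q"
          using mS0 by (simp add: pos_divide_le_eq)
        then have "norm (g y) \<le> C1 * (s * q)"
          using spread_bound_avg[OF adm ui d] C1_nonneg mult_left_mono unfolding g_def by (meson order_trans)
        also have "\<dots> = (C1 * q) * s" by simp
        also have "\<dots> \<le> Kg * s" using s q C1_nonneg by (intro mult_right_mono) (auto simp: Kg_def algebra_simps)
        finally show ?thesis .
      qed
      have [measurable]: "g \<in> borel_measurable borel" unfolding g_def by (rule spread_meas[OF adm]) measurable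
      have gi: "integrable lborel g"
      proof (rule Bochner_Integration.integrable_bound[OF iO[of "Kg * s"]])
        have "norm (g x) \<le> norm (Kg * s * indicator \<Omega> x)" for x
          using gb[of x] gO[of x] Kg s by (cases "x \<in> \<Omega>") auto
        then show "AE x in lborel. norm (g x) \<le> norm (Kg * s * indicator \<Omega> x)" by simp
      qed simp
      have gd: "weakly_div_free g" unfolding g_def by (rule spread_weakly_div_free[OF adm ui udf])
      define k where "k = (1 / 2 + 2 * Kg ^ 2) * s ^ 2"
      have k0: "k \<ge> 0" by (simp add: k_def)
      have pt: "norm (u x - g x) ^ 2 \<le> 2 * large_part u s x + k * indicator F x" for x
      proof (cases "x \<in> F")
        case True
        have "norm (u x - g x) ^ 2 \<le> (norm (u x) + norm (g x)) ^ 2" by (intro power_mono norm_triangle_ineq4) auto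
        also have "\<dots> \<le> 2 * norm (u x) ^ 2 + 2 * norm (g x) ^ 2" using sum_squares_bound[of "norm (u x)" "norm (g x)"]
          by (simp add: power2_sum)
        also have "\<dots> \<le> 2 * (s ^ 2 / 4 + large_part u s x) + 2 * (Kg * s) ^ 2"
          using large_part_bounds(1)[OF s, of u x] gb[of x] by (intro add_mono mult_left_mono power_mono) auto
        finally show ?thesis using True by (simp add: k_def power_mult_distrib algebra_simps)
      qed (use gF l0 in simp)
      have combine: "2 * ennreal c + ennreal a * (ennreal b * ennreal c) = ennreal ((2 + a * b) * c)"
        if "a \<ge> 0" "b \<ge> 0" "c \<ge> 0" for a b c :: real
      proof -
        have "2 * ennreal c = ennreal (2 * c)" using that by (simp add: ennreal_mult')
        moreover have "ennreal a * (ennreal b * ennreal c) = ennreal (a * b * c)" using that by (simp add: ennreal_mult mult.assoc)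
        ultimately show ?thesis using that by (simp add: ennreal_plus[symmetric] distrib_right del: ennreal_plus)
      qed
      have "(\<integral>\<^sup>+x. ennreal (norm (u x - g x) ^ 2) \<partial>lborel) \<le> (\<integral>\<^sup>+x. 2 * ennreal (large_part u s x) + ennreal k * indicator F x \<partial>lborel)"
      proof (rule nn_integral_mono)
        fix x
        have "ennreal (norm (u x - g x) ^ 2) \<le> ennreal (2 * large_part u s x + k * indicator F x)" by (rule ennreal_leI[OF pt])
        also have "\<dots> = 2 * ennreal (large_part u s x) + ennreal k * indicator F x"
          using k0 l0 by (simp add: ennreal_plus ennreal_mult' indicator_def)
        finally show "ennreal (norm (u x - g x) ^ 2) \<le> 2 * ennreal (large_part u s x) + ennreal k * indicator F x" .
      qed
      also have "\<dots> = 2 * ennreal I + ennreal k * emeasure lborel F"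
        using oF nI by (simp add: nn_integral_add nn_integral_cmult nn_integral_cmult_indicator)
      also have "ennreal k * emeasure lborel F = ennreal (1 / 2 + 2 * Kg ^ 2) * (ennreal (s ^ 2) * emeasure lborel F)"
        unfolding k_def by (simp add: ennreal_mult' mult.assoc)
      also have "\<dots> \<le> ennreal (1 / 2 + 2 * Kg ^ 2) * (ennreal (4 * 5 ^ CARD('n)) * ennreal I)"
        unfolding F_def nI[symmetric] by (intro mult_left_mono maximal_set_measure[OF uc u'(2) s rb]) auto
      also have "2 * ennreal I + \<dots> = ennreal ((2 + (1 / 2 + 2 * Kg ^ 2) * (4 * 5 ^ CARD('n))) * I)"
        by (rule combine) (use I0 in auto)
      also have "\<dots> \<le> ennreal (K * I)" using K(3) I0 by (intro ennreal_leI mult_right_mono) auto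
      also have "\<dots> = ennreal K * ennreal I" using I0 K by (simp add: ennreal_mult)
      finally have fin: "(\<integral>\<^sup>+x. ennreal (norm (u x - g x) ^ 2) \<partial>lborel) \<le> ennreal K * ennreal I" by (simp add: add_left_mono)
      have gK: "norm (g x) \<le> K * s" for x using gb[of x] K(1) s mult_right_mono[OF K(1), of s] by linarith
      show ?thesis unfolding nI
        by (intro exI[of _ g] conjI allI impI gi gd gK fin) (rule gO)
    qed
  qed
  then show ?thesis using K(2) by (intro exI[of _ K]) auto
qed

end

section \<open>Lebesgue spaces\<close>

lemma AE_lebesgue_on:
  assumes "S \<in> sets lebesgue" shows "(AE x in lebesgue_on S. P x) \<longleftrightarrow> (AE x in lborel. x \<in> S \<longrightarrow> P x)"
  using assms by (simp add: AE_restrict_space_iff AE_completion_iff)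

lemma nn_integral_lebesgue_on_lborel:
  assumes "S \<in> sets lebesgue" "\<And>x. x \<notin> S \<Longrightarrow> h x = 0"
  shows "(\<integral>\<^sup>+x. h x \<partial>lebesgue_on S) = (\<integral>\<^sup>+x. h x \<partial>lborel)"
proof -
  have "(\<lambda>x. h x * indicator S x) = h" using assms(2) by (auto simp: indicator_def fun_eq_iff)
  then show ?thesis using assms(1) by (simp add: nn_integral_restrict_space nn_integral_completion)
qed

lemma integral_lebesgue_on_lborel:
  fixes h :: "'a::euclidean_space \<Rightarrow> 'b::euclidean_space"
  assumes "S \<in> sets lebesgue" "\<And>x. x \<notin> S \<Longrightarrow> h x = 0" and [measurable]: "h \<in> borel_measurable borel"
  shows "(LINT x|lebesgue_on S. h x) = (LINT x|lborel. h x)"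
proof -
  have "(\<lambda>x. indicator S x *\<^sub>R h x) = h" using assms(2) by (auto simp: indicator_def fun_eq_iff)
  then show ?thesis using assms(1) by (simp add: integral_restrict_space integral_completion)
qed

lemma borel_measurable_lebesgue_on:
  "h \<in> borel_measurable borel \<Longrightarrow> h \<in> borel_measurable (lebesgue_on S)"
  by (intro measurable_restrict_space1 measurable_completion) simp

text \<open>Elements of \<open>Lp\<close> are only Lebesgue measurable on \<Omega>, with arbitrary
  values elsewhere; the product-measure arguments for kernels work with Borel functions on the whole
  space. The change on a null set is made one coordinate at a time.\<close>

lemma borel_representative:
  fixes u :: "'a::euclidean_space \<Rightarrow> 'b::euclidean_space"
  assumes S: "S \<in> sets borel" and u: "u \<in> borel_measurable (lebesgue_on S)"
  shows "\<exists>u0. u0 \<in> borel_measurable borel \<and> (\<forall>x. x \<notin> S \<longrightarrow> u0 x = 0) \<and> (AE x in lebesgue_on S. u x = u0 x)"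
proof -
  have SL: "S \<in> sets lebesgue" using S by simp
  have "(\<lambda>x. indicator S x *\<^sub>R u x) \<in> borel_measurable lebesgue"
    using u SL by (simp add: borel_measurable_restrict_space_iff)
  then have "\<exists>g\<in>borel_measurable lborel. AE x in lborel. (indicator S x *\<^sub>R u x) \<bullet> b = g x" for b
    by (intro completion_ex_borel_measurable_real borel_measurable_inner borel_measurable_const)
  then obtain g where g: "\<And>b. g b \<in> borel_measurable lborel" "\<And>b. AE x in lborel. (indicator S x *\<^sub>R u x) \<bullet> b = g b x"
    by metis
  define u0 where "u0 x = indicator S x *\<^sub>R (\<Sum>b\<in>Basis. g b x *\<^sub>R b)" for x
  have [measurable]: "g b \<in> borel_measurable borel" "S \<in> sets borel" for b using g(1) S by auto
  have "u0 \<in> borel_measurable borel" unfolding u0_def by measurable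
  moreover have "AE x in lborel. \<forall>b\<in>Basis. (indicator S x *\<^sub>R u x) \<bullet> b = g b x"
    by (intro AE_finite_allI g(2)) simp
  then have "AE x in lborel. x \<in> S \<longrightarrow> u x = u0 x"
  proof eventually_elim
    case (elim x)
    show ?case
    proof
      assume "x \<in> S"
      then have "(\<Sum>b\<in>Basis. g b x *\<^sub>R b) = (\<Sum>b\<in>Basis. (u x \<bullet> b) *\<^sub>R b)" using elim by (intro sum.cong) auto
      then show "u x = u0 x" using \<open>x \<in> S\<close> by (simp add: u0_def euclidean_representation)
    qed
  qed
  ultimately show ?thesis using SL by (intro exI[of _ u0]) (auto simp: AE_lebesgue_on u0_def)
qed

text \<open>The \<open>r\<close>-th power of the norm as an extended real. It can go through Tonelli
  and Fatou before finiteness is known; roots are taken only at the end.\<close>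

definition moment :: "real \<Rightarrow> (real^'n) set \<Rightarrow> (real^'n \<Rightarrow> 'b::euclidean_space) \<Rightarrow> ennreal" where
  "moment r S f = (\<integral>\<^sup>+x. ennreal (norm (f x) powr r) \<partial>lebesgue_on S)"

lemma moment_cong_AE: "(AE x in lebesgue_on S. f x = g x) \<Longrightarrow> moment r S f = moment r S g"
  unfolding moment_def by (rule nn_integral_cong_AE) auto

lemma powr_two: "x \<ge> 0 \<Longrightarrow> x powr 2 = x ^ 2" for x :: real
  by (cases "x = 0") auto

lemma moment_two: "moment 2 S f = (\<integral>\<^sup>+x. ennreal (norm (f x) ^ 2) \<partial>lebesgue_on S)"
  by (simp add: moment_def powr_two)

lemma moment_lborel:
  assumes "S \<in> sets lebesgue" "\<And>x. x \<notin> S \<Longrightarrow> f x = 0"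
  shows "moment r S f = (\<integral>\<^sup>+x. ennreal (norm (f x) powr r) \<partial>lborel)"
  unfolding moment_def by (rule nn_integral_lebesgue_on_lborel) (use assms in auto)

lemma Lp_iff_moment:
  assumes "r > 0"
  shows "f \<in> Lp (ennreal r) S \<longleftrightarrow> f \<in> borel_measurable (lebesgue_on S) \<and> moment r S f < \<infinity>"
  unfolding Lp_def moment_def using assms by (auto simp: integrable_iff_bounded)

lemma Lp_norm_nonneg: "Lp_norm p S f \<ge> 0"
  by (simp add: Lp_norm_def)

lemma moment_eq_Lp_norm:
  assumes r: "r > 0" and f: "f \<in> Lp (ennreal r) S"
  shows "moment r S f = ennreal (Lp_norm (ennreal r) S f powr r)"
proof -
  have i: "integrable (lebesgue_on S) (\<lambda>x. norm (f x) powr r)" using r f by (simp add: Lp_def)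
  have "moment r S f = ennreal (LINT x|lebesgue_on S. norm (f x) powr r)"
    unfolding moment_def by (rule nn_integral_eq_integral[OF i]) simp
  moreover have "(LINT x|lebesgue_on S. norm (f x) powr r) \<ge> 0" by (rule integral_nonneg_AE) simp
  ultimately show ?thesis using r by (simp add: Lp_norm_def powr_powr)
qed

lemma Lp_norm_leI:
  assumes r: "r > 0" and f: "f \<in> borel_measurable (lebesgue_on S)" and le: "moment r S f \<le> ennreal (c powr r)" and c: "c \<ge> 0"
  shows "f \<in> Lp (ennreal r) S" "Lp_norm (ennreal r) S f \<le> c"
proof -
  show L: "f \<in> Lp (ennreal r) S" 
    using Lp_iff_moment[OF r, of f S] f le_less_trans[OF le ennreal_less_top] by simp
  have "ennreal (Lp_norm (ennreal r) S f powr r) \<le> ennreal (c powr r)" using moment_eq_Lp_norm[OF r L] le by simp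
  then have "Lp_norm (ennreal r) S f powr r \<le> c powr r" by simp
  then have "(Lp_norm (ennreal r) S f powr r) powr (1 / r) \<le> (c powr r) powr (1 / r)"
    by (rule powr_mono2[rotated 2]) (use r in auto)
  then show "Lp_norm (ennreal r) S f \<le> c" using r c Lp_norm_nonneg[of "ennreal r" S f] by (simp add: powr_powr)
qed

lemma Linf_norm_leI:
  assumes f: "f \<in> borel_measurable (lebesgue_on S)" and le: "AE x in lebesgue_on S. norm (f x) \<le> c" and c: "c \<ge> 0"
  shows "f \<in> Lp \<infinity> S" "Lp_norm \<infinity> S f \<le> c"
proof -
  have "esssup (lebesgue_on S) (\<lambda>x. ennreal (norm (f x))) \<le> ennreal c"
  proof (rule esssup_I)
    show "(\<lambda>x. ennreal (norm (f x))) \<in> borel_measurable (lebesgue_on S)" using f by measurable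
    show "AE x in lebesgue_on S. ennreal (norm (f x)) \<le> ennreal c" using le by eventually_elim (rule ennreal_leI)
  qed
  then show "f \<in> Lp \<infinity> S" "Lp_norm \<infinity> S f \<le> c"
    using f c by (auto simp: Lp_def Lp_norm_def enn2real_leI intro: le_less_trans)
qed

lemma Linf_AE_le:
  assumes f: "f \<in> Lp \<infinity> S" shows "AE x in lebesgue_on S. norm (f x) \<le> Lp_norm \<infinity> S f"
proof -
  let ?e = "esssup (lebesgue_on S) (\<lambda>x. ennreal (norm (f x)))"
  have "?e < \<infinity>" using f by (simp add: Lp_def)
  then have e: "?e = ennreal (Lp_norm \<infinity> S f)" by (simp add: Lp_norm_def less_top)
  have "AE x in lebesgue_on S. ennreal (norm (f x)) \<le> ?e" by (rule esssup_AE)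
  then show ?thesis unfolding e by eventually_elim (simp add: Lp_norm_nonneg)
qed

text \<open>Used with exponent \<open>r\<close> for the level sets of \<open>T v\<close> and with
  exponent \<open>r - 2\<close> for the large part of \<open>v\<close>.\<close>

lemma powr_layer_cake:
  fixes a y :: real
  assumes a: "a > 0" and y: "y \<ge> 0"
  shows "(\<integral>\<^sup>+s. ennreal (a * s powr (a - 1)) * indicator {0..y} s \<partial>lborel) = ennreal (y powr a)"
proof -
  have "((\<lambda>s. s powr (a - 1)) has_integral (y powr (a - 1 + 1) / (a - 1 + 1))) {0..y}"
    by (rule has_integral_powr_from_0) (use a y in auto)
  then have "((\<lambda>s. a * s powr (a - 1)) has_integral (a * (y powr a / a))) {0..y}"
    by (intro has_integral_mult_right) simp
  then show ?thesis using a by (subst nn_integral_has_integral_lebesgue') auto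
qed

text \<open>From \<open>t ^ 2 \<le> n * t + n powr (2 - r) * t powr r\<close>, by cases on
  \<open>t \<le> n\<close>: a large \<open>n\<close> makes the second part small uniformly in
  \<open>k\<close>, and then the first tends to 0. This lifts convergence in L1 to the space on
  which \<open>T\<close> is bounded.\<close>

lemma L2_tendsto_0:
  fixes w :: "nat \<Rightarrow> 'a \<Rightarrow> 'b::real_normed_vector"
  assumes m: "\<And>k. (\<lambda>x. norm (w k x)) \<in> borel_measurable M"
    and L1: "(\<lambda>k. \<integral>\<^sup>+x. ennreal (norm (w k x)) \<partial>M) \<longlonglongrightarrow> 0"
    and Lr: "\<And>k. (\<integral>\<^sup>+x. ennreal (norm (w k x) powr r) \<partial>M) \<le> ennreal b" and b: "b \<ge> 0" and r: "r > 2"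
  shows "(\<lambda>k. \<integral>\<^sup>+x. ennreal (norm (w k x) ^ 2) \<partial>M) \<longlonglongrightarrow> 0"
proof (rule tendsto_zero_ennreal)
  fix e :: real assume e: "e > 0"
  have "((\<lambda>N. real N powr (2 - r) * b) \<longlongrightarrow> 0 * b) sequentially"
    by (intro tendsto_intros tendsto_neg_powr filterlim_real_sequentially) (use r in auto)
  then have "\<forall>\<^sub>F N in sequentially. real N powr (2 - r) * b < e / 4"
    using e by (intro order_tendstoD(2)[of _ "0 * b"]) auto
  then have "\<forall>\<^sub>F N in sequentially. real N powr (2 - r) * b < e / 4 \<and> N \<ge> 1"
    using eventually_ge_at_top[of 1] by (rule eventually_conj)
  then obtain N :: nat where N: "real N powr (2 - r) * b < e / 4" "N \<ge> 1"
    using eventually_happens'[OF sequentially_bot] by blast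
  define n where "n = real N"
  have n: "n \<ge> 1" "n powr (2 - r) * b < e / 4" using N by (auto simp: n_def)
  have pt: "t ^ 2 \<le> n * t + n powr (2 - r) * t powr r" if t: "t \<ge> 0" for t
  proof (cases "t \<le> n")
    case True
    then have "t ^ 2 \<le> n * t" using t by (simp add: power2_eq_square mult_right_mono)
    then show ?thesis by (smt (verit) mult_nonneg_nonneg powr_ge_zero)
  next
    case False
    then have tn: "t > 0" "n \<le> t" using n by auto
    have "t ^ 2 = t powr (2 - r) * t powr r" using tn by (simp add: powr_add[symmetric] powr_two)
    also have "\<dots> \<le> n powr (2 - r) * t powr r"
      using tn n r by (intro mult_right_mono powr_mono2') auto
    finally show ?thesis using n t by (smt (verit) mult_nonneg_nonneg)
  qed
  have "\<forall>\<^sub>F k in sequentially. (\<integral>\<^sup>+x. ennreal (norm (w k x)) \<partial>M) < ennreal (e / (4 * n))"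
    using L1 by (rule order_tendstoD(2)) (use e n in simp)
  then show "\<forall>\<^sub>F k in sequentially. (\<integral>\<^sup>+x. ennreal (norm (w k x) ^ 2) \<partial>M) < ennreal e"
  proof eventually_elim
    case (elim k)
    note [measurable] = m[of k]
    have "(\<integral>\<^sup>+x. ennreal (norm (w k x) ^ 2) \<partial>M)
       \<le> (\<integral>\<^sup>+x. ennreal n * ennreal (norm (w k x)) + ennreal (n powr (2 - r)) * ennreal (norm (w k x) powr r) \<partial>M)"
    proof (rule nn_integral_mono)
      fix x
      have "ennreal (norm (w k x) ^ 2) \<le> ennreal (n * norm (w k x) + n powr (2 - r) * norm (w k x) powr r)"
        by (rule ennreal_leI[OF pt]) simp
      then show "ennreal (norm (w k x) ^ 2) \<le> ennreal n * ennreal (norm (w k x)) + ennreal (n powr (2 - r)) * ennreal (norm (w k x) powr r)"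
        using n by (simp add: ennreal_mult ennreal_plus)
    qed
    also have "\<dots> = ennreal n * (\<integral>\<^sup>+x. ennreal (norm (w k x)) \<partial>M) + ennreal (n powr (2 - r)) * (\<integral>\<^sup>+x. ennreal (norm (w k x) powr r) \<partial>M)"
      by (subst nn_integral_add, measurable, subst nn_integral_cmult, measurable, subst nn_integral_cmult, measurable)
    also have "\<dots> \<le> ennreal n * ennreal (e / (4 * n)) + ennreal (n powr (2 - r)) * ennreal b"
      using elim Lr by (intro add_mono mult_left_mono) auto
    also have "\<dots> = ennreal (e / 4 + n powr (2 - r) * b)"
      using n e b by (simp add: ennreal_mult[symmetric] ennreal_plus[symmetric] del: ennreal_plus)
    also have "\<dots> < ennreal e" using n e by (intro ennreal_lessI) auto
    finally show ?case .
  qed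
qed

section \<open>Interpolation\<close>

lemma test_functions_UNIV_iff: "\<phi> \<in> test_functions UNIV \<longleftrightarrow> smooth \<phi> \<and> bdd_supp \<phi>"
proof
  assume "smooth \<phi> \<and> bdd_supp \<phi>"
  moreover then obtain r where "\<And>z. r < norm z \<Longrightarrow> \<phi> z = 0" by (auto simp: bdd_supp_def)
  then have "bounded {x. \<phi> x \<noteq> 0}" by (intro boundedI[of _ r]) (force simp: not_less[symmetric])
  ultimately show "\<phi> \<in> test_functions UNIV" by (simp add: test_functions_def smooth_def compact_closure)
qed (use test_functionD in blast)

lemma pairing_integrable:
  fixes u :: "real^'n \<Rightarrow> complex^'n"
  assumes u: "integrable lborel u" and \<phi>: "smooth \<phi>" "bdd_supp \<phi>"
  shows "integrable lborel (\<lambda>x. \<Sum>i\<in>UNIV. u x $ i * partial i \<phi> x)"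
proof -
  obtain b where b: "b > 0" "\<And>i x. norm (partial i \<phi> x) \<le> b" using smooth_partial_bounded[OF \<phi>] by blast
  have [measurable]: "u \<in> borel_measurable borel" "partial i \<phi> \<in> borel_measurable borel" for i
    using u smooth_borel[OF smooth_partial[OF \<phi>(1)]] by auto
  show ?thesis
  proof (rule Bochner_Integration.integrable_bound)
    show "integrable lborel (\<lambda>x. (real CARD('n) * b) *\<^sub>R u x)" using u by simp
    have "norm (\<Sum>i\<in>UNIV. u x $ i * partial i \<phi> x) \<le> norm ((real CARD('n) * b) *\<^sub>R u x)" for x
      using norm_pairing_le[of "\<lambda>i. partial i \<phi> x" b "u x"] b by simp
    then show "AE x in lborel. norm (\<Sum>i\<in>UNIV. u x $ i * partial i \<phi> x) \<le> norm ((real CARD('n) * b) *\<^sub>R u x)" by simp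
  qed measurable
qed

lemma norm_vector_scalar_mult: "norm (c *s (v :: complex^'n)) = norm c * norm v"
  by (simp add: norm_vec_def norm_mult L2_set_right_distrib)

section \<open>Whole-space representatives and their approximants\<close>

context spreading
begin

lemma \<Omega>_sets: "\<Omega> \<in> sets borel" "\<Omega> \<in> sets lebesgue"
  using open_\<Omega> by auto

lemma finite_measure_\<Omega>: "finite_measure (lebesgue_on \<Omega>)"
proof (rule finite_measureI)
  have "emeasure lborel \<Omega> < \<infinity>" by (rule emeasure_bounded_finite[OF bounded_\<Omega>])
  then show "emeasure (lebesgue_on \<Omega>) (space (lebesgue_on \<Omega>)) \<noteq> \<infinity>"
    using \<Omega>_sets by (simp add: emeasure_restrict_space space_restrict_space)
qed

text \<open>The normal form of an element of \<open>Lp_sol 2 \<Omega>\<close>: measurable for the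
  Borel sets, extended by zero, and divergence free on the whole space. Integrability follows from
  the second moment because \<Omega> is bounded, but is kept for the averages.\<close>

definition sol_ext :: "(real^'n \<Rightarrow> complex^'n) \<Rightarrow> bool" where
  "sol_ext u \<longleftrightarrow> integrable lborel u \<and> weakly_div_free u \<and> (\<forall>x. x \<notin> \<Omega> \<longrightarrow> u x = 0) \<and> moment 2 \<Omega> u < \<infinity>"

lemma Lp_sol_iff:
  assumes u: "u \<in> borel_measurable borel" "\<And>x. x \<notin> \<Omega> \<Longrightarrow> u x = 0"
  shows "u \<in> Lp_sol p \<Omega> \<longleftrightarrow> u \<in> Lp p \<Omega> \<and> weakly_div_free u"
proof -
  have "(LINT x|lebesgue_on \<Omega>. (\<Sum>i\<in>UNIV. u x $ i * partial i \<phi> x)) = (LINT x|lborel. (\<Sum>i\<in>UNIV. u x $ i * partial i \<phi> x))"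
    if "smooth \<phi>" for \<phi>
  proof (rule integral_lebesgue_on_lborel[OF \<Omega>_sets(2)])
    have [measurable]: "u \<in> borel_measurable borel" "partial i \<phi> \<in> borel_measurable borel" for i
      using u smooth_borel[OF smooth_partial[OF that]] by auto
    show "(\<lambda>x. \<Sum>i\<in>UNIV. u x $ i * partial i \<phi> x) \<in> borel_measurable borel" by measurable
  qed (simp add: u(2))
  then show ?thesis by (auto simp: Lp_sol_def weakly_div_free_def test_functions_UNIV_iff)
qed

lemma two_ennreal: "(2 :: ennreal) = ennreal 2" by simp

lemma Lp_two_iff: "f \<in> Lp 2 \<Omega> \<longleftrightarrow> f \<in> borel_measurable (lebesgue_on \<Omega>) \<and> moment 2 \<Omega> f < \<infinity>"
  unfolding two_ennreal by (rule Lp_iff_moment) simp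

lemma sol_ext_borel: "sol_ext u \<Longrightarrow> u \<in> borel_measurable borel" by (auto simp: sol_ext_def)

lemma sol_ext_Lp_sol:
  assumes u: "sol_ext u" shows "u \<in> Lp_sol 2 \<Omega>"
proof -
  have u': "u \<in> borel_measurable borel" "\<And>x. x \<notin> \<Omega> \<Longrightarrow> u x = 0" "weakly_div_free u" "moment 2 \<Omega> u < \<infinity>"
    using u by (auto simp: sol_ext_def)
  have "u \<in> Lp 2 \<Omega>" unfolding Lp_two_iff using u'(4) borel_measurable_lebesgue_on[OF u'(1)] by blast
  then show ?thesis using Lp_sol_iff[OF u'(1,2), of 2] u'(3) by blast
qed

lemma Lp_sol_representative:
  assumes u: "u \<in> Lp_sol 2 \<Omega>"
  shows "\<exists>u0. sol_ext u0 \<and> (AE x in lebesgue_on \<Omega>. u x = u0 x)"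
proof -
  have um: "u \<in> borel_measurable (lebesgue_on \<Omega>)" "moment 2 \<Omega> u < \<infinity>" using u Lp_two_iff by (auto simp: Lp_sol_def)
  obtain u0 where u0: "u0 \<in> borel_measurable borel" "\<And>x. x \<notin> \<Omega> \<Longrightarrow> u0 x = 0" "AE x in lebesgue_on \<Omega>. u x = u0 x"
    using borel_representative[OF \<Omega>_sets(1) um(1)] by blast
  have [measurable]: "u0 \<in> borel_measurable borel" by (rule u0(1))
  have m: "moment 2 \<Omega> u0 < \<infinity>" using um moment_cong_AE[OF u0(3), where r=2] by simp
  then have L2: "(\<integral>\<^sup>+x. ennreal (norm (u0 x) powr 2) \<partial>lborel) < \<infinity>" using moment_lborel[OF \<Omega>_sets(2) u0(2), where r=2] by simp
  have "integrable lborel u0"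
  proof (rule integrableI_bounded)
    have "(\<integral>\<^sup>+x. ennreal (norm (u0 x)) \<partial>lborel) \<le> (\<integral>\<^sup>+x. indicator \<Omega> x + ennreal (norm (u0 x) powr 2) \<partial>lborel)"
    proof (rule nn_integral_mono)
      fix x
      have "2 * norm (u0 x) \<le> 1 + norm (u0 x) ^ 2" using sum_squares_bound[of 1 "norm (u0 x)"] by simp
      then have "norm (u0 x) \<le> 1 + norm (u0 x) ^ 2" using norm_ge_zero[of "u0 x"] by linarith
      then have "ennreal (norm (u0 x)) \<le> ennreal (1 + norm (u0 x) powr 2)" by (intro ennreal_leI) (simp add: powr_two)
      then show "ennreal (norm (u0 x)) \<le> indicator \<Omega> x + ennreal (norm (u0 x) powr 2)"
        using u0(2)[of x] by (cases "x \<in> \<Omega>") (auto simp: ennreal_plus)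
    qed
    also have "\<dots> = emeasure lborel \<Omega> + (\<integral>\<^sup>+x. ennreal (norm (u0 x) powr 2) \<partial>lborel)"
      using \<Omega>_sets by (subst nn_integral_add) auto
    also have "\<dots> < \<infinity>" using L2 emeasure_bounded_finite[OF bounded_\<Omega>] by (simp add: ennreal_add_less_top)
    finally show "(\<integral>\<^sup>+x. ennreal (norm (u0 x)) \<partial>lborel) < \<infinity>" .
  qed simp
  moreover have "weakly_div_free u0"
  proof -
    have "u0 \<in> Lp_sol 2 \<Omega>"
      unfolding Lp_sol_def
    proof (intro CollectI conjI ballI)
      show "u0 \<in> Lp 2 \<Omega>" using m borel_measurable_lebesgue_on[OF u0(1)] by (simp add: Lp_two_iff)
      fix \<phi> :: "real^'n \<Rightarrow> complex" assume \<phi>: "\<phi> \<in> test_functions UNIV"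
      have [measurable]: "partial i \<phi> \<in> borel_measurable (lebesgue_on \<Omega>)" for i
        using borel_measurable_lebesgue_on[OF smooth_borel[OF smooth_partial]] \<phi> by (auto simp: test_functions_UNIV_iff)
      have [measurable]: "u \<in> borel_measurable (lebesgue_on \<Omega>)" "u0 \<in> borel_measurable (lebesgue_on \<Omega>)"
        using um borel_measurable_lebesgue_on[OF u0(1)] by auto
      have "(LINT x|lebesgue_on \<Omega>. (\<Sum>i\<in>UNIV. u0 x $ i * partial i \<phi> x)) = (LINT x|lebesgue_on \<Omega>. (\<Sum>i\<in>UNIV. u x $ i * partial i \<phi> x))"
      proof (rule integral_cong_AE)
        show "AE x in lebesgue_on \<Omega>. (\<Sum>i\<in>UNIV. u0 x $ i * partial i \<phi> x) = (\<Sum>i\<in>UNIV. u x $ i * partial i \<phi> x)"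
          using u0(3) by eventually_elim simp
      qed measurable
      then show "(LINT x|lebesgue_on \<Omega>. (\<Sum>i\<in>UNIV. u0 x $ i * partial i \<phi> x)) = 0" using u \<phi> by (simp add: Lp_sol_def)
    qed
    then show ?thesis using Lp_sol_iff[OF u0(1,2)] by blast
  qed
  ultimately show ?thesis using u0 m by (auto simp: sol_ext_def)
qed

lemma Lp_sol_subset:
  assumes p: "2 < p" and u: "u \<in> Lp_sol p \<Omega>" shows "u \<in> Lp_sol 2 \<Omega>"
proof -
  have uL: "u \<in> Lp p \<Omega>" using u by (simp add: Lp_sol_def)
  then have um [measurable]: "u \<in> borel_measurable (lebesgue_on \<Omega>)" by (simp add: Lp_def)
  have fin: "emeasure (lebesgue_on \<Omega>) (space (lebesgue_on \<Omega>)) < \<infinity>"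
    using finite_measure.emeasure_finite[OF finite_measure_\<Omega>] by (simp add: less_top)
  have "moment 2 \<Omega> u < \<infinity>"
  proof (cases "p = \<infinity>")
    case True
    have "moment 2 \<Omega> u \<le> (\<integral>\<^sup>+x. ennreal (Lp_norm \<infinity> \<Omega> u powr 2) \<partial>lebesgue_on \<Omega>)"
      unfolding moment_def
    proof (rule nn_integral_mono_AE)
      show "AE x in lebesgue_on \<Omega>. ennreal (norm (u x) powr 2) \<le> ennreal (Lp_norm \<infinity> \<Omega> u powr 2)"
        using Linf_AE_le[of u \<Omega>] uL unfolding True
        by (auto elim!: eventually_mono intro!: ennreal_leI power_mono simp: powr_two Lp_norm_nonneg)
    qed
    also have "\<dots> < \<infinity>" using fin by (simp add: ennreal_mult_less_top)
    finally show ?thesis .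
  next
    case False
    define r where "r = enn2real p"
    have pr: "p = ennreal r" using False by (simp add: r_def less_top)
    have r: "r > 2" using p unfolding pr two_ennreal by (simp add: ennreal_less_iff)
    have mr: "moment r \<Omega> u < \<infinity>" using uL Lp_iff_moment[of r u \<Omega>] r unfolding pr by simp
    have "moment 2 \<Omega> u \<le> (\<integral>\<^sup>+x. 1 + ennreal (norm (u x) powr r) \<partial>lebesgue_on \<Omega>)"
      unfolding moment_def
    proof (rule nn_integral_mono)
      fix x
      have "norm (u x) powr 2 \<le> 1 + norm (u x) powr r"
      proof (cases "norm (u x) \<le> 1")
        case True
        then have "norm (u x) powr 2 \<le> 1" by (simp add: powr_two power_le_one)
        then show ?thesis using powr_ge_zero[of "norm (u x)" r] by linarith
      next
        case False
        then have "norm (u x) powr 2 \<le> norm (u x) powr r" using r by (intro powr_mono) auto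
        then show ?thesis by simp
      qed
      then have "ennreal (norm (u x) powr 2) \<le> ennreal (1 + norm (u x) powr r)" by (rule ennreal_leI)
      then show "ennreal (norm (u x) powr 2) \<le> 1 + ennreal (norm (u x) powr r)" by (simp add: ennreal_plus)
    qed
    also have "\<dots> = emeasure (lebesgue_on \<Omega>) (space (lebesgue_on \<Omega>)) + moment r \<Omega> u"
      unfolding moment_def by (subst nn_integral_add) auto
    also have "\<dots> < \<infinity>" using fin mr by (simp add: ennreal_add_less_top)
    finally show ?thesis .
  qed
  then have "u \<in> Lp 2 \<Omega>" using um by (simp add: Lp_two_iff)
  then show ?thesis using u by (simp add: Lp_sol_def)
qed

lemma bdd_supp_zero_outside: "(\<And>x. x \<notin> \<Omega> \<Longrightarrow> u x = 0) \<Longrightarrow> bdd_supp u"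
proof -
  assume u: "\<And>x. x \<notin> \<Omega> \<Longrightarrow> u x = 0"
  obtain r where "r > 0" "\<And>x. x \<in> \<Omega> \<Longrightarrow> norm x \<le> r" using bounded_\<Omega> bounded_pos by blast
  then show ?thesis unfolding bdd_supp_def using u by (metis not_le)
qed

lemma moment_bounded:
  assumes "AE x in lborel. norm (u x) \<le> a" "r > 0"
  shows "moment r \<Omega> u < \<infinity>"
proof -
  have "AE x in lebesgue_on \<Omega>. norm (u x) \<le> a" using assms(1) by (simp add: AE_lebesgue_on[OF \<Omega>_sets(2)] eventually_mono)
  then have "moment r \<Omega> u \<le> (\<integral>\<^sup>+x. ennreal (a powr r) \<partial>lebesgue_on \<Omega>)"
    unfolding moment_def using assms(2)
    by (intro nn_integral_mono_AE) (auto elim!: eventually_mono intro!: ennreal_leI powr_mono2)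
  also have "\<dots> < \<infinity>"
    using finite_measure.emeasure_finite[OF finite_measure_\<Omega>] by (simp add: ennreal_mult_less_top less_top)
  finally show ?thesis .
qed

lemma sol_ext_bounded:
  assumes "integrable lborel u" "weakly_div_free u" "\<And>x. x \<notin> \<Omega> \<Longrightarrow> u x = 0" "\<And>x. norm (u x) \<le> a"
  shows "sol_ext u"
  using assms moment_bounded[of u a 2] by (simp add: sol_ext_def)

lemma sol_test_function_bounded:
  assumes v: "v \<in> sol_test_functions \<Omega>"
  shows "sol_ext v" "\<exists>a. \<forall>x. norm (v x) \<le> a"
proof -
  have "v \<in> test_functions \<Omega>" using v by (simp add: sol_test_functions_def)
  note v' = test_functionD[OF this]
  have vc: "continuous_on UNIV v" by (rule smooth_continuous[OF v'(1)])
  obtain a where a: "\<And>x. norm (v x) \<le> a" using bounded_if_bdd_supp[OF vc v'(2)] by blast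
  then show "\<exists>a. \<forall>x. norm (v x) \<le> a" by blast
  show "sol_ext v"
    by (rule sol_ext_bounded[OF bdd_supp_integrable[OF vc v'(2)] sol_test_function_weakly_div_free[OF v] v'(3) a])
qed

lemma sol_ext_combine:
  assumes u: "sol_ext u" and v: "sol_ext v" shows "sol_ext (\<lambda>x. u x + c *s v x)"
proof -
  have [measurable]: "u \<in> borel_measurable borel" "v \<in> borel_measurable borel" using u v sol_ext_borel by auto
  have u': "integrable lborel u" "weakly_div_free u" "\<And>x. x \<notin> \<Omega> \<Longrightarrow> u x = 0" "moment 2 \<Omega> u < \<infinity>" using u by (auto simp: sol_ext_def)
  have v': "integrable lborel v" "weakly_div_free v" "\<And>x. x \<notin> \<Omega> \<Longrightarrow> v x = 0" "moment 2 \<Omega> v < \<infinity>" using v by (auto simp: sol_ext_def)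
  have [measurable]: "(\<lambda>x. c *s v x) \<in> borel_measurable borel"
    by (rule borel_measurable_vecI) (simp, measurable)
  have cv: "integrable lborel (\<lambda>x. c *s v x)"
  proof (rule Bochner_Integration.integrable_bound)
    show "integrable lborel (\<lambda>x. norm c *\<^sub>R v x)" using v' by simp
  qed (auto simp: norm_vector_scalar_mult)
  have "weakly_div_free (\<lambda>x. u x + c *s v x)"
    unfolding weakly_div_free_def
  proof (intro allI impI)
    fix \<phi> :: "real^'n \<Rightarrow> complex" assume \<phi>: "smooth \<phi>" "bdd_supp \<phi>"
    have "(\<Sum>i\<in>UNIV. (u x + c *s v x) $ i * partial i \<phi> x)
        = (\<Sum>i\<in>UNIV. u x $ i * partial i \<phi> x) + c * (\<Sum>i\<in>UNIV. v x $ i * partial i \<phi> x)" for x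
      by (simp add: distrib_right sum.distrib sum_distrib_left mult.assoc)
    then show "(LINT x|lborel. (\<Sum>i\<in>UNIV. (u x + c *s v x) $ i * partial i \<phi> x)) = 0"
      using pairing_integrable[OF u'(1) \<phi>] pairing_integrable[OF v'(1) \<phi>] u'(2) v'(2) \<phi>
      by (simp add: weakly_div_free_def)
  qed
  moreover have "moment 2 \<Omega> (\<lambda>x. u x + c *s v x) < \<infinity>"
  proof -
    have [measurable]: "u \<in> borel_measurable (lebesgue_on \<Omega>)" "v \<in> borel_measurable (lebesgue_on \<Omega>)"
      using borel_measurable_lebesgue_on sol_ext_borel u v by auto
    have "moment 2 \<Omega> (\<lambda>x. u x + c *s v x) \<le> (\<integral>\<^sup>+x. 2 * ennreal (norm (u x) ^ 2) + ennreal (2 * norm c ^ 2) * ennreal (norm (v x) ^ 2) \<partial>lebesgue_on \<Omega>)"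
      unfolding moment_two
    proof (rule nn_integral_mono)
      fix x
      have "norm (u x + c *s v x) ^ 2 \<le> (norm (u x) + norm c * norm (v x)) ^ 2"
        by (intro power_mono) (use norm_triangle_ineq[of "u x" "c *s v x"] in \<open>auto simp: norm_vector_scalar_mult\<close>)
      also have "\<dots> \<le> 2 * norm (u x) ^ 2 + 2 * norm c ^ 2 * norm (v x) ^ 2"
        using sum_squares_bound[of "norm (u x)" "norm c * norm (v x)"] by (simp add: power2_sum power_mult_distrib)
      finally have "ennreal (norm (u x + c *s v x) ^ 2) \<le> ennreal (2 * norm (u x) ^ 2 + 2 * norm c ^ 2 * norm (v x) ^ 2)" by (rule ennreal_leI)
      then show "ennreal (norm (u x + c *s v x) ^ 2) \<le> 2 * ennreal (norm (u x) ^ 2) + ennreal (2 * norm c ^ 2) * ennreal (norm (v x) ^ 2)"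
        by (simp add: ennreal_plus ennreal_mult)
    qed
    also have "\<dots> = 2 * moment 2 \<Omega> u + ennreal (2 * norm c ^ 2) * moment 2 \<Omega> v"
      unfolding moment_two by (subst nn_integral_add, measurable, subst nn_integral_cmult, measurable, subst nn_integral_cmult, measurable)
    also have "\<dots> < \<infinity>" using u' v' by (simp add: ennreal_add_less_top ennreal_mult_less_top)
    finally show ?thesis .
  qed
  ultimately show ?thesis using u' v' cv by (simp add: sol_ext_def)
qed

definition approx :: "(real^'n \<Rightarrow> complex^'n) \<Rightarrow> nat \<Rightarrow> real^'n \<Rightarrow> complex^'n" where
  "approx u k = spread (\<lambda>_. t0 / real (Suc k)) u"

lemma step_bounds: "0 < t0 / real (Suc k)" "t0 / real (Suc k) \<le> t0"
  using t0 by (auto simp: divide_simps mult_le_cancel_left1)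

lemma approx_test: "sol_ext u \<Longrightarrow> approx u k \<in> sol_test_functions \<Omega>"
  unfolding approx_def by (rule spread_const_sol_test_function[OF step_bounds]) (auto simp: sol_ext_def)

lemma approx_moment:
  assumes u: "sol_ext u" and r: "r \<ge> 1"
  shows "moment r \<Omega> (approx u k) \<le> ennreal (C1 powr r) * moment r \<Omega> u"
proof -
  have "approx u k x = 0" if "x \<notin> \<Omega>" for x
    using sol_test_functions_def test_functionD(3) approx_test[OF u, of k] that by blast
  then show ?thesis
    using spread_const_Lq[OF step_bounds _ r, of u k] u
    by (simp add: moment_lborel[OF \<Omega>_sets(2)] sol_ext_def approx_def)
qed

lemma approx_sup:
  assumes u: "sol_ext u" and a: "AE x in lborel. norm (u x) \<le> a" "a \<ge> 0"
  shows "norm (approx u k y) \<le> C1 * a"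
  unfolding approx_def
  by (rule spread_bound_sup[OF admissible_const]) (use step_bounds[of k] a u in \<open>auto simp: sol_ext_def intro: less_imp_le\<close>)

text \<open>Convergence is known in L1 only; moments of an order above 2, bounded uniformly in
  \<open>k\<close>, lift it to L2. This is the origin of the hypothesis on \<open>r\<close> in the
  lemmas on \<open>T\<close> below.\<close>

lemma approx_L2:
  assumes u: "sol_ext u" and r: "r > 2" "moment r \<Omega> u < \<infinity>"
  shows "(\<lambda>k. \<integral>\<^sup>+x. ennreal (norm (approx u k x - u x) ^ 2) \<partial>lborel) \<longlonglongrightarrow> 0"
proof -
  have u': "integrable lborel u" "\<And>x. x \<notin> \<Omega> \<Longrightarrow> u x = 0" using u by (auto simp: sol_ext_def)
  have ai: "integrable lborel (approx u k)" for k using approx_test[OF u] sol_test_function_bounded by (auto simp: sol_ext_def)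
  have a0: "approx u k x = 0" if "x \<notin> \<Omega>" for k x
    using sol_test_functions_def test_functionD(3) approx_test[OF u, of k] that by blast
  have [measurable]: "u \<in> borel_measurable borel" "approx u k \<in> borel_measurable borel" for k using u' ai by auto
  obtain m where m: "m \<ge> 0" "moment r \<Omega> u = ennreal m" using r(2) by (cases "moment r \<Omega> u") auto
  have mu: "(\<integral>\<^sup>+x. ennreal (norm (u x) powr r) \<partial>lborel) = ennreal m"
    using m moment_lborel[OF \<Omega>_sets(2) u'(2)] by simp
  show ?thesis
  proof (rule L2_tendsto_0[where r=r and b="2 powr r * (C1 powr r * m + m)"])
    show "(\<lambda>k. \<integral>\<^sup>+x. ennreal (norm (approx u k x - u x)) \<partial>lborel) \<longlonglongrightarrow> 0"
    proof -
      have "(\<lambda>k. ennreal (LINT x|lborel. norm (approx u k x - u x))) \<longlonglongrightarrow> ennreal 0"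
        unfolding approx_def by (intro tendsto_ennrealI spread_L1_tendsto u'(1) bdd_supp_zero_outside u'(2))
      moreover have "(\<integral>\<^sup>+x. ennreal (norm (approx u k x - u x)) \<partial>lborel) = ennreal (LINT x|lborel. norm (approx u k x - u x))" for k
        using ai u' by (intro nn_integral_eq_integral) auto
      ultimately show ?thesis by simp
    qed
    show "(\<integral>\<^sup>+x. ennreal (norm (approx u k x - u x) powr r) \<partial>lborel) \<le> ennreal (2 powr r * (C1 powr r * m + m))" for k
    proof -
      have "(\<integral>\<^sup>+x. ennreal (norm (approx u k x - u x) powr r) \<partial>lborel)
         \<le> (\<integral>\<^sup>+x. ennreal (2 powr r) * (ennreal (norm (approx u k x) powr r) + ennreal (norm (u x) powr r)) \<partial>lborel)"
      proof (rule nn_integral_mono)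
        fix x
        let ?a = "norm (approx u k x)" and ?b = "norm (u x)"
        have "norm (approx u k x - u x) powr r \<le> (2 * max ?a ?b) powr r"
          using r norm_triangle_ineq4[of "approx u k x" "u x"] by (intro powr_mono2) auto
        also have "\<dots> = 2 powr r * max ?a ?b powr r" by (simp add: powr_mult)
        also have "\<dots> \<le> 2 powr r * (?a powr r + ?b powr r)" by (intro mult_left_mono) (auto simp: max_def)
        finally have "ennreal (norm (approx u k x - u x) powr r) \<le> ennreal (2 powr r * (?a powr r + ?b powr r))" by (rule ennreal_leI)
        then show "ennreal (norm (approx u k x - u x) powr r) \<le> ennreal (2 powr r) * (ennreal (?a powr r) + ennreal (?b powr r))"
          by (simp add: ennreal_mult ennreal_plus)
      qed
      also have "\<dots> = ennreal (2 powr r) * ((\<integral>\<^sup>+x. ennreal (norm (approx u k x) powr r) \<partial>lborel) + (\<integral>\<^sup>+x. ennreal (norm (u x) powr r) \<partial>lborel))"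
        by (subst nn_integral_cmult, measurable, subst nn_integral_add, measurable)
      also have "\<dots> \<le> ennreal (2 powr r) * (ennreal (C1 powr r) * ennreal m + ennreal m)"
        using approx_moment[OF u, of r k] r m mu moment_lborel[OF \<Omega>_sets(2) a0[where k=k], where r=r]
        by (intro mult_left_mono add_mono) auto
      also have "\<dots> = ennreal (2 powr r * (C1 powr r * m + m))"
        using m by (simp add: ennreal_mult[symmetric] ennreal_plus[symmetric] del: ennreal_plus)
      finally show ?thesis .
    qed
  qed (use r m in auto)
qed

end

section \<open>The operator on approximants and bounded fields\<close>

locale sol_operator = spreading \<Omega> V \<rho> \<eta> R A B t0
  for \<Omega> :: "(real^'n) set" and V :: "real^'n \<Rightarrow> real^'n" and \<rho> :: "real^'n \<Rightarrow> real" and \<eta> R A B t0 :: real +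
  fixes T :: "(real^'n \<Rightarrow> complex^'n) \<Rightarrow> real^'n \<Rightarrow> complex^'n" and M2 Mi :: real
  assumes T: "bounded_operator 2 \<Omega> T" and M2: "\<And>u. u \<in> Lp_sol 2 \<Omega> \<Longrightarrow> Lp_norm 2 \<Omega> (T u) \<le> M2 * Lp_norm 2 \<Omega> u"
    and Mi: "\<And>u. u \<in> sol_test_functions \<Omega> \<Longrightarrow> T u \<in> Lp \<infinity> \<Omega> \<and> Lp_norm \<infinity> \<Omega> (T u) \<le> Mi * Lp_norm \<infinity> \<Omega> u"
    and nonneg: "M2 \<ge> 0" "Mi \<ge> 0"
begin

lemma T_meas: "sol_ext u \<Longrightarrow> T u \<in> borel_measurable (lebesgue_on \<Omega>)"
  using T sol_ext_Lp_sol unfolding bounded_operator_def Lp_two_iff by blast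

lemma T_L2: "u \<in> Lp_sol 2 \<Omega> \<Longrightarrow> moment 2 \<Omega> (T u) \<le> ennreal (M2 ^ 2) * moment 2 \<Omega> u"
proof -
  assume u: "u \<in> Lp_sol 2 \<Omega>"
  then have L: "u \<in> Lp (ennreal 2) \<Omega>" "T u \<in> Lp (ennreal 2) \<Omega>"
    using T by (auto simp: Lp_sol_def bounded_operator_def)
  have "Lp_norm 2 \<Omega> (T u) ^ 2 \<le> (M2 * Lp_norm 2 \<Omega> u) ^ 2"
    by (intro power_mono M2 u Lp_norm_nonneg)
  then have "ennreal (Lp_norm 2 \<Omega> (T u) ^ 2) \<le> ennreal (M2 ^ 2 * Lp_norm 2 \<Omega> u ^ 2)"
    by (intro ennreal_leI) (simp add: power_mult_distrib)
  then show ?thesis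
    using moment_eq_Lp_norm[OF _ L(1)] moment_eq_Lp_norm[OF _ L(2)] by (simp add: powr_two Lp_norm_nonneg ennreal_mult)
qed

lemma T_add:
  "u \<in> Lp_sol 2 \<Omega> \<Longrightarrow> v \<in> Lp_sol 2 \<Omega> \<Longrightarrow> AE x in lebesgue_on \<Omega>. T (\<lambda>y. u y + v y) x = T u x + T v x"
  using T unfolding bounded_operator_def by blast

lemma T_scale: "u \<in> Lp_sol 2 \<Omega> \<Longrightarrow> AE x in lebesgue_on \<Omega>. T (\<lambda>y. c *s u y) x = c *s T u x"
  using T unfolding bounded_operator_def by blast

text \<open>\<open>T\<close> acts on representatives and is linear only up to null sets, so the
  difference is written as \<open>u\<close> plus a multiple of \<open>v\<close> by -1, each step
  holding almost everywhere.\<close>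

lemma T_diff_L2:
  assumes u: "sol_ext u" and v: "sol_ext v"
  shows "(\<integral>\<^sup>+x. ennreal (norm (T u x - T v x) ^ 2) \<partial>lebesgue_on \<Omega>)
    \<le> ennreal (M2 ^ 2) * (\<integral>\<^sup>+x. ennreal (norm (u x - v x) ^ 2) \<partial>lborel)"
proof -
  let ?w = "\<lambda>x. u x + (-1) *s v x"
  have w: "sol_ext ?w" by (rule sol_ext_combine[OF u v])
  have nv: "sol_ext (\<lambda>x. (-1) *s v x)"
  proof -
    have "sol_ext (\<lambda>x. 0 *s v x)" using sol_ext_bounded[of "\<lambda>x. 0" 0] by (simp add: weakly_div_free_def)
    from sol_ext_combine[OF this v, of "-1"] show ?thesis by simp
  qed
  have e: "u x + (-1) *s v x = u x - v x" for x by (simp add: vec_eq_iff)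
  have "AE x in lebesgue_on \<Omega>. T ?w x = T u x + T (\<lambda>y. (-1) *s v y) x"
    by (rule T_add[OF sol_ext_Lp_sol[OF u] sol_ext_Lp_sol[OF nv]])
  moreover have "AE x in lebesgue_on \<Omega>. T (\<lambda>y. (-1) *s v y) x = (-1) *s T v x"
    by (rule T_scale[OF sol_ext_Lp_sol[OF v]])
  ultimately have "AE x in lebesgue_on \<Omega>. T ?w x = T u x - T v x"
    by eventually_elim (simp add: vec_eq_iff)
  then have "moment 2 \<Omega> (\<lambda>x. T u x - T v x) = moment 2 \<Omega> (T ?w)" by (intro moment_cong_AE) (auto elim: eventually_mono)
  also have "\<dots> \<le> ennreal (M2 ^ 2) * moment 2 \<Omega> ?w" by (rule T_L2[OF sol_ext_Lp_sol[OF w]])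
  also have "moment 2 \<Omega> ?w = (\<integral>\<^sup>+x. ennreal (norm (u x - v x) ^ 2) \<partial>lborel)"
    unfolding e using u v by (subst moment_lborel[OF \<Omega>_sets(2)]) (auto simp: sol_ext_def powr_two)
  finally show ?thesis by (simp add: moment_two)
qed

text \<open>The squared differences tend to 0 in L1, so a subsequence converges almost everywhere.
  Pointwise convergence transfers supremum bounds and, through Fatou, moments to the limit.\<close>

lemma T_approx:
  assumes u: "sol_ext u" and r: "r > 2" "moment r \<Omega> u < \<infinity>"
  shows "\<exists>\<sigma>. AE x in lebesgue_on \<Omega>. (\<lambda>k. T (approx u (\<sigma> k)) x) \<longlonglongrightarrow> T u x"
proof -
  let ?W = "\<lambda>k x. norm (T (approx u k) x - T u x) ^ 2"
  let ?N = "\<lambda>k. \<integral>\<^sup>+x. ennreal (?W k x) \<partial>lebesgue_on \<Omega>"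
  have na: "sol_ext (approx u k)" for k using approx_test[OF u] sol_test_function_bounded by blast
  have [measurable]: "T u \<in> borel_measurable (lebesgue_on \<Omega>)" "T (approx u k) \<in> borel_measurable (lebesgue_on \<Omega>)" for k
    using T_meas u na by auto
  have le: "?N k \<le> ennreal (M2 ^ 2) * (\<integral>\<^sup>+x. ennreal (norm (approx u k x - u x) ^ 2) \<partial>lborel)" for k
    by (rule T_diff_L2[OF na u])
  have fin: "?N k < \<infinity>" for k
  proof -
    have e: "approx u k x + (-1) *s u x = approx u k x - u x" for x by (simp add: vec_eq_iff)
    have "moment 2 \<Omega> (\<lambda>x. approx u k x - u x) < \<infinity>" using sol_ext_combine[OF na u, of k "-1"] unfolding e by (simp add: sol_ext_def)
    moreover have "moment 2 \<Omega> (\<lambda>x. approx u k x - u x) = (\<integral>\<^sup>+x. ennreal (norm (approx u k x - u x) ^ 2) \<partial>lborel)"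
      using u na[of k] by (subst moment_lborel[OF \<Omega>_sets(2)]) (auto simp: sol_ext_def powr_two)
    ultimately show ?thesis using le[of k] by (auto simp: ennreal_mult_less_top intro: le_less_trans)
  qed
  have i: "integrable (lebesgue_on \<Omega>) (?W k)" for k
    by (rule integrableI_nonneg) (use fin in auto)
  have "(\<lambda>k. ennreal (M2 ^ 2) * (\<integral>\<^sup>+x. ennreal (norm (approx u k x - u x) ^ 2) \<partial>lborel)) \<longlonglongrightarrow> ennreal (M2 ^ 2) * 0"
    by (intro ennreal_tendsto_cmult approx_L2[OF u r]) simp
  then have "(\<lambda>k. ennreal (M2 ^ 2) * (\<integral>\<^sup>+x. ennreal (norm (approx u k x - u x) ^ 2) \<partial>lborel)) \<longlonglongrightarrow> ennreal 0" by simp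
  then have "?N \<longlonglongrightarrow> ennreal 0"
    by (rule tendsto_sandwich[rotated 3]) (use le in auto)
  then have "(\<lambda>k. enn2real (?N k)) \<longlonglongrightarrow> 0" by (rule tendsto_enn2real) simp
  moreover have "enn2real (?N k) = (LINT x|lebesgue_on \<Omega>. norm (?W k x))" for k
    by (simp add: integral_eq_nn_integral)
  ultimately have "(\<lambda>k. LINT x|lebesgue_on \<Omega>. norm (?W k x)) \<longlonglongrightarrow> 0" by simp
  from tendsto_L1_AE_subseq[OF i this] obtain \<sigma> where "AE x in lebesgue_on \<Omega>. (\<lambda>k. ?W (\<sigma> k) x) \<longlonglongrightarrow> 0" by blast
  then have "AE x in lebesgue_on \<Omega>. (\<lambda>k. T (approx u (\<sigma> k)) x) \<longlonglongrightarrow> T u x"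
  proof eventually_elim
    case (elim x)
    then have "(\<lambda>k. sqrt (?W (\<sigma> k) x)) \<longlonglongrightarrow> sqrt 0" by (rule tendsto_real_sqrt)
    then have "(\<lambda>k. norm (T (approx u (\<sigma> k)) x - T u x)) \<longlonglongrightarrow> 0" by simp
    then show ?case by (simp add: LIM_zero_iff tendsto_norm_zero_iff)
  qed
  then show ?thesis by blast
qed

lemma T_approx_le:
  assumes a: "\<And>x. norm (v x) \<le> a" "a \<ge> 0" and v: "v \<in> sol_test_functions \<Omega>"
  shows "AE x in lebesgue_on \<Omega>. norm (T v x) \<le> Mi * a"
proof -
  have "v \<in> borel_measurable (lebesgue_on \<Omega>)"
    using sol_ext_borel sol_test_function_bounded(1)[OF v] borel_measurable_lebesgue_on by blast
  then have "Lp_norm \<infinity> \<Omega> v \<le> a" by (rule Linf_norm_leI(2)) (use a in auto)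
  then have "Mi * Lp_norm \<infinity> \<Omega> v \<le> Mi * a" using nonneg by (intro mult_left_mono) auto
  then have "Lp_norm \<infinity> \<Omega> (T v) \<le> Mi * a" using Mi[OF v] by linarith
  moreover have "AE x in lebesgue_on \<Omega>. norm (T v x) \<le> Lp_norm \<infinity> \<Omega> (T v)" using Mi[OF v] by (intro Linf_AE_le) simp
  ultimately show ?thesis by (auto elim!: eventually_mono)
qed

text \<open>The approximants are solenoidal test functions bounded by \<open>C1 * a\<close>; the
  hypothesis on test functions bounds their images, and the almost everywhere limit inherits the
  bound.\<close>

lemma T_Linf:
  assumes u: "sol_ext u" and a: "AE x in lborel. norm (u x) \<le> a" "a \<ge> 0"
  shows "AE x in lebesgue_on \<Omega>. norm (T u x) \<le> Mi * (C1 * a)"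
proof -
  \<comment> \<open>A bounded field has moments of every positive order on \<Omega>; 3 stands for
    any exponent above 2.\<close>
  obtain \<sigma> where \<sigma>: "AE x in lebesgue_on \<Omega>. (\<lambda>k. T (approx u (\<sigma> k)) x) \<longlonglongrightarrow> T u x"
    using T_approx[OF u, of 3] moment_bounded[OF a(1), of 3] by auto
  have "AE x in lebesgue_on \<Omega>. norm (T (approx u (\<sigma> k)) x) \<le> Mi * (C1 * a)" for k
    by (rule T_approx_le[OF approx_sup[OF u a]]) (use C1_nonneg a approx_test[OF u] in auto)
  then have "AE x in lebesgue_on \<Omega>. \<forall>k. norm (T (approx u (\<sigma> k)) x) \<le> Mi * (C1 * a)" by (simp add: AE_all_countable)
  with \<sigma> show ?thesis
  proof eventually_elim
    case (elim x)
    show ?case by (rule Lim_norm_ubound[OF _ elim(1)]) (use elim(2) in auto)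
  qed
qed

text \<open>For \<open>Mi = 0\<close> the level in the weak-type estimate would degenerate to 0.
  Here \<open>T\<close> annihilates all solenoidal test functions, hence also their limit.\<close>

lemma T_eq_0:
  assumes "Mi = 0" and u: "sol_ext u" and r: "r > 2" "moment r \<Omega> u < \<infinity>"
  shows "AE x in lebesgue_on \<Omega>. T u x = 0"
proof -
  obtain \<sigma> where \<sigma>: "AE x in lebesgue_on \<Omega>. (\<lambda>k. T (approx u (\<sigma> k)) x) \<longlonglongrightarrow> T u x"
    using T_approx[OF u r] by auto
  have "AE x in lebesgue_on \<Omega>. T (approx u (\<sigma> k)) x = 0" for k
  proof -
    obtain a where a: "\<And>x. norm (approx u (\<sigma> k) x) \<le> a" using sol_test_function_bounded(2)[OF approx_test[OF u]] by blast
    have "a \<ge> 0" using a[of 0] norm_ge_zero order_trans by blast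
    from T_approx_le[OF a this approx_test[OF u]] show ?thesis using assms(1) by simp
  qed
  then have "AE x in lebesgue_on \<Omega>. \<forall>k. T (approx u (\<sigma> k)) x = 0" by (simp add: AE_all_countable)
  with \<sigma> show ?thesis
  proof eventually_elim
    case (elim x)
    then show ?case using LIMSEQ_unique[OF elim(1), of 0] by simp
  qed
qed

end

context spreading
begin

text \<open>The truncation property as a predicate on \<open>K\<close>, so that one constant can be
  fixed before any operator is given.\<close>

definition truncation_const :: "real \<Rightarrow> bool" where
  "truncation_const K \<longleftrightarrow> K > 0 \<and> (\<forall>u s. u \<in> sol_test_functions \<Omega> \<longrightarrow> s > 0 \<longrightarrow>
    (\<exists>g. integrable lborel g \<and> weakly_div_free g \<and> (\<forall>x. x \<notin> \<Omega> \<longrightarrow> g x = 0) \<and> (\<forall>x. norm (g x) \<le> K * s) \<and>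
       (\<integral>\<^sup>+x. ennreal (norm (u x - g x) ^ 2) \<partial>lborel) \<le> ennreal K * (\<integral>\<^sup>+x. ennreal (large_part u s x) \<partial>lborel)))"

text \<open>With \<open>a = Mi * ((C1 + 1) * K)\<close>, the quotient of
  \<open>(2 * a) powr r\<close> by \<open>a ^ 2\<close> gives the first two factors and the power of
  \<open>Mi\<close>; \<open>K\<close> is the L2 constant of the truncation,
  \<open>r / (r - 2)\<close> the ratio of the two layer-cake weights, and the last factor comes from
  integrating up to \<open>2 * norm (v x)\<close>.\<close>

definition strong_const :: "real \<Rightarrow> real \<Rightarrow> real" where
  "strong_const K r = 2 powr r * ((C1 + 1) * K) powr (r - 2) * K * (r / (r - 2)) * 2 powr (r - 2)"

end

lemma powr_minus_two: "x powr (r - 2) * x ^ 2 = x powr r" if "x > 0" for x r :: real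
proof -
  have "x ^ 2 = x powr 2" using that powr_two[of x] by simp
  then have "x powr (r - 2) * x ^ 2 = x powr (r - 2 + 2)" by (simp only: powr_add)
  then show ?thesis by simp
qed

section \<open>Weak-type and strong-type estimates\<close>

context sol_operator
begin

text \<open>Where \<open>norm (T v x)\<close> is at least \<open>2 * a * s\<close>, the bound
  \<open>a * s\<close> for \<open>T g\<close> leaves at least \<open>a * s\<close> for the
  difference, and Chebyshev applies to its square. Taking \<open>C1 + 1\<close> in \<open>a\<close>
  keeps \<open>a\<close> positive even if \<open>C1 = 0\<close>.\<close>

lemma T_weak_type:
  assumes K: "truncation_const K" and v: "v \<in> sol_test_functions \<Omega>" and s: "s > 0" and a: "a = Mi * ((C1 + 1) * K)" "Mi > 0"
  shows "emeasure (lebesgue_on \<Omega>) {x \<in> space (lebesgue_on \<Omega>). 2 * a * s \<le> norm (T v x)}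
    \<le> ennreal (M2 ^ 2 * K / (a * s) ^ 2) * (\<integral>\<^sup>+x. ennreal (large_part v s x) \<partial>lborel)"
proof -
  have K0: "K > 0" using K by (simp add: truncation_const_def)
  have as: "a * s > 0" using a K0 s C1_nonneg by simp
  obtain g where g: "integrable lborel g" "weakly_div_free g" "\<And>x. x \<notin> \<Omega> \<Longrightarrow> g x = 0" "\<And>x. norm (g x) \<le> K * s"
    and L2: "(\<integral>\<^sup>+x. ennreal (norm (v x - g x) ^ 2) \<partial>lborel) \<le> ennreal K * (\<integral>\<^sup>+x. ennreal (large_part v s x) \<partial>lborel)"
    using K v s unfolding truncation_const_def by blast
  have ng: "sol_ext g" by (rule sol_ext_bounded[OF g])
  have nv: "sol_ext v" by (rule sol_test_function_bounded(1)[OF v])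
  have [measurable]: "T v \<in> borel_measurable (lebesgue_on \<Omega>)" "T g \<in> borel_measurable (lebesgue_on \<Omega>)"
    using T_meas nv ng by auto
  have Tg: "AE x in lebesgue_on \<Omega>. norm (T g x) \<le> a * s"
  proof -
    have "Mi * (C1 * (K * s)) \<le> a * s"
      unfolding a using a(2) K0 s C1_nonneg by (simp add: algebra_simps)
    moreover have "AE x in lebesgue_on \<Omega>. norm (T g x) \<le> Mi * (C1 * (K * s))"
      by (rule T_Linf[OF ng]) (use g K0 s in auto)
    ultimately show ?thesis by (auto elim!: eventually_mono)
  qed
  define S where "S = {x \<in> space (lebesgue_on \<Omega>). 2 * a * s \<le> norm (T v x)}"
  have S: "S \<in> sets (lebesgue_on \<Omega>)" unfolding S_def by measurable
  have "emeasure (lebesgue_on \<Omega>) S = (\<integral>\<^sup>+x. indicator S x \<partial>lebesgue_on \<Omega>)" using S by simp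
  also have "\<dots> \<le> (\<integral>\<^sup>+x. ennreal (1 / (a * s) ^ 2) * ennreal (norm (T v x - T g x) ^ 2) \<partial>lebesgue_on \<Omega>)"
  proof (rule nn_integral_mono_AE)
    show "AE x in lebesgue_on \<Omega>. indicator S x \<le> ennreal (1 / (a * s) ^ 2) * ennreal (norm (T v x - T g x) ^ 2)"
      using Tg
    proof eventually_elim
      case (elim x)
      show ?case
      proof (cases "x \<in> S")
        case True
        then have "a * s \<le> norm (T v x - T g x)"
          using elim norm_triangle_ineq2[of "T v x" "T g x"] by (simp add: S_def)
        then have "(a * s) ^ 2 \<le> norm (T v x - T g x) ^ 2" using as by (intro power_mono) auto
        moreover have "(a * s) ^ 2 > 0" by (rule zero_less_power[OF as])
        ultimately have "1 \<le> 1 / (a * s) ^ 2 * norm (T v x - T g x) ^ 2"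
          unfolding times_divide_eq_left mult_1 by (simp only: le_divide_eq_1_pos)
        then have "ennreal 1 \<le> ennreal (1 / (a * s) ^ 2 * norm (T v x - T g x) ^ 2)" by (rule ennreal_leI)
        also have "\<dots> = ennreal (1 / (a * s) ^ 2) * ennreal (norm (T v x - T g x) ^ 2)" by (rule ennreal_mult) auto
        finally show ?thesis using True by simp
      qed simp
    qed
  qed
  also have "\<dots> = ennreal (1 / (a * s) ^ 2) * (\<integral>\<^sup>+x. ennreal (norm (T v x - T g x) ^ 2) \<partial>lebesgue_on \<Omega>)"
    by (rule nn_integral_cmult) measurable
  also have "\<dots> \<le> ennreal (1 / (a * s) ^ 2) * (ennreal (M2 ^ 2) * (ennreal K * (\<integral>\<^sup>+x. ennreal (large_part v s x) \<partial>lborel)))"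
    by (intro mult_left_mono order_trans[OF T_diff_L2[OF nv ng]] L2) auto
  also have "\<dots> = ennreal (1 / (a * s) ^ 2 * (M2 ^ 2 * K)) * (\<integral>\<^sup>+x. ennreal (large_part v s x) \<partial>lborel)"
    using K0 as by (simp only: ennreal_mult zero_le_power2 zero_le_divide_1_iff mult_nonneg_nonneg less_imp_le mult.assoc)
  finally show ?thesis by (simp add: S_def)
qed

text \<open>The layer-cake formula for the scaled \<open>T v\<close>, the weak-type bound at each
  level, Tonelli, and the layer cake again for \<open>v\<close>. The remaining weight, of order
  \<open>s powr (r - 3)\<close>, is integrable at 0 because \<open>r > 2\<close>.\<close>

lemma T_strong_type_test:
  assumes K: "truncation_const K" and v: "v \<in> sol_test_functions \<Omega>" and r: "r > 2" and Mi0: "Mi > 0"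
  shows "moment r \<Omega> (T v) \<le> ennreal (strong_const K r * M2 ^ 2 * Mi powr (r - 2)) * moment r \<Omega> v"
proof -
  have K0: "K > 0" using K by (simp add: truncation_const_def)
  define D where "D = (C1 + 1) * K"
  define a where "a = Mi * D"
  have D: "D > 0" using C1_nonneg K0 by (simp add: D_def)
  have a0: "a > 0" using D Mi0 by (simp add: a_def)
  let ?M = "lebesgue_on \<Omega>"
  have nv: "sol_ext v" by (rule sol_test_function_bounded(1)[OF v])
  have [measurable]: "T v \<in> borel_measurable ?M" "v \<in> borel_measurable borel" using T_meas[OF nv] sol_ext_borel[OF nv] by auto
  have v0: "\<And>x. x \<notin> \<Omega> \<Longrightarrow> v x = 0" using nv by (simp add: sol_ext_def)
  \<comment> \<open>Scaled so that \<open>s \<le> h x\<close> is the level set of the weak-type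
    estimate.\<close>
  define h where "h x = norm (T v x) / (2 * a)" for x
  have [measurable]: "h \<in> borel_measurable ?M" unfolding h_def by measurable
  have h0: "h x \<ge> 0" for x using a0 by (simp add: h_def)
  \<comment> \<open>The layer-cake weight \<open>r * s powr (r - 1)\<close> divided by
    \<open>(a * s) ^ 2\<close> is a multiple of \<open>s powr (r - 3)\<close>. Normalising
    \<open>w\<close> as the layer-cake weight of exponent \<open>r - 2\<close> leaves the quotient
    \<open>r / (r - 2)\<close>.\<close>
  define c where "c = M2 ^ 2 * K / a ^ 2 * (r / (r - 2))"
  have c0: "c \<ge> 0" using K0 r by (simp add: c_def)
  define w where "w s = (r - 2) * s powr (r - 2 - 1)" for s :: real
  have w0: "w s \<ge> 0" for s using r by (simp add: w_def)
  have [measurable]: "w \<in> borel_measurable borel" unfolding w_def by measurable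
  interpret M: finite_measure ?M by (rule finite_measure_\<Omega>)
  interpret P: pair_sigma_finite ?M "lborel :: real measure" ..
  let ?L = "\<lambda>s x. ennreal (norm (v x) ^ 2) * (ennreal (w s) * indicator {0..2 * norm (v x)} s)"
  have slice: "(\<integral>\<^sup>+x. ennreal (r * s powr (r - 1)) * indicator {0..h x} s \<partial>?M) \<le> ennreal c * (\<integral>\<^sup>+x. ?L s x \<partial>lborel)" for s
  proof (cases "s > 0")
    case False
    then have "ennreal (r * s powr (r - 1)) * indicator {0..h x} s = 0" for x by (cases "s = 0") auto
    then have "(\<integral>\<^sup>+x. ennreal (r * s powr (r - 1)) * indicator {0..h x} s \<partial>?M) = (\<integral>\<^sup>+x. 0 \<partial>?M)"
      by (intro nn_integral_cong)
    then show ?thesis by (simp only: nn_integral_const) simp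
  next
    case True
    let ?S = "{x \<in> space ?M. 2 * a * s \<le> norm (T v x)}"
    have S: "?S \<in> sets ?M" by measurable
    have "(\<integral>\<^sup>+x. ennreal (r * s powr (r - 1)) * indicator {0..h x} s \<partial>?M) = (\<integral>\<^sup>+x. ennreal (r * s powr (r - 1)) * indicator ?S x \<partial>?M)"
      by (rule nn_integral_cong) (use True a0 in \<open>auto simp: indicator_def h_def field_simps\<close>)
    also have "\<dots> = ennreal (r * s powr (r - 1)) * emeasure ?M ?S" using S by (rule nn_integral_cmult_indicator)
    also have "\<dots> \<le> ennreal (r * s powr (r - 1)) * (ennreal (M2 ^ 2 * K / (a * s) ^ 2) * (\<integral>\<^sup>+x. ennreal (large_part v s x) \<partial>lborel))"
      by (intro mult_left_mono T_weak_type[OF K v True] Mi0) (auto simp: a_def D_def)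
    also have "\<dots> = ennreal (r * s powr (r - 1) * (M2 ^ 2 * K / (a * s) ^ 2)) * (\<integral>\<^sup>+x. ennreal (large_part v s x) \<partial>lborel)"
      by (subst ennreal_mult) (use r K0 in \<open>auto simp: mult.assoc\<close>)
    also have "r * s powr (r - 1) * (M2 ^ 2 * K / (a * s) ^ 2) = c * w s"
    proof -
      have "s powr (r - 1) = s powr (r - 2 - 1) * s ^ 2"
        using powr_minus_two[OF True, of "r - 1"] by simp
      then show ?thesis using r True by (simp add: c_def w_def power_mult_distrib)
    qed
    also have "ennreal (c * w s) * (\<integral>\<^sup>+x. ennreal (large_part v s x) \<partial>lborel)
        = ennreal c * (ennreal (w s) * (\<integral>\<^sup>+x. ennreal (large_part v s x) \<partial>lborel))"
      using c0 w0 by (simp add: ennreal_mult mult.assoc)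
    also have "ennreal (w s) * (\<integral>\<^sup>+x. ennreal (large_part v s x) \<partial>lborel) = (\<integral>\<^sup>+x. ennreal (w s) * ennreal (large_part v s x) \<partial>lborel)"
    proof (rule nn_integral_cmult[symmetric])
      show "(\<lambda>x. ennreal (large_part v s x)) \<in> borel_measurable lborel" unfolding large_part_def by measurable
    qed
    \<comment> \<open>\<open>large_part v s x\<close> is nonzero only for
      \<open>s < 2 * norm (v x)\<close>; for fixed \<open>x\<close> this becomes a bounded range of
      integration in \<open>s\<close>.\<close>
    also have "\<dots> \<le> (\<integral>\<^sup>+x. ?L s x \<partial>lborel)"
      by (rule nn_integral_mono) (use True in \<open>auto simp: large_part_def indicator_def mult.commute\<close>)
    finally show ?thesis by (simp add: mult_left_mono)
  qed
  have "(\<integral>\<^sup>+x. ennreal (h x powr r) \<partial>?M) = (\<integral>\<^sup>+x. \<integral>\<^sup>+s. ennreal (r * s powr (r - 1)) * indicator {0..h x} s \<partial>lborel \<partial>?M)"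
    using r h0 by (intro nn_integral_cong powr_layer_cake[symmetric]) auto
  also have "\<dots> = (\<integral>\<^sup>+s. \<integral>\<^sup>+x. ennreal (r * s powr (r - 1)) * indicator {0..h x} s \<partial>?M \<partial>lborel)"
  proof (rule P.Fubini'[symmetric])
    have "(\<lambda>(x, s). ennreal (r * s powr (r - 1)) * indicator {0..h x} s)
       = (\<lambda>p. ennreal (r * snd p powr (r - 1)) * (if 0 \<le> snd p \<and> snd p \<le> h (fst p) then 1 else 0))"
      by (auto simp: indicator_def fun_eq_iff)
    then show "(\<lambda>(x, s). ennreal (r * s powr (r - 1)) * indicator {0..h x} s) \<in> borel_measurable (?M \<Otimes>\<^sub>M lborel)"
      by (simp only:) measurable
  qed
  also have "\<dots> \<le> (\<integral>\<^sup>+s. ennreal c * (\<integral>\<^sup>+x. ?L s x \<partial>lborel) \<partial>lborel)"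
    by (rule nn_integral_mono) (rule slice)
  also have "\<dots> = ennreal c * (\<integral>\<^sup>+s. \<integral>\<^sup>+x. ?L s x \<partial>lborel \<partial>lborel)"
  proof (rule nn_integral_cmult)
    have [measurable]: "(\<lambda>p. ?L (fst p) (snd p)) \<in> borel_measurable (lborel \<Otimes>\<^sub>M lborel)"
    proof -
      have "(\<lambda>p. ?L (fst p) (snd p)) = (\<lambda>p. ennreal (norm (v (snd p)) ^ 2) * (ennreal (w (fst p)) * (if 0 \<le> fst p \<and> fst p \<le> 2 * norm (v (snd p)) then 1 else 0)))"
        by (auto simp: indicator_def fun_eq_iff)
      then show ?thesis by (simp only:) measurable
    qed
    show "(\<lambda>s. \<integral>\<^sup>+x. ?L s x \<partial>lborel) \<in> borel_measurable lborel" by measurable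
  qed
  also have "(\<integral>\<^sup>+s. \<integral>\<^sup>+x. ?L s x \<partial>lborel \<partial>lborel) = (\<integral>\<^sup>+x. \<integral>\<^sup>+s. ?L s x \<partial>lborel \<partial>lborel)"
  proof (rule lborel_pair.Fubini'[symmetric])
    have "(\<lambda>(s, x). ?L s x) = (\<lambda>p. ennreal (norm (v (snd p)) ^ 2) * (ennreal (w (fst p)) * (if 0 \<le> fst p \<and> fst p \<le> 2 * norm (v (snd p)) then 1 else 0)))"
      by (auto simp: indicator_def fun_eq_iff)
    then show "(\<lambda>(s, x). ?L s x) \<in> borel_measurable (lborel \<Otimes>\<^sub>M lborel)"
      by (simp only:) measurable
  qed
  also have "\<dots> = (\<integral>\<^sup>+x. ennreal (2 powr (r - 2)) * ennreal (norm (v x) powr r) \<partial>lborel)"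
  proof (rule nn_integral_cong)
    fix x :: "real^'n"
    have "(\<integral>\<^sup>+s. ?L s x \<partial>lborel) = ennreal (norm (v x) ^ 2) * (\<integral>\<^sup>+s. ennreal (w s) * indicator {0..2 * norm (v x)} s \<partial>lborel)"
      by (rule nn_integral_cmult) measurable
    also have "(\<integral>\<^sup>+s. ennreal (w s) * indicator {0..2 * norm (v x)} s \<partial>lborel) = ennreal ((2 * norm (v x)) powr (r - 2))"
      unfolding w_def by (rule powr_layer_cake) (use r in auto)
    also have "ennreal (norm (v x) ^ 2) * ennreal ((2 * norm (v x)) powr (r - 2)) = ennreal (norm (v x) ^ 2 * (2 * norm (v x)) powr (r - 2))"
      by (rule ennreal_mult[symmetric]) auto
    also have "norm (v x) ^ 2 * (2 * norm (v x)) powr (r - 2) = 2 powr (r - 2) * norm (v x) powr r"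
    proof (cases "norm (v x) = 0")
      case False
      then have "norm (v x) powr r = norm (v x) ^ 2 * norm (v x) powr (r - 2)"
        using powr_minus_two[of "norm (v x)" r] by (simp add: mult.commute)
      then show ?thesis by (simp add: powr_mult)
    qed simp
    finally show "(\<integral>\<^sup>+s. ?L s x \<partial>lborel) = ennreal (2 powr (r - 2)) * ennreal (norm (v x) powr r)"
      by (simp add: ennreal_mult)
  qed
  also have "\<dots> = ennreal (2 powr (r - 2)) * moment r \<Omega> v"
  proof -
    have "moment r \<Omega> v = (\<integral>\<^sup>+x. ennreal (norm (v x) powr r) \<partial>lborel)"
      by (rule moment_lborel[OF \<Omega>_sets(2)]) (rule v0)
    then show ?thesis by (simp only:) (rule nn_integral_cmult, measurable)
  qed
  finally have hle: "(\<integral>\<^sup>+x. ennreal (h x powr r) \<partial>?M) \<le> ennreal c * (ennreal (2 powr (r - 2)) * moment r \<Omega> v)" .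
  have "moment r \<Omega> (T v) = (\<integral>\<^sup>+x. ennreal ((2 * a) powr r) * ennreal (h x powr r) \<partial>?M)"
    unfolding moment_def
  proof (rule nn_integral_cong)
    fix x
    have "norm (T v x) = 2 * a * h x" using a0 by (simp add: h_def)
    then have "norm (T v x) powr r = (2 * a) powr r * h x powr r" using a0 h0 by (simp add: powr_mult)
    then show "ennreal (norm (T v x) powr r) = ennreal ((2 * a) powr r) * ennreal (h x powr r)" by (simp add: ennreal_mult)
  qed
  also have "\<dots> = ennreal ((2 * a) powr r) * (\<integral>\<^sup>+x. ennreal (h x powr r) \<partial>?M)" by (rule nn_integral_cmult) measurable
  also have "\<dots> \<le> ennreal ((2 * a) powr r) * (ennreal c * (ennreal (2 powr (r - 2)) * moment r \<Omega> v))"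
    by (rule mult_left_mono[OF hle]) simp
  also have "\<dots> = ennreal ((2 * a) powr r * c * 2 powr (r - 2)) * moment r \<Omega> v"
    using c0 by (simp add: ennreal_mult mult.assoc)
  also have "(2 * a) powr r * c * 2 powr (r - 2) = strong_const K r * M2 ^ 2 * Mi powr (r - 2)"
  proof -
    have "a powr r = a powr (r - 2) * a ^ 2" by (rule powr_minus_two[OF a0, symmetric])
    then have "(2 * a) powr r = 2 powr r * (a powr (r - 2) * a ^ 2)" using a0 by (simp add: powr_mult)
    also have "a powr (r - 2) = Mi powr (r - 2) * D powr (r - 2)" using Mi0 D by (simp add: a_def powr_mult)
    finally show ?thesis using a0 by (simp add: c_def strong_const_def D_def[symmetric])
  qed
  finally show ?thesis .
qed

text \<open>Fatou along a subsequence converging almost everywhere. The approximants cost the factor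
  \<open>C1 powr r\<close>.\<close>

lemma T_strong_type:
  assumes K: "truncation_const K" and u: "sol_ext u" and r: "r > 2" "moment r \<Omega> u < \<infinity>"
  shows "moment r \<Omega> (T u) \<le> ennreal (strong_const K r * M2 ^ 2 * Mi powr (r - 2) * C1 powr r) * moment r \<Omega> u"
proof (cases "Mi = 0")
  case True
  have "moment r \<Omega> (T u) = moment r \<Omega> (\<lambda>_. 0 :: complex^'n)" by (rule moment_cong_AE[OF T_eq_0[OF True u r]])
  then show ?thesis by (simp add: moment_def)
next
  case False
  then have Mi0: "Mi > 0" using nonneg by simp
  have K0: "K > 0" using K by (simp add: truncation_const_def)
  obtain \<sigma> where \<sigma>: "AE x in lebesgue_on \<Omega>. (\<lambda>k. T (approx u (\<sigma> k)) x) \<longlonglongrightarrow> T u x"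
    using T_approx[OF u r] by blast
  have at: "approx u k \<in> sol_test_functions \<Omega>" for k by (rule approx_test[OF u])
  have [measurable]: "T (approx u k) \<in> borel_measurable (lebesgue_on \<Omega>)" for k
    by (rule T_meas[OF sol_test_function_bounded(1)[OF at]])
  let ?c = "ennreal (strong_const K r * M2 ^ 2 * Mi powr (r - 2) * C1 powr r) * moment r \<Omega> u"
  have le: "moment r \<Omega> (T (approx u k)) \<le> ?c" for k
  proof -
    have "moment r \<Omega> (T (approx u k)) \<le> ennreal (strong_const K r * M2 ^ 2 * Mi powr (r - 2)) * moment r \<Omega> (approx u k)"
      by (rule T_strong_type_test[OF K at r(1) Mi0])
    also have "\<dots> \<le> ennreal (strong_const K r * M2 ^ 2 * Mi powr (r - 2)) * (ennreal (C1 powr r) * moment r \<Omega> u)"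
      by (intro mult_left_mono approx_moment u) (use r in auto)
    also have "\<dots> = ?c"
    proof -
      have "strong_const K r \<ge> 0" using K0 r by (simp add: strong_const_def)
      then show ?thesis by (subst ennreal_mult) (auto simp: mult.assoc)
    qed
    finally show ?thesis .
  qed
  have "moment r \<Omega> (T u) = (\<integral>\<^sup>+x. liminf (\<lambda>k. ennreal (norm (T (approx u (\<sigma> k)) x) powr r)) \<partial>lebesgue_on \<Omega>)"
    unfolding moment_def
  proof (rule nn_integral_cong_AE)
    show "AE x in lebesgue_on \<Omega>. ennreal (norm (T u x) powr r) = liminf (\<lambda>k. ennreal (norm (T (approx u (\<sigma> k)) x) powr r))"
      using \<sigma>
    proof eventually_elim
      case (elim x)
      have "(\<lambda>k. ennreal (norm (T (approx u (\<sigma> k)) x) powr r)) \<longlonglongrightarrow> ennreal (norm (T u x) powr r)"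
        by (intro tendsto_ennrealI tendsto_powr' tendsto_norm elim tendsto_const) (use r in auto)
      then show ?case by (intro lim_imp_Liminf[symmetric]) auto
    qed
  qed
  also have "\<dots> \<le> liminf (\<lambda>k. \<integral>\<^sup>+x. ennreal (norm (T (approx u (\<sigma> k)) x) powr r) \<partial>lebesgue_on \<Omega>)"
    by (rule nn_integral_liminf) measurable
  also have "\<dots> \<le> limsup (\<lambda>k. \<integral>\<^sup>+x. ennreal (norm (T (approx u (\<sigma> k)) x) powr r) \<partial>lebesgue_on \<Omega>)"
    by (rule Liminf_le_Limsup) simp
  also have "\<dots> \<le> ?c" by (rule Limsup_bounded) (use le in \<open>simp add: moment_def\<close>)
  finally show ?thesis .
qed

section \<open>Passage to arbitrary representatives\<close>

lemma T_cong:
  "u \<in> Lp_sol 2 \<Omega> \<Longrightarrow> v \<in> Lp_sol 2 \<Omega> \<Longrightarrow> AE x in lebesgue_on \<Omega>. u x = v x \<Longrightarrow> AE x in lebesgue_on \<Omega>. T u x = T v x"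
  using T unfolding bounded_operator_def by blast

text \<open>Linearity and compatibility with null sets are inherited from the larger space
  \<open>Lp_sol 2 \<Omega>\<close>; only the mapping property and the norm bound are specific to
  \<open>p\<close>.\<close>

lemma bounded_operator_Lp:
  assumes p: "2 < p" and b: "\<And>u. u \<in> Lp_sol p \<Omega> \<Longrightarrow> T u \<in> Lp p \<Omega> \<and> Lp_norm p \<Omega> (T u) \<le> c * Lp_norm p \<Omega> u"
  shows "bounded_operator p \<Omega> T"
  unfolding bounded_operator_def
proof (intro conjI ballI impI allI)
  fix u v assume uv: "u \<in> Lp_sol p \<Omega>" "v \<in> Lp_sol p \<Omega>" "AE x in lebesgue_on \<Omega>. u x = v x"
  show "AE x in lebesgue_on \<Omega>. T u x = T v x"
    by (rule T_cong[OF Lp_sol_subset[OF p uv(1)] Lp_sol_subset[OF p uv(2)] uv(3)])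
next
  fix u v assume uv: "u \<in> Lp_sol p \<Omega>" "v \<in> Lp_sol p \<Omega>"
  show "AE x in lebesgue_on \<Omega>. T (\<lambda>y. u y + v y) x = T u x + T v x"
    by (rule T_add[OF Lp_sol_subset[OF p uv(1)] Lp_sol_subset[OF p uv(2)]])
next
  fix k u assume u: "u \<in> Lp_sol p \<Omega>"
  show "AE x in lebesgue_on \<Omega>. T (\<lambda>y. k *s u y) x = k *s T u x"
    by (rule T_scale[OF Lp_sol_subset[OF p u]])
next
  show "\<exists>K. \<forall>u\<in>Lp_sol p \<Omega>. Lp_norm p \<Omega> (T u) \<le> K * Lp_norm p \<Omega> u" using b by blast
qed (use b in blast)

lemma T_Lp_sol_meas: "u \<in> Lp_sol 2 \<Omega> \<Longrightarrow> T u \<in> borel_measurable (lebesgue_on \<Omega>)"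
  using T unfolding bounded_operator_def Lp_two_iff by blast

text \<open>Since \<open>0 powr 0\<close> is 0, the bound claimed for \<open>p = \<infinity>\<close>
  asserts \<open>T u = 0\<close> when \<open>M_2 = 0\<close>, and this lemma provides it.\<close>

lemma T_zero_if_M2_zero:
  assumes "M2 = 0" "u \<in> Lp_sol 2 \<Omega>" shows "AE x in lebesgue_on \<Omega>. T u x = 0"
proof -
  have [measurable]: "T u \<in> borel_measurable (lebesgue_on \<Omega>)" by (rule T_Lp_sol_meas[OF assms(2)])
  have "(\<integral>\<^sup>+x. ennreal (norm (T u x) ^ 2) \<partial>lebesgue_on \<Omega>) = 0"
    using T_L2[OF assms(2)] assms(1) by (simp add: moment_two)
  then have "AE x in lebesgue_on \<Omega>. ennreal (norm (T u x) ^ 2) = 0"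
    by (subst (asm) nn_integral_0_iff_AE) auto
  then show ?thesis by eventually_elim simp
qed

lemma T_Lp_inf:
  assumes u: "u \<in> Lp_sol \<infinity> \<Omega>"
  shows "T u \<in> Lp \<infinity> \<Omega>" "Lp_norm \<infinity> \<Omega> (T u) \<le> Mi * (C1 * Lp_norm \<infinity> \<Omega> u)" "M2 = 0 \<Longrightarrow> Lp_norm \<infinity> \<Omega> (T u) \<le> 0"
proof -
  have u2: "u \<in> Lp_sol 2 \<Omega>" by (rule Lp_sol_subset[OF _ u]) (simp add: less_top[symmetric])
  obtain u0 where u0: "sol_ext u0" "AE x in lebesgue_on \<Omega>. u x = u0 x" using Lp_sol_representative[OF u2] by blast
  have "AE x in lebesgue_on \<Omega>. norm (u x) \<le> Lp_norm \<infinity> \<Omega> u" using u by (intro Linf_AE_le) (simp add: Lp_sol_def)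
  then have "AE x in lebesgue_on \<Omega>. norm (u0 x) \<le> Lp_norm \<infinity> \<Omega> u" using u0(2) by eventually_elim simp
  then have "AE x in lborel. norm (u0 x) \<le> Lp_norm \<infinity> \<Omega> u"
    unfolding AE_lebesgue_on[OF \<Omega>_sets(2)]
  proof eventually_elim
    case (elim x)
    then show ?case using u0(1) Lp_norm_nonneg[of \<infinity> \<Omega> u] by (cases "x \<in> \<Omega>") (auto simp: sol_ext_def)
  qed
  then have "AE x in lebesgue_on \<Omega>. norm (T u0 x) \<le> Mi * (C1 * Lp_norm \<infinity> \<Omega> u)"
    by (rule T_Linf[OF u0(1) _ Lp_norm_nonneg])
  then have le: "AE x in lebesgue_on \<Omega>. norm (T u x) \<le> Mi * (C1 * Lp_norm \<infinity> \<Omega> u)"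
    using T_cong[OF u2 sol_ext_Lp_sol[OF u0(1)] u0(2)] by eventually_elim simp
  have "Mi * (C1 * Lp_norm \<infinity> \<Omega> u) \<ge> 0" using nonneg C1_nonneg Lp_norm_nonneg[of \<infinity> \<Omega> u] by simp
  then show "T u \<in> Lp \<infinity> \<Omega>" "Lp_norm \<infinity> \<Omega> (T u) \<le> Mi * (C1 * Lp_norm \<infinity> \<Omega> u)"
    using Linf_norm_leI[OF T_Lp_sol_meas[OF u2] le] by auto
  show "Lp_norm \<infinity> \<Omega> (T u) \<le> 0" if "M2 = 0"
    by (rule Linf_norm_leI(2)[OF T_Lp_sol_meas[OF u2]]) (use T_zero_if_M2_zero[OF that u2] in \<open>auto elim: eventually_mono\<close>)
qed

lemma T_Lp_finite:
  assumes K: "truncation_const K" and r: "r > 2" and u: "u \<in> Lp_sol (ennreal r) \<Omega>"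
  shows "T u \<in> Lp (ennreal r) \<Omega>"
    and "Lp_norm (ennreal r) \<Omega> (T u) \<le>
      (strong_const K r * (C1 + 1) powr r) powr (1 / r) * M2 powr (2 / r) * Mi powr (1 - 2 / r) * Lp_norm (ennreal r) \<Omega> u"
proof -
  let ?c = "(strong_const K r * (C1 + 1) powr r) powr (1 / r) * M2 powr (2 / r) * Mi powr (1 - 2 / r)"
  let ?N = "Lp_norm (ennreal r) \<Omega> u"
  have K0: "K > 0" using K by (simp add: truncation_const_def)
  have r2: "2 < ennreal r" unfolding two_ennreal using r by (intro ennreal_lessI) auto
  have u2: "u \<in> Lp_sol 2 \<Omega>" by (rule Lp_sol_subset[OF r2 u])
  obtain u0 where u0: "sol_ext u0" "AE x in lebesgue_on \<Omega>. u x = u0 x" using Lp_sol_representative[OF u2] by blast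
  have uL: "u \<in> Lp (ennreal r) \<Omega>" using u by (simp add: Lp_sol_def)
  have mu: "moment r \<Omega> u0 = ennreal (?N powr r)"
    using moment_eq_Lp_norm[OF _ uL] moment_cong_AE[OF u0(2), where r=r] r by simp
  have sc: "strong_const K r \<ge> 0" using K0 r by (simp add: strong_const_def)
  have "moment r \<Omega> (T u) = moment r \<Omega> (T u0)"
    by (rule moment_cong_AE[OF T_cong[OF u2 sol_ext_Lp_sol[OF u0(1)] u0(2)]])
  also have "\<dots> \<le> ennreal (strong_const K r * M2 ^ 2 * Mi powr (r - 2) * C1 powr r) * moment r \<Omega> u0"
    by (rule T_strong_type[OF K u0(1) r]) (simp add: mu)
  also have "\<dots> = ennreal (strong_const K r * M2 ^ 2 * Mi powr (r - 2) * C1 powr r * ?N powr r)"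
    unfolding mu using sc by (simp add: ennreal_mult)
  also have "\<dots> \<le> ennreal ((?c * ?N) powr r)"
  proof (rule ennreal_leI)
    \<comment> \<open>The theorem asks for a positive constant, whereas only
      \<open>C1 \<ge> 0\<close> is known.\<close>
    have "C1 powr r \<le> (C1 + 1) powr r" using C1_nonneg r by (intro powr_mono2) auto
    then have "strong_const K r * M2 ^ 2 * Mi powr (r - 2) * C1 powr r * ?N powr r
        \<le> strong_const K r * M2 ^ 2 * Mi powr (r - 2) * (C1 + 1) powr r * ?N powr r"
      using sc by (intro mult_right_mono mult_left_mono) auto
    also have "\<dots> = (?c * ?N) powr r"
    proof -
      have "(?c * ?N) powr r = ((strong_const K r * (C1 + 1) powr r) powr (1 / r)) powr r * (M2 powr (2 / r)) powr r
          * (Mi powr (1 - 2 / r)) powr r * ?N powr r"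
        by (simp add: powr_mult Lp_norm_nonneg)
      also have "((strong_const K r * (C1 + 1) powr r) powr (1 / r)) powr r = strong_const K r * (C1 + 1) powr r"
        using r sc C1_nonneg by (simp add: powr_powr)
      also have "(M2 powr (2 / r)) powr r = M2 ^ 2" using r nonneg by (simp add: powr_powr powr_two)
      also have "(Mi powr (1 - 2 / r)) powr r = Mi powr (r - 2)" using r by (simp add: powr_powr left_diff_distrib)
      finally show ?thesis by (simp add: ac_simps)
    qed
    finally show "strong_const K r * M2 ^ 2 * Mi powr (r - 2) * C1 powr r * ?N powr r \<le> (?c * ?N) powr r" .
  qed
  finally have le: "moment r \<Omega> (T u) \<le> ennreal ((?c * ?N) powr r)" .
  have "?c * ?N \<ge> 0" using Lp_norm_nonneg[of "ennreal r" \<Omega> u] by simp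
  then show "T u \<in> Lp (ennreal r) \<Omega>" "Lp_norm (ennreal r) \<Omega> (T u) \<le> ?c * ?N"
    using Lp_norm_leI[OF _ T_Lp_sol_meas[OF u2] le] r by auto
qed

end

section \<open>Existence of the data and conclusion\<close>

lemma spreading_exists:
  fixes \<Omega> :: "(real^'n) set"
  assumes b: "bounded \<Omega>" and L: "lipschitz_domain \<Omega>"
  shows "\<exists>V \<rho> \<eta> R A B t0. spreading \<Omega> V \<rho> \<eta> R A B t0"
proof -
  obtain V :: "real^'n \<Rightarrow> real^'n" and \<eta> t0 where V: "smooth V" "bdd_supp V" and \<eta>: "\<eta> > 0" "t0 > 0"
    and push: "\<And>x s z. x \<in> closure \<Omega> \<Longrightarrow> 0 < s \<Longrightarrow> s \<le> t0 \<Longrightarrow> norm z \<le> \<eta> \<Longrightarrow> x + s *\<^sub>R (V x + z) \<in> \<Omega>"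
    using inward_field[OF b L] by blast
  obtain \<rho> :: "real^'n \<Rightarrow> real" where \<rho>: "mollifier \<eta> \<rho>" using mollifier_exists[OF \<eta>(1)] by blast
  then have \<rho>': "smooth \<rho>" "bdd_supp \<rho>" by (auto simp: mollifier_def)
  obtain BV where BV: "\<And>x. norm (V x) \<le> BV" using bounded_if_bdd_supp[OF smooth_continuous[OF V(1)] V(2)] by blast
  obtain A where A: "\<And>j x. norm (partial j V x) \<le> A" using smooth_partial_bounded[OF V] by blast
  obtain B where B: "\<And>x. norm (\<rho> x) \<le> B" using bounded_if_bdd_supp[OF smooth_continuous[OF \<rho>'(1)] \<rho>'(2)] by blast
  \<comment> \<open>The minimum with 1 secures \<open>t0 \<le> 1\<close> and keeps
    \<open>push\<close>, which is stated for all smaller steps.\<close>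
  have "spreading \<Omega> V \<rho> \<eta> (BV + \<eta>) A B (min t0 1)"
  proof
    show "open \<Omega>" using L by (simp add: lipschitz_domain_def)
    show "\<rho> z \<le> B" for z using B[of z] by simp
  qed (use b V \<rho> \<eta> BV A push in auto)
  then show ?thesis by blast
qed

theorem theoremA1:
  fixes \<Omega> :: "(real^'n) set" and p :: ennreal
  assumes "CARD('n) \<ge> 2"
    and "bounded \<Omega>" and "lipschitz_domain \<Omega>"
    and "2 < p"
  shows "\<exists>C>0. \<forall>(T :: (real^'n \<Rightarrow> complex^'n) \<Rightarrow> real^'n \<Rightarrow> complex^'n) (M_2 :: real) (M_inf :: real).
    bounded_operator 2 \<Omega> T \<longrightarrow>
    (\<forall>u \<in> Lp_sol 2 \<Omega>. Lp_norm 2 \<Omega> (T u) \<le> M_2 * Lp_norm 2 \<Omega> u) \<longrightarrow>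
    (\<forall>u \<in> sol_test_functions \<Omega>.
       T u \<in> Lp \<infinity> \<Omega> \<and> Lp_norm \<infinity> \<Omega> (T u) \<le> M_inf * Lp_norm \<infinity> \<Omega> u) \<longrightarrow>
    bounded_operator p \<Omega> T \<and>
    (let \<theta> = enn2real (2 / p) in
      \<forall>u \<in> Lp_sol p \<Omega>.
        Lp_norm p \<Omega> (T u) \<le> C * M_2 powr \<theta> * M_inf powr (1 - \<theta>) * Lp_norm p \<Omega> u)"
proof -
  obtain V \<rho> \<eta> R A B t0 where S: "spreading \<Omega> V \<rho> \<eta> R A B t0"
    using spreading_exists[OF assms(2,3)] by blast
  interpret S: spreading \<Omega> V \<rho> \<eta> R A B t0 by (rule S)
  obtain K where K: "K > 0" "\<forall>u s. u \<in> sol_test_functions \<Omega> \<longrightarrow> s > 0 \<longrightarrow>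
    (\<exists>g. integrable lborel g \<and> weakly_div_free g \<and> (\<forall>x. x \<notin> \<Omega> \<longrightarrow> g x = 0) \<and> (\<forall>x. norm (g x) \<le> K * s) \<and>
       (\<integral>\<^sup>+x. ennreal (norm (u x - g x) ^ 2) \<partial>lborel) \<le> ennreal K * (\<integral>\<^sup>+x. ennreal (large_part u s x) \<partial>lborel))"
    using S.solenoidal_truncation by blast
  let ?c = "S.C1 + 1"
  have c: "?c > 0" using S.C1_nonneg by linarith
  \<comment> \<open>\<open>M_2\<close> and \<open>M_inf\<close> are arbitrary reals in the theorem.
    Norms being nonnegative, the hypotheses survive the passage to positive parts.\<close>
  have op: "sol_operator \<Omega> V \<rho> \<eta> R A B t0 T (max 0 M_2) (max 0 M_inf)"
    if T: "bounded_operator 2 \<Omega> T"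
      and M2: "\<forall>u \<in> Lp_sol 2 \<Omega>. Lp_norm 2 \<Omega> (T u) \<le> M_2 * Lp_norm 2 \<Omega> u"
      and Mi: "\<forall>u \<in> sol_test_functions \<Omega>. T u \<in> Lp \<infinity> \<Omega> \<and> Lp_norm \<infinity> \<Omega> (T u) \<le> M_inf * Lp_norm \<infinity> \<Omega> u"
    for T :: "(real^'n \<Rightarrow> complex^'n) \<Rightarrow> real^'n \<Rightarrow> complex^'n" and M_2 M_inf :: real
  proof (intro sol_operator.intro S sol_operator_axioms.intro T)
    show "Lp_norm 2 \<Omega> (T u) \<le> max 0 M_2 * Lp_norm 2 \<Omega> u" if "u \<in> Lp_sol 2 \<Omega>" for u
      using M2 that by (intro order_trans[OF bspec[OF M2 that]] mult_right_mono Lp_norm_nonneg) auto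
    show "T u \<in> Lp \<infinity> \<Omega> \<and> Lp_norm \<infinity> \<Omega> (T u) \<le> max 0 M_inf * Lp_norm \<infinity> \<Omega> u" if "u \<in> sol_test_functions \<Omega>" for u
    proof
      have "Lp_norm \<infinity> \<Omega> (T u) \<le> M_inf * Lp_norm \<infinity> \<Omega> u" using Mi that by blast
      also have "\<dots> \<le> max 0 M_inf * Lp_norm \<infinity> \<Omega> u" by (intro mult_right_mono Lp_norm_nonneg) auto
      finally show "Lp_norm \<infinity> \<Omega> (T u) \<le> max 0 M_inf * Lp_norm \<infinity> \<Omega> u" .
    qed (use Mi that in blast)
  qed auto
  show ?thesis
  proof (cases "p = \<infinity>")
    case True
    show ?thesis
    proof (intro exI[of _ ?c] conjI c allI impI)
      fix T :: "(real^'n \<Rightarrow> complex^'n) \<Rightarrow> real^'n \<Rightarrow> complex^'n" and M_2 M_inf :: real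
      assume hyps: "bounded_operator 2 \<Omega> T" "\<forall>u \<in> Lp_sol 2 \<Omega>. Lp_norm 2 \<Omega> (T u) \<le> M_2 * Lp_norm 2 \<Omega> u"
        "\<forall>u \<in> sol_test_functions \<Omega>. T u \<in> Lp \<infinity> \<Omega> \<and> Lp_norm \<infinity> \<Omega> (T u) \<le> M_inf * Lp_norm \<infinity> \<Omega> u"
      interpret O: sol_operator \<Omega> V \<rho> \<eta> R A B t0 T "max 0 M_2" "max 0 M_inf" by (rule op[OF hyps])
      show "bounded_operator p \<Omega> T"
        by (rule O.bounded_operator_Lp[OF assms(4), of "max 0 M_inf * S.C1"])
          (use O.T_Lp_inf in \<open>auto simp: True mult.assoc\<close>)
      show "let \<theta> = enn2real (2 / p) in \<forall>u \<in> Lp_sol p \<Omega>.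
          Lp_norm p \<Omega> (T u) \<le> ?c * M_2 powr \<theta> * M_inf powr (1 - \<theta>) * Lp_norm p \<Omega> u"
      proof -
        have "Lp_norm \<infinity> \<Omega> (T u) \<le> ?c * M_2 powr 0 * M_inf powr 1 * Lp_norm \<infinity> \<Omega> u"
          if u: "u \<in> Lp_sol \<infinity> \<Omega>" for u
        proof -
          note le = O.T_Lp_inf[OF u]
          have rhs: "?c * M_2 powr 0 * M_inf powr 1 * Lp_norm \<infinity> \<Omega> u \<ge> 0"
            using c Lp_norm_nonneg[of \<infinity> \<Omega> u] by simp
          \<comment> \<open>If one of the constants is not positive, its positive part is 0 and
            \<open>T u\<close> has norm 0, which settles the claim because the right-hand side is
            nonnegative.\<close>
          show ?thesis
          proof (cases "M_2 > 0 \<and> M_inf > 0")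
            case True
            have "M_inf * (S.C1 * Lp_norm \<infinity> \<Omega> u) \<le> M_inf * (?c * Lp_norm \<infinity> \<Omega> u)"
              using True Lp_norm_nonneg[of \<infinity> \<Omega> u] by (intro mult_left_mono mult_right_mono) auto
            moreover have "?c * M_2 powr 0 * M_inf powr 1 * Lp_norm \<infinity> \<Omega> u = M_inf * (?c * Lp_norm \<infinity> \<Omega> u)"
              using True by simp
            moreover have "Lp_norm \<infinity> \<Omega> (T u) \<le> M_inf * (S.C1 * Lp_norm \<infinity> \<Omega> u)" using le(2) True by simp
            ultimately show ?thesis by linarith
          next
            case False
            then have "Lp_norm \<infinity> \<Omega> (T u) \<le> 0" using le(2,3) by (auto simp: max_def not_less split: if_splits)
            then show ?thesis using rhs by linarith
          qed
        qed
        then show ?thesis by (simp add: True)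
      qed
    qed
  next
    case False
    define r where "r = enn2real p"
    have p: "p = ennreal r" using False by (simp add: r_def less_top)
    have r: "r > 2" using assms(4) unfolding p S.two_ennreal by (simp add: ennreal_less_iff)
    have th: "enn2real (2 / p) = 2 / r" unfolding p S.two_ennreal using r by (simp only: divide_ennreal) simp
    let ?C = "(S.strong_const K r * ?c powr r) powr (1 / r)"
    have C: "?C > 0" using K(1) c r by (simp add: S.strong_const_def)
    show ?thesis
    proof (intro exI[of _ ?C] conjI C allI impI)
      fix T :: "(real^'n \<Rightarrow> complex^'n) \<Rightarrow> real^'n \<Rightarrow> complex^'n" and M_2 M_inf :: real
      assume hyps: "bounded_operator 2 \<Omega> T" "\<forall>u \<in> Lp_sol 2 \<Omega>. Lp_norm 2 \<Omega> (T u) \<le> M_2 * Lp_norm 2 \<Omega> u"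
        "\<forall>u \<in> sol_test_functions \<Omega>. T u \<in> Lp \<infinity> \<Omega> \<and> Lp_norm \<infinity> \<Omega> (T u) \<le> M_inf * Lp_norm \<infinity> \<Omega> u"
      interpret O: sol_operator \<Omega> V \<rho> \<eta> R A B t0 T "max 0 M_2" "max 0 M_inf" by (rule op[OF hyps])
      have tc: "S.truncation_const K" using K by (simp add: S.truncation_const_def)
      note le = O.T_Lp_finite[OF tc r]
      show "bounded_operator p \<Omega> T"
        by (rule O.bounded_operator_Lp[OF assms(4)]) (use le in \<open>auto simp: p\<close>)
      \<comment> \<open>For \<open>M < 0\<close> the left-hand side is \<open>0 powr e\<close>,
        which is 0, and \<open>powr\<close> is nonnegative at every base.\<close>
      have mono: "max 0 M powr e \<le> M powr e" for M e :: real
        by (cases "M \<ge> 0") (auto simp: max_def)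
      have "Lp_norm (ennreal r) \<Omega> (T u) \<le> ?C * M_2 powr (2 / r) * M_inf powr (1 - 2 / r) * Lp_norm (ennreal r) \<Omega> u"
        if "u \<in> Lp_sol (ennreal r) \<Omega>" for u
        using C by (intro order_trans[OF le(2)[OF that]] mult_right_mono mult_mono mono Lp_norm_nonneg order_refl) auto
      then show "let \<theta> = enn2real (2 / p) in \<forall>u \<in> Lp_sol p \<Omega>.
          Lp_norm p \<Omega> (T u) \<le> ?C * M_2 powr \<theta> * M_inf powr (1 - \<theta>) * Lp_norm p \<Omega> u"
        unfolding th by (simp add: p)
    qed
  qed
qed

end
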